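(* Let $\phi: M_3(\mathbb{C})\to M_3(\mathbb{C})$ be a PPT map. Then the composition $\phi\circ\phi$ is separable (entanglement breaking), i.e. its Choi matrix $C_{\phi\circ\phi}=\sum_{i,j=0}^{2}|i\rangle\langle j|\otimes(\phi\circ\phi)(|i\rangle\langle j|)\in M_3\otimes M_3$ is a separable positive semidefinite matrix.
   Context: A linear map $\phi: M_n(\mathbb{C})\to M_n(\mathbb{C})$ is called a PPT map if it is both completely positive and completely copositive (i.e. both $\phi$ and $T\circ\phi$ are completely positive, where $T$ is the transpose). A positive semidefinite matrix in $M_m\otimes M_n$ is separable if it is a convex combination (nonnegative combination) of product matrices $\alpha\otimes\beta$ with $\alpha,\beta$ positive semidefinite. A map $\psi$ on $M_n$ is called separable (entanglement breaking) if its Choi matrix $C_\psi=\sum_{i,j}|i\rangle\langle j|\otimes\psi(|i\rangle\langle j|)$ is separable. *)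

theory Defs
  imports "Jordan_Normal_Form.Matrix"
begin

definition psd_mat :: "nat \<Rightarrow> complex mat \<Rightarrow> bool" where
  "psd_mat n A \<longleftrightarrow> A \<in> carrier_mat n n \<and>
     (\<forall>i<n. \<forall>j<n. A $$ (i,j) = cnj (A $$ (j,i))) \<and>
     (\<forall>v :: nat \<Rightarrow> complex.
        (\<Sum>i<n. \<Sum>j<n. cnj (v i) * A $$ (i,j) * v j) \<in> \<real> \<and>
        Re (\<Sum>i<n. \<Sum>j<n. cnj (v i) * A $$ (i,j) * v j) \<ge> 0)"

definition linear_map_mat :: "nat \<Rightarrow> (complex mat \<Rightarrow> complex mat) \<Rightarrow> bool" where
  "linear_map_mat n \<phi> \<longleftrightarrow>
     (\<forall>A \<in> carrier_mat n n. \<phi> A \<in> carrier_mat n n) \<and>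
     (\<forall>A \<in> carrier_mat n n. \<forall>B \<in> carrier_mat n n. \<phi> (A + B) = \<phi> A + \<phi> B) \<and>
     (\<forall>A \<in> carrier_mat n n. \<forall>c::complex. \<phi> (c \<cdot>\<^sub>m A) = c \<cdot>\<^sub>m \<phi> A)"

text \<open>The ampliation id_k \<otimes> \<phi> acting on M_k(M_n) = M_(k*n): the (a,b) block of X
  (of size n x n) is replaced by \<phi> applied to it.\<close>
definition block_mat :: "nat \<Rightarrow> complex mat \<Rightarrow> nat \<Rightarrow> nat \<Rightarrow> complex mat" where
  "block_mat n X a b = mat n n (\<lambda>(i,j). X $$ (a*n + i, b*n + j))"

definition ampliation :: "nat \<Rightarrow> nat \<Rightarrow> (complex mat \<Rightarrow> complex mat) \<Rightarrow> complex mat \<Rightarrow> complex mat" where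
  "ampliation k n \<phi> X = mat (k*n) (k*n)
     (\<lambda>(r,s). \<phi> (block_mat n X (r div n) (s div n)) $$ (r mod n, s mod n))"

definition completely_positive :: "nat \<Rightarrow> (complex mat \<Rightarrow> complex mat) \<Rightarrow> bool" where
  "completely_positive n \<phi> \<longleftrightarrow>
     (\<forall>k. \<forall>X. psd_mat (k*n) X \<longrightarrow> psd_mat (k*n) (ampliation k n \<phi> X))"

definition completely_copositive :: "nat \<Rightarrow> (complex mat \<Rightarrow> complex mat) \<Rightarrow> bool" where
  "completely_copositive n \<phi> \<longleftrightarrow> completely_positive n (\<lambda>A. transpose_mat (\<phi> A))"

definition PPT_map :: "nat \<Rightarrow> (complex mat \<Rightarrow> complex mat) \<Rightarrow> bool" where
  "PPT_map n \<phi> \<longleftrightarrow> linear_map_mat n \<phi> \<and> completely_positive n \<phi> \<and> completely_copositive n \<phi>"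

definition mat_unit :: "nat \<Rightarrow> nat \<Rightarrow> nat \<Rightarrow> complex mat" where
  "mat_unit n i j = mat n n (\<lambda>(a,b). if a = i \<and> b = j then 1 else 0)"

text \<open>Choi matrix C_\<psi> = \<Sum>_{i,j} |i><j| \<otimes> \<psi>(|i><j|) in M_n \<otimes> M_n, with the Kronecker
  convention (r,s) = (i*n + a, j*n + b).\<close>
definition choi_mat :: "nat \<Rightarrow> (complex mat \<Rightarrow> complex mat) \<Rightarrow> complex mat" where
  "choi_mat n \<psi> = mat (n*n) (n*n)
     (\<lambda>(r,s). \<psi> (mat_unit n (r div n) (s div n)) $$ (r mod n, s mod n))"

definition kron_mat :: "nat \<Rightarrow> nat \<Rightarrow> complex mat \<Rightarrow> complex mat \<Rightarrow> complex mat" where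
  "kron_mat m n \<alpha> \<beta> = mat (m*n) (m*n)
     (\<lambda>(r,s). \<alpha> $$ (r div n, s div n) * \<beta> $$ (r mod n, s mod n))"

text \<open>Separable: positive semidefinite and a finite sum of products \<alpha> \<otimes> \<beta> with \<alpha>, \<beta> psd
  (nonnegative coefficients are absorbed into \<alpha>).\<close>
definition separable_mat :: "nat \<Rightarrow> nat \<Rightarrow> complex mat \<Rightarrow> bool" where
  "separable_mat m n C \<longleftrightarrow> psd_mat (m*n) C \<and>
     (\<exists>(N::nat) \<alpha> \<beta>. (\<forall>l<N. psd_mat m (\<alpha> l) \<and> psd_mat n (\<beta> l)) \<and>
        C = mat (m*n) (m*n) (\<lambda>(r,s). \<Sum>l<N. kron_mat m n (\<alpha> l) (\<beta> l) $$ (r,s)))"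

definition separable_map :: "nat \<Rightarrow> (complex mat \<Rightarrow> complex mat) \<Rightarrow> bool" where
  "separable_map n \<psi> \<longleftrightarrow> separable_mat n n (choi_mat n \<psi>)"

end

theory Submission
  imports Defs "HOL-Analysis.Analysis" "HOL-Computational_Algebra.Fundamental_Theorem_Algebra"
begin

text \<open>By duality it suffices to pair the Choi matrix of $\phi \circ \phi$ with a block positive $W$. Moving one
  copy of $\phi$ over to $W$ produces a form that is positive on vectors of Schmidt rank at most two,
  because a PPT matrix in $M_2 \otimes M_3$ pairs nonnegatively with block positive ones. By Choi's Schur
  complement such a form is completely positive plus a block positive form on $M_2 \otimes M_3$, so it
  pairs nonnegatively with the PPT Choi matrix of $\phi$.

  For $M_2 \otimes M_3$ one has to find a product vector $e \otimes f$ in the range of a PPT matrix with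
  $\bar e \otimes f$ in the range of its partial transpose. After normalisation the matrix has blocks
  $1, S, S^*, T$ with $T \ge S^* S$ and $T \ge S S^*$. If one of the two defects has rank at least two
  and the other is nonzero, a degree argument (Brouwer) produces the vector; if both have rank one,
  $S$ has a normal dilation of size four, and an eigenvector of it does the job; otherwise $S$ is normal.\<close>

text \<open>The conditions on the product vector involve a parameter together with its conjugate, so
  they are not holomorphic and algebraic closedness alone does not solve them. With \<alpha> = 1 and
  \<beta> = w the unknowns are the number w and a vector f in C^3, and a defect of rank r imposes 3
  - r linear equations on f. Ranks two and one give three equations, that is, the vanishing of one
  determinant, whose leading term w (cnj w)^2 has winding number -1. Two defects of rank one give
  four equations for three coordinates, and counting no longer helps; what helps is that the
  difference of the defects is the commutator of \<open>S\<close> and \<open>adj S\<close>, which is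
  exactly the condition for a normal matrix of size four with corner \<open>S\<close>. Dimension
  three matters once more in the duality argument: taking one index away from three leaves two,
  where only product vectors have to be tested.\<close>

hide_const (open) Matrix.mat Matrix.vec
no_notation Matrix.vec_index (infixl "$" 100)

section \<open>Hermitian linear algebra in \<open>complex^'n\<close>\<close>

definition cip :: "complex^'n \<Rightarrow> complex^'n \<Rightarrow> complex" where
  "cip x y = (\<Sum>i\<in>UNIV. cnj (x$i) * y$i)"

definition adj :: "complex^'n^'m \<Rightarrow> complex^'m^'n" where
  "adj A = (\<chi> i j. cnj (A$j$i))"

definition outer :: "complex^'n \<Rightarrow> complex^'m \<Rightarrow> complex^'m^'n" where
  "outer x y = (\<chi> i j. x$i * cnj (y$j))"

lemma cip_simps:
  "cip x (y + z) = cip x y + cip x z" "cip (x + y) z = cip x z + cip y z"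
  "cip x (y - z) = cip x y - cip x z" "cip (x - y) z = cip x z - cip y z"
  "cip x (- y) = - cip x y" "cip (- x) y = - cip x y"
  "cip x (c *s y) = c * cip x y" "cip (c *s x) y = cnj c * cip x y"
  "cip x 0 = 0" "cip 0 x = 0"
  by (simp_all add: cip_def sum.distrib sum_subtractf sum_negf sum_distrib_left algebra_simps)

lemma cnj_cip: "cnj (cip x y) = cip y x"
  by (simp add: cip_def mult.commute)

lemma cip_self: "cip x x = of_real ((norm x)\<^sup>2)"
  by (simp add: cip_def norm_vec_def L2_set_def sum_nonneg complex_norm_square mult.commute del: of_real_power)

lemma cip_eq_0 [simp]: "cip x x = 0 \<longleftrightarrow> x = 0"
  by (simp add: cip_self)

lemma cip_adj: "cip x (A *v y) = cip (adj A *v x) y"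
proof -
  have "cip x (A *v y) = (\<Sum>i\<in>UNIV. \<Sum>j\<in>UNIV. cnj (x$i) * A$i$j * y$j)"
    by (simp add: cip_def matrix_vector_mult_def sum_distrib_left mult.assoc)
  also have "\<dots> = (\<Sum>j\<in>UNIV. \<Sum>i\<in>UNIV. cnj (x$i) * A$i$j * y$j)"
    by (rule sum.swap)
  also have "\<dots> = cip (adj A *v x) y"
    by (simp add: cip_def adj_def matrix_vector_mult_def sum_distrib_left sum_distrib_right mult_ac)
  finally show ?thesis .
qed

lemma adj_adj [simp]: "adj (adj A) = A"
  by (simp add: adj_def vec_eq_iff)

lemma cip_adj2: "cip (A *v x) y = cip x (adj A *v y)"
  by (simp add: cip_adj)

lemma adj_simps: "adj (A + B) = adj A + adj B" "adj (A - B) = adj A - adj B"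
  "adj 0 = 0"
  by (simp_all add: adj_def vec_eq_iff)

lemma adj_mult: "adj (A ** B) = adj B ** adj A"
  by (simp add: adj_def vec_eq_iff matrix_matrix_mult_def mult.commute)

lemma outer_mv: "outer x y *v w = cip y w *s x"
  by (simp add: outer_def cip_def matrix_vector_mult_def vec_eq_iff sum_distrib_left mult_ac)

lemma mv_smult: "A *v (c *s x) = c *s (A *v x)" for A :: "complex^'n^'m"
  by (simp add: vec.scale)

lemma mv_simps:
  fixes A :: "complex^'n^'m"
  shows "A *v (x + y) = A *v x + A *v y" "A *v (x - y) = A *v x - A *v y"
   "(A + B) *v x = A *v x + B *v x" "(A - B) *v x = A *v x - B *v x"
   "A *v (c *s x) = c *s (A *v x)" "A *v (- x) = - (A *v x)"
  apply (simp_all add: matrix_vector_mult_add_rdistrib matrix_vector_mult_diff_distrib mv_smult matrix_vector_right_distrib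
     matrix_vector_mult_diff_rdistrib)
  apply (metis diff_0 matrix_vector_mult_0_right matrix_vector_mult_diff_distrib)
  done

lemma cip_ext: "(\<And>u. cip u x = cip u y) \<Longrightarrow> x = y"
  by (metis cip_eq_0 cip_simps(3) right_minus_eq)

lemma trace_outer: "trace (A ** outer x y) = cip y (A *v x)"
  by (simp add: trace_def outer_def matrix_matrix_mult_def cip_def matrix_vector_mult_def sum_distrib_left mult_ac)

lemma adj_outer: "adj (outer x y) = outer y x"
  by (simp add: adj_def outer_def vec_eq_iff mult.commute)

lemma trace_adj: "trace (adj A) = cnj (trace A)"
  by (simp add: trace_def adj_def)

definition psd :: "complex^'n^'n \<Rightarrow> bool" where
  "psd A \<longleftrightarrow> adj A = A \<and> (\<forall>v. 0 \<le> Re (cip v (A *v v)))"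

text \<open>With the phase of \<open>c\<close> opposite to that of \<open>s\<close> the hypothesis
  becomes a real quadratic in a parameter t, minimal at t = 1/r if r > 0. If r <= 0, boundedness
  from below forces s = 0 and then r = 0.\<close>

lemma quad_CS:
  fixes p r :: real and s :: complex
  assumes "\<And>c::complex. 0 \<le> p + 2 * Re (c * s) + (cmod c)\<^sup>2 * r"
  shows "(cmod s)\<^sup>2 \<le> p * r"
proof -
  have p: "0 \<le> p" using assms[of 0] by simp
  have q: "0 \<le> p - 2 * t * (cmod s)\<^sup>2 + t\<^sup>2 * (cmod s)\<^sup>2 * r" for t :: real
  proof -
    have "Re (- (of_real t * cnj s) * s) = - t * (cmod s)\<^sup>2"
      unfolding cmod_power2 by (simp add: power2_eq_square algebra_simps)
    moreover have "(cmod (- (of_real t * cnj s)))\<^sup>2 = t\<^sup>2 * (cmod s)\<^sup>2"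
      by (simp add: norm_mult power_mult_distrib)
    ultimately show ?thesis
      using assms[of "- (of_real t * cnj s)"] by (simp add: algebra_simps)
  qed
  show ?thesis
  proof (cases "r > 0")
    case True
    have "0 \<le> p - (cmod s)\<^sup>2 / r"
      using q[of "1/r"] True by (simp add: power2_eq_square field_simps)
    then show ?thesis using True by (simp add: field_simps)
  next
    case False
    show ?thesis
    proof (cases "s = 0")
      case True
      have "0 \<le> r"
      proof (rule ccontr)
        assume "\<not> 0 \<le> r"
        \<comment> \<open>The chosen scalar c satisfies |c|^2 r = -(p + 1), which is too
          small.\<close>
        have "0 \<le> p + (cmod (of_real (sqrt ((p + 1) / - r))))\<^sup>2 * r"
          using assms[of "of_real (sqrt ((p + 1) / - r))"] True by simp
        moreover have "(p + 1) / - r \<ge> 0" using p \<open>\<not> 0 \<le> r\<close> by (simp add: divide_nonneg_neg divide_nonneg_pos)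
        ultimately show False using p \<open>\<not> 0 \<le> r\<close> by (simp add: real_sqrt_pow2)
      qed
      then show ?thesis using True p by simp
    next
      case s: False
      then have s2: "(cmod s)\<^sup>2 > 0" by simp
      have "t\<^sup>2 * (cmod s)\<^sup>2 * r \<le> 0" for t :: real
        using False by (simp add: mult_nonneg_nonpos)
      then have "0 \<le> p - 2 * t * (cmod s)\<^sup>2" for t using q[of t] by (smt (verit))
      \<comment> \<open>At this value the linear bound equals -1.\<close>
      from this[of "(p + 1) / (2 * (cmod s)\<^sup>2)"] show ?thesis using s2 p by (simp add: field_simps)
    qed
  qed
qed

lemma Re_cip_sym: "Re (cip x y) = Re (cip y x)"
  by (metis cnj_cip complex_cnj(1) complex.sel(1) cnj.simps(1))

lemma psd_CS:
  assumes "psd A"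
  shows "(cmod (cip u (A *v v)))\<^sup>2 \<le> Re (cip u (A *v u)) * Re (cip v (A *v v))"
proof (rule quad_CS)
  fix c :: complex
  have h: "cip v (A *v u) = cnj (cip u (A *v v))" 
    using assms unfolding psd_def by (metis cip_adj cnj_cip)
  have "0 \<le> Re (cip (u + c *s v) (A *v (u + c *s v)))" using assms by (simp add: psd_def)
  also have "\<dots> = Re (cip u (A *v u)) + 2 * Re (c * cip u (A *v v)) + Re (cnj c * c * cip v (A *v v))"
    by (simp add: mv_simps cip_simps h algebra_simps)
  also have "Re (cnj c * c * cip v (A *v v)) = (cmod c)\<^sup>2 * Re (cip v (A *v v))"
    unfolding mult.commute[of "cnj c" c] complex_norm_square[symmetric] by simp
  finally show "0 \<le> Re (cip u (A *v u)) + 2 * Re (c * cip u (A *v v)) + (cmod c)\<^sup>2 * Re (cip v (A *v v))" .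
qed

text \<open>The conjugates of \<open>a\<close> and \<open>b\<close>, completed by a zero row, form a
  singular matrix; \<open>u\<close> spans part of its kernel. Repeating an argument, as in
  \<open>ex_orth2[of g g]\<close>, serves for a single condition.\<close>

lemma ex_orth2:
  fixes a b :: "complex^3"
  shows "\<exists>u. u \<noteq> 0 \<and> cip a u = 0 \<and> cip b u = 0"
proof -
  define M :: "complex^3^3" where "M = (\<chi> i. if i = 1 then (\<chi> j. cnj (a$j)) else if i = 2 then (\<chi> j. cnj (b$j)) else 0)"
  have "det M = 0" by (simp add: det_3 M_def)
  then have "\<not> (\<forall>x. M *v x = 0 \<longrightarrow> x = 0)"
    using invertible_det_nz[of M] invertible_left_inverse[of M] matrix_left_invertible_ker[of M] by blast
  then obtain u where u: "u \<noteq> 0" "M *v u = 0" by blast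
  then have "(M *v u) $ 1 = 0" "(M *v u) $ 2 = 0" by simp_all
  then have "cip a u = 0 \<and> cip b u = 0"
    by (simp add: M_def cip_def matrix_vector_mult_def)
  then show ?thesis using u by blast
qed

lemma basis3:
  fixes a b c v :: "complex^3"
  assumes "\<And>r s t. r *s a + s *s b + t *s c = 0 \<Longrightarrow> r = 0 \<and> s = 0 \<and> t = 0"
  shows "\<exists>r s t. v = r *s a + s *s b + t *s c"
proof -
  define M :: "complex^3^3" where "M = (\<chi> i j. if j = 1 then a$i else if j = 2 then b$i else c$i)"
  have M: "M *v x = x$1 *s a + x$2 *s b + x$3 *s c" for x
    by (simp add: M_def matrix_vector_mult_def vec_eq_iff sum_3 mult.commute)
  have "x = 0" if "M *v x = 0" for x
    using assms[of "x$1" "x$2" "x$3"] that by (simp add: M vec_eq_iff forall_3)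
  then have "\<forall>x. M *v x = 0 \<longrightarrow> x = 0" by blast
  then obtain B where "B ** M = Finite_Cartesian_Product.mat 1"
    using matrix_left_invertible_ker[of M] by blast
  then have "M ** B = Finite_Cartesian_Product.mat 1"
    using matrix_left_right_inverse by blast
  then have "M *v (B *v v) = v"
    by (simp add: matrix_vector_mul_assoc)
  then show ?thesis using M by metis
qed

text \<open>\<open>x\<close> completes \<open>a\<close>, \<open>b\<close> to a basis, and the part
  of \<open>s\<close> in the span of \<open>a\<close>, \<open>b\<close> is orthogonal to
  itself.\<close>

lemma orth_span:
  fixes a b x s :: "complex^3"
  assumes ind: "\<And>r t. r *s a + t *s b = 0 \<Longrightarrow> r = 0 \<and> t = 0"
    and x: "x \<noteq> 0" "cip a x = 0" "cip b x = 0"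
    and s: "cip a s = 0" "cip b s = 0"
  shows "\<exists>c. s = c *s x"
proof -
  have ind3: "r = 0 \<and> s = 0 \<and> t = 0" if h: "r *s a + s *s b + t *s x = 0" for r s t
  proof -
    have "cip x (r *s a + s *s b + t *s x) = t * cip x x"
      using x cnj_cip[of a x] cnj_cip[of b x] by (simp add: cip_simps)
    then have "t = 0" using h x by (simp add: cip_simps)
    then show ?thesis using h ind by auto
  qed
  obtain r q t where sv: "s = r *s a + q *s b + t *s x"
    using basis3[of a b x s] ind3 by blast
  have "cip (r *s a + q *s b) (r *s a + q *s b) = cip (r *s a + q *s b) (s - t *s x)"
    by (simp add: sv)
  also have "\<dots> = 0" using x s by (simp add: cip_simps)
  finally have "r *s a + q *s b = 0" by simp
  then show ?thesis using sv by auto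
qed

lemma psd_eq_0:
  assumes "psd Y" "\<And>a. Re (cip a (Y *v a)) = 0"
  shows "Y = 0"
proof -
  have "Y *v v = 0 *v v" for v
  proof (rule cip_ext)
    fix u show "cip u (Y *v v) = cip u (0 *v v)"
      using psd_CS[OF assms(1), of u v] assms(2) by (simp add: cip_simps)
  qed
  then show ?thesis by (simp add: matrix_eq)
qed

text \<open>The scaling of \<open>y\<close> is the one for which \<open>psd_CS\<close> in direction
  \<open>a\<close> is just enough: positivity survives the subtraction while \<open>a\<close> moves
  into the kernel. Repeating the step reads off the rank.\<close>

lemma psd_schur:
  assumes Y: "psd Y" and a: "Re (cip a (Y *v a)) > 0"
  defines "y \<equiv> of_real (1 / sqrt (Re (cip a (Y *v a)))) *s (Y *v a)"
  shows "psd (Y - outer y y)" "(Y - outer y y) *v a = 0" "y \<noteq> 0"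
proof -
  define r where "r = Re (cip a (Y *v a))"
  have r: "r > 0" using a by (simp add: r_def)
  have her: "cip u (Y *v v) = cip (Y *v u) v" for u v
    using Y by (metis cip_adj psd_def)
  have "cip a (Y *v a) = cnj (cip a (Y *v a))"
    by (metis cnj_cip her)
  then have ra: "cip a (Y *v a) = of_real r"
    by (simp add: r_def complex_eq_iff)
  have yv: "cip y v = of_real (1 / sqrt r) * cip a (Y *v v)" for v
    by (simp add: y_def r_def cip_simps her)
  show "psd (Y - outer y y)"
    unfolding psd_def
  proof (intro conjI allI)
    show "adj (Y - outer y y) = Y - outer y y"
      using Y by (simp add: adj_simps adj_outer psd_def)
    fix v
    have "cip v (outer y y *v v) = cip y v * cnj (cip y v)"
      by (simp add: outer_mv cip_simps cnj_cip)
    also have "\<dots> = of_real ((cmod (cip y v))\<^sup>2)"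
      by (simp only: complex_norm_square)
    also have "(cmod (cip y v))\<^sup>2 = (cmod (cip a (Y *v v)))\<^sup>2 / r"
      using r by (simp add: yv norm_mult norm_divide power_mult_distrib power_divide)
    finally have "cip v (outer y y *v v) = of_real ((cmod (cip a (Y *v v)))\<^sup>2 / r)" .
    then show "0 \<le> Re (cip v ((Y - outer y y) *v v))"
      using psd_CS[OF Y, of a v] r
      by (simp add: mv_simps cip_simps r_def[symmetric] field_simps del: of_real_power of_real_divide)
  qed
  have "sqrt r * sqrt r = r" using r by simp
  then have "of_real r * of_real (1 / sqrt r) * of_real (1 / sqrt r) = (1::complex)"
    using r unfolding of_real_mult[symmetric] by simp
  then show "(Y - outer y y) *v a = 0"
    unfolding mv_simps outer_mv yv ra unfolding y_def r_def[symmetric]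
    by (simp add: mult_ac)
  show "y \<noteq> 0"
  proof
    assume "y = 0" then have "cip y a = 0" by (simp add: cip_simps)
    then show False using yv[of a] ra r by simp
  qed
qed

text \<open>The cases are rank zero, one, and at least two. In the last case the range contains a
  plane, given by its normal \<open>u\<close>, so that a single linear equation ensures membership
  in the range.\<close>

lemma psd_cases3:
  fixes Y :: "complex^3^3"
  assumes Y: "psd Y"
  obtains "Y = 0" | y where "y \<noteq> 0" "Y = outer y y"
    | u where "u \<noteq> 0" "\<And>v. cip u v = 0 \<Longrightarrow> \<exists>q. v = Y *v q"
proof (cases "\<exists>a. Re (cip a (Y *v a)) \<noteq> 0")
  case False
  then show ?thesis using psd_eq_0[OF Y] that(1) by blast
next
  case True
  then obtain a where a: "Re (cip a (Y *v a)) > 0"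
    using Y by (metis order_le_less psd_def)
  define y where "y = of_real (1 / sqrt (Re (cip a (Y *v a)))) *s (Y *v a)"
  define Z where "Z = Y - outer y y"
  have Z: "psd Z" "Z *v a = 0" and y0: "y \<noteq> 0"
    using psd_schur[OF Y a] by (simp_all add: Z_def y_def)
  show ?thesis
  proof (cases "\<exists>b. Re (cip b (Z *v b)) \<noteq> 0")
    case False
    then have "Z = 0" using psd_eq_0[OF Z(1)] by blast
    then show ?thesis using that(2)[OF y0] by (simp add: Z_def)
  next
    case True
    then obtain b where b: "Re (cip b (Z *v b)) > 0"
      using Z by (metis order_le_less psd_def)
    have aZ: "cip a (Z *v b) = 0"
      using Z by (metis cip_adj cip_simps(10) psd_def)
    \<comment> \<open>If \<open>Y\<close> kills w = r a + s b, then both nonnegative summands of Y =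
      Z + \<open>outer y y\<close> vanish on w, and the \<open>Z\<close> part sees only s.\<close>
    have ind: "r = 0 \<and> s = 0" if h: "r *s (Y *v a) + s *s (Y *v b) = 0" for r s
    proof -
      define w where "w = r *s a + s *s b"
      have "Y *v w = 0" using h by (simp add: w_def mv_simps)
      moreover have "Y = Z + outer y y" by (simp add: Z_def)
      ultimately have "Re (cip w (Z *v w)) + Re (cip w (outer y y *v w)) = 0"
        by (metis cip_simps(1,9) matrix_vector_mult_add_rdistrib plus_complex.sel(1) zero_complex.sel(1))
      moreover have "cip w (outer y y *v w) = of_real ((cmod (cip y w))\<^sup>2)"
        unfolding complex_norm_square by (simp add: outer_mv cip_simps cnj_cip)
      moreover have "0 \<le> Re (cip w (Z *v w))" using Z by (simp add: psd_def)
      ultimately have "Re (cip w (Z *v w)) = 0"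
        by (smt (verit) Re_complex_of_real zero_le_power2)
      moreover have "cip w (Z *v w) = (s * cnj s) * cip b (Z *v b)"
        by (simp add: w_def mv_simps cip_simps Z aZ)
      then have "Re (cip w (Z *v w)) = (cmod s)\<^sup>2 * Re (cip b (Z *v b))"
        unfolding complex_norm_square[symmetric] by simp
      ultimately have s: "s = 0" using b by simp
      have "Y *v a \<noteq> 0" using a by (auto simp: cip_simps)
      then show ?thesis using s h by simp
    qed
    obtain u where u: "u \<noteq> 0" "cip (Y *v a) u = 0" "cip (Y *v b) u = 0"
      using ex_orth2 by blast
    have u': "cip u (Y *v a) = 0" "cip u (Y *v b) = 0"
      using u by (metis cnj_cip complex_cnj_zero)+
    have ind3: "r = 0 \<and> s = 0 \<and> t = 0" if h: "r *s (Y *v a) + s *s (Y *v b) + t *s u = 0" for r s t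
    proof -
      have "cip u (r *s (Y *v a) + s *s (Y *v b) + t *s u) = t * cip u u"
        by (simp add: cip_simps u')
      then have "t = 0" using h u by (simp add: cip_simps)
      then show ?thesis using h ind by auto
    qed
    show ?thesis
    proof (rule that(3)[OF u(1)])
      fix v assume v: "cip u v = 0"
      obtain r s t where e: "v = r *s (Y *v a) + s *s (Y *v b) + t *s u"
        using basis3 ind3 by blast
      have "t * cip u u = 0" using v by (simp add: e cip_simps u')
      then have "t = 0" using u by simp
      then have "v = Y *v (r *s a + s *s b)" by (simp add: e mv_simps)
      then show "\<exists>q. v = Y *v q" ..
    qed
  qed
qed

section \<open>Product vectors in the range of a PPT matrix\<close>

text \<open>The map \<open>J\<close> plays the role of multiplication by the imaginary unit; this form of the lemma covers
  invariant subspaces of $C^n$ and of $C^n \times C$ at once.\<close>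

lemma eigenvector_exists:
  fixes A J :: "'a::euclidean_space \<Rightarrow> 'a"
  assumes A: "linear A" and J: "linear J" and JJ: "\<And>v. J (J v) = - v"
    and AJ: "\<And>v. A (J v) = J (A v)" and U: "subspace U"
    and JU: "\<And>v. v \<in> U \<Longrightarrow> J v \<in> U" and AU: "\<And>v. v \<in> U \<Longrightarrow> A v \<in> U"
    and v0: "v0 \<in> U" "v0 \<noteq> 0"
  obtains h w where "h \<in> U" "h \<noteq> 0" "A h = Re w *\<^sub>R h + Im w *\<^sub>R J h"
proof -
  define sc where "sc c v = Re c *\<^sub>R v + Im c *\<^sub>R J v" for c v
  have sc_add: "sc (c + d) v = sc c v + sc d v" "sc c (v + w) = sc c v + sc c w" for c d v w
    by (simp_all add: sc_def algebra_simps linear_add[OF J])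
  have sc_mult: "sc (c * d) v = sc c (sc d v)" for c d v
    by (simp add: sc_def algebra_simps linear_add[OF J] linear_scale[OF J] JJ)
  have sc_0 [simp]: "sc 0 v = 0" "sc c 0 = 0" "sc 1 v = v" for c v
    by (simp_all add: sc_def linear_0[OF J])
  have A_sc: "A (sc c v) = sc c (A v)" for c v
    by (simp add: sc_def linear_add[OF A] linear_scale[OF A] AJ)
  have sc_U: "sc c v \<in> U" if "v \<in> U" for c v
    using that U JU by (simp add: sc_def subspace_add subspace_scale)
  have sc_sum: "sc c (\<Sum>k\<in>I. f k) = (\<Sum>k\<in>I. sc c (f k))" if "finite I" for c f and I :: "nat set"
    using that by induction (simp_all add: sc_add)
  \<comment> \<open>\<open>ev p v\<close> is p(A) v, the complex coefficients acting through
    \<open>sc\<close>.\<close>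
  define ev where "ev p v = (\<Sum>k\<le>degree p. sc (coeff p k) ((A ^^ k) v))" for p v
  have ev_ge: "ev p v = (\<Sum>k\<le>N. sc (coeff p k) ((A ^^ k) v))" if "degree p \<le> N" for p v N
    unfolding ev_def using that
    by (intro sum.mono_neutral_left) (auto simp: coeff_eq_0)
  have ev_add: "ev (p + q) v = ev p v + ev q v" for p q v
  proof -
    define N where "N = max (degree p) (degree q)"
    have "degree (p + q) \<le> N" "degree p \<le> N" "degree q \<le> N" 
      by (simp_all add: N_def degree_add_le_max)
    then show ?thesis by (simp add: ev_ge sc_add sum.distrib)
  qed
  have ev_smult: "ev (smult c p) v = sc c (ev p v)" for c p v
    by (simp add: ev_ge[OF degree_smult_le] sc_mult sc_sum ev_def)
  have ev_shift: "ev (pCons 0 p) v = A (ev p v)" for p v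
  proof -
    have "ev (pCons 0 p) v = (\<Sum>k\<le>Suc (degree p). sc (coeff (pCons 0 p) k) ((A ^^ k) v))"
      by (rule ev_ge) (simp add: degree_pCons_le)
    also have "\<dots> = (\<Sum>k\<le>degree p. sc (coeff p k) (A ((A ^^ k) v)))"
      by (simp add: sum.atMost_Suc_shift del: sum.atMost_Suc)
    also have "\<dots> = A (ev p v)"
      by (simp add: ev_def linear_sum[OF A] A_sc)
    finally show ?thesis .
  qed
  have ev_U: "ev p v \<in> U" if "v \<in> U" for p v
  proof -
    have "(A ^^ k) v \<in> U" for k by (induction k) (simp_all add: that AU)
    then show ?thesis unfolding ev_def by (intro subspace_sum[OF U] sc_U)
  qed
  have ev_0: "ev 0 v = 0" for v by (simp add: ev_def)
  have ev_sum: "ev (\<Sum>k\<in>I. f k) v = (\<Sum>k\<in>I. ev (f k) v)" if "finite I" for f v and I :: "nat set"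
    using that by induction (simp_all add: ev_add ev_0)
  have ev_monom: "ev (monom c k) v = sc c ((A ^^ k) v)" for c k v
  proof -
    have "ev (monom c k) v = (\<Sum>i\<le>k. sc (coeff (monom c k) i) ((A ^^ i) v))"
      by (rule ev_ge) (rule degree_monom_le)
    also have "\<dots> = (\<Sum>i\<le>k. if i = k then sc c ((A ^^ k) v) else 0)"
      by (intro sum.cong) (auto simp: coeff_monom)
    finally show ?thesis by simp
  qed
  \<comment> \<open>Among DIM + 1 iterates of \<open>v0\<close> there is a real linear relation.
    Coinciding iterates are treated apart, since the set of iterates is then smaller.\<close>
  have ex: "\<exists>p. p \<noteq> 0 \<and> ev p v0 = 0"
  proof -
    define N where "N = DIM('a)"
    define F where "F k = (A ^^ k) v0" for k
    show ?thesis
    proof (cases "inj_on F {..N}")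
      case False
      then obtain i j where ij: "i \<noteq> j" "F i = F j" by (auto simp: inj_on_def)
      define p :: "complex poly" where "p = monom 1 i + monom (-1) j"
      have "coeff p i = 1" using ij by (simp add: p_def coeff_monom)
      then have "p \<noteq> 0" by auto
      moreover have "sc (-1) v = - v" for v by (simp add: sc_def)
      then have "ev p v0 = 0" using ij by (simp add: p_def ev_add ev_monom F_def)
      ultimately show ?thesis by blast
    next
      case True
      then have "card (F ` {..N}) = Suc N" by (simp add: card_image)
      then have "dependent (F ` {..N})"
        by (intro dependent_biggerset) (simp_all add: N_def)
      then obtain u where u: "\<exists>v\<in>F ` {..N}. u v \<noteq> 0" "(\<Sum>v\<in>F ` {..N}. u v *\<^sub>R v) = 0"
        by (auto simp: dependent_finite)
      define p :: "complex poly" where "p = (\<Sum>k\<le>N. monom (of_real (u (F k))) k)"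
      obtain k where k: "k \<le> N" "u (F k) \<noteq> 0" using u by auto
      have "coeff p k = (\<Sum>i\<le>N. if i = k then of_real (u (F k)) else 0)"
        unfolding p_def coeff_sum by (intro sum.cong) (auto simp: coeff_monom)
      then have "p \<noteq> 0" using k by auto
      moreover have "ev p v0 = (\<Sum>k\<le>N. u (F k) *\<^sub>R F k)"
        by (simp add: p_def ev_sum ev_monom F_def sc_def)
      then have "ev p v0 = 0" using u(2) True by (simp add: sum.reindex)
      ultimately show ?thesis by blast
    qed
  qed
  \<comment> \<open>For an annihilator of least degree with root w, the cofactor of X - w does not
    annihilate \<open>v0\<close>; its value there is the eigenvector.\<close>
  then obtain p where p: "p \<noteq> 0" "ev p v0 = 0" 
      and least: "\<And>q. q \<noteq> 0 \<and> ev q v0 = 0 \<Longrightarrow> degree p \<le> degree q"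
    using ex_has_least_nat[of "\<lambda>p. p \<noteq> 0 \<and> ev p v0 = 0" _ degree] by blast
  have "degree p \<noteq> 0"
  proof
    assume "degree p = 0"
    then obtain c where c: "p = [:c:]" by (metis degree_eq_zeroE)
    then have "c \<noteq> 0" using p by auto
    have "sc c v0 = 0" using p(2) c by (simp add: ev_def)
    then have "sc (inverse c * c) v0 = 0" by (simp only: sc_mult sc_0)
    then show False using \<open>c \<noteq> 0\<close> v0 by simp
  qed
  then obtain w where "poly p w = 0"
    using fundamental_theorem_of_algebra[of p] constant_degree[of p] by auto
  then obtain Q where Q: "p = [:-w, 1:] * Q" by (auto simp: poly_eq_0_iff_dvd)
  then have "Q \<noteq> 0" using p by auto
  then have "degree p = Suc (degree Q)" using Q degree_mult_eq[of "[:-w,1:]" Q] by simp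
  then have h: "ev Q v0 \<noteq> 0" using least[of Q] \<open>Q \<noteq> 0\<close> by auto
  have "p = smult (-w) Q + pCons 0 Q" by (simp add: Q)
  then have "sc (-w) (ev Q v0) + A (ev Q v0) = 0"
    using p(2) by (simp only: ev_add ev_smult ev_shift)
  then have "A (ev Q v0) = sc w (ev Q v0)" by (simp add: sc_def algebra_simps add_eq_0_iff)
  then show ?thesis using that[of "ev Q v0" w] h ev_U[OF v0(1)] by (simp add: sc_def)
qed

text \<open>The hypotheses say that the bordered matrix with rows $(S, x)$ and $(y^*, z)$ is normal;
  \<open>(f, c)\<close> is an eigenvector of it, hence also of its adjoint.\<close>

lemma normal_dilation_eigenvector:
  fixes S :: "complex^'n^'n" and x y g f0 :: "complex^'n"
  assumes D: "S ** adj S - adj S ** S = outer y y - outer x x"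
    and off: "adj S *v x - S *v y = cnj z *s x - z *s y"
    and n: "norm x = norm y"
    and g: "cip g x = 0" "cip g y = 0" "S *v g = 0" "adj S *v g = 0"
    and f0: "f0 \<noteq> 0" "cip g f0 = 0"
  obtains f c w where "f \<noteq> 0" "cip g f = 0"
    "S *v f + c *s x = w *s f" "adj S *v f + c *s y = cnj w *s f"
proof -
  define N :: "(complex^'n) \<times> complex \<Rightarrow> (complex^'n) \<times> complex"
    where "N F = (S *v fst F + snd F *s x, cip y (fst F) + z * snd F)" for F
  define J :: "(complex^'n) \<times> complex \<Rightarrow> (complex^'n) \<times> complex"
    where "J F = (\<i> *s fst F, \<i> * snd F)" for F
  \<comment> \<open>If x = 0, then y = 0 as well and (0, 1) would be an eigenvector with vanishing
    first component; cutting off the last coordinate excludes it.\<close>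
  define U where "U = {F :: (complex^'n) \<times> complex. cip g (fst F) = 0 \<and> (x = 0 \<longrightarrow> snd F = 0)}"
  have sR: "r *\<^sub>R v = complex_of_real r *s v" for r and v :: "complex^'n"
    by (simp add: vec_eq_iff) (simp add: scaleR_conv_of_real)
  have lN: "linear N"
    by (rule linearI) (simp_all add: N_def mv_simps cip_simps sR scaleR_conv_of_real algebra_simps vec.scale_right_distrib vec.scale_left_distrib)
  have lJ: "linear J"
    by (rule linearI) (simp_all add: J_def sR scaleR_conv_of_real algebra_simps vec.scale_right_distrib)
  have JJ: "J (J v) = - v" for v
    by (simp add: J_def prod_eq_iff vec_eq_iff mult.assoc[symmetric])
  have NJ: "N (J v) = J (N v)" for v
    by (simp add: N_def J_def mv_simps cip_simps algebra_simps vec.scale_right_distrib)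
  have U: "subspace U"
    by (auto simp: subspace_def U_def cip_simps sR)
  have JU: "J v \<in> U" if "v \<in> U" for v using that by (auto simp: U_def J_def cip_simps)
  have gS: "cip g (S *v v) = 0" for v
    using g by (simp add: cip_adj cip_simps)
  have NU: "N v \<in> U" if "v \<in> U" for v
    using that n by (auto simp: U_def N_def cip_simps g gS)
  obtain h w where h: "h \<in> U" "h \<noteq> 0" "N h = Re w *\<^sub>R h + Im w *\<^sub>R J h"
  proof (rule eigenvector_exists[OF lN lJ JJ NJ U JU NU])
    show "(f0, 0) \<in> U" "(f0, 0 :: complex) \<noteq> 0" using f0 by (simp_all add: U_def prod_eq_iff)
  qed
  define f c where "f = fst h" and "c = snd h"
  have sw: "of_real (Re w) * t + of_real (Im w) * (\<i> * t) = w * t" for t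
  proof -
    have "w = of_real (Re w) + \<i> * of_real (Im w)" by (rule complex_eq)
    then show ?thesis by (metis (no_types, opaque_lifting) distrib_right mult.assoc mult.commute)
  qed
  have e1: "S *v f + c *s x = w *s f"
    using arg_cong[OF h(3), of fst] by (simp add: N_def J_def f_def c_def sR vec_eq_iff sw[folded mult.assoc])
  have e2: "cip y f + z * c = w * c"
    using arg_cong[OF h(3), of snd] by (simp add: N_def J_def f_def c_def scaleR_conv_of_real sw)
  have f: "f \<noteq> 0"
  proof
    assume "f = 0"
    then have "c \<noteq> 0" "c *s x = 0" using h(2) e1 by (auto simp: f_def c_def prod_eq_iff)
    then have "x = 0" by simp
    then show False using h(1) \<open>c \<noteq> 0\<close> by (auto simp: U_def c_def)
  qed
  have gf: "cip g f = 0" using h(1) by (simp add: U_def f_def)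
  define a b xf yf where "a = cip (S *v f) x" and "b = cip (adj S *v f) y"
    and "xf = cip x f" and "yf = cip y f"
  have i1: "cip (adj S *v f) (adj S *v f) - cip (S *v f) (S *v f) = cnj yf * yf - cnj xf * xf"
  proof -
    have "cip f ((S ** adj S - adj S ** S) *v f) = cip f ((outer y y - outer x x) *v f)"
      by (simp add: D)
    then show ?thesis
      by (simp add: mv_simps cip_simps outer_mv matrix_vector_mul_assoc[symmetric] cip_adj xf_def yf_def cnj_cip mult.commute)
  qed
  have i2: "a - b = cnj z * cnj xf - z * cnj yf"
  proof -
    have "cip f (adj S *v x - S *v y) = cip f (cnj z *s x - z *s y)"
      by (simp add: off)
    then show ?thesis
      by (simp add: cip_simps cip_adj a_def b_def xf_def yf_def cnj_cip)
  qed
  have xy: "cip x x = cip y y" using n by (simp add: cip_self)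
  have e2': "cnj yf + cnj z * cnj c = cnj w * cnj c"
    using arg_cong[OF e2, of cnj] by (simp add: yf_def)
  have "cip (S *v f + c *s x) (S *v f + c *s x) = cip (w *s f) (w *s f)" by (simp add: e1)
  then have i3: "cip (S *v f) (S *v f) + c * a + cnj c * cnj a + c * cnj c * cip x x = w * cnj w * cip f f"
    by (simp add: cip_simps a_def cnj_cip algebra_simps)
  have i4: "(yf + z * c) * (cnj yf + cnj z * cnj c) = w * c * (cnj w * cnj c)"
    using e2 e2' by (simp add: yf_def)
  \<comment> \<open>\<open>d\<close> and xf + \<open>cnj z\<close> c - \<open>cnj w\<close> c are
    the two components of the adjoint of \<open>N\<close> minus \<open>cnj w\<close>, applied to (f,
    c). By normality this vector is as long as N (f, c) - w (f, c), which is 0.\<close>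
  define d where "d = adj S *v f + c *s y - cnj w *s f"
  have i5: "cip f (S *v f) + c * cnj xf = w * cip f f"
    using arg_cong[OF e1, of "cip f"] by (simp add: cip_simps xf_def cnj_cip)
  have i5': "cip (S *v f) f + cnj c * xf = cnj w * cip f f"
    using arg_cong[OF i5, of cnj] by (simp add: cnj_cip)
  have dd: "cip d d = cip (adj S *v f) (adj S *v f) + c * b + cnj c * cnj b + c * cnj c * cip y y
     + w * cnj w * cip f f - w * (cip (S *v f) f + c * cnj yf) - cnj w * (cip f (S *v f) + cnj c * yf)"
  proof -
    define P where "P = adj S *v f"
    have "cip P f = cip f (S *v f)" "cip f P = cip (S *v f) f" "cip P y = b" "cip y P = cnj b"
      "cip f y = cnj yf" "cip y f = yf"
      by (simp_all add: P_def b_def yf_def cnj_cip cip_adj2)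
    then show ?thesis
      by (simp add: d_def P_def[symmetric] cip_simps algebra_simps)
  qed
  have "cip d d + (xf + cnj z * c - cnj w * c) * (cnj xf + z * cnj c - w * cnj c) = 0"
  proof -
    have yf: "yf = (w - z) * c" "cnj yf = (cnj w - cnj z) * cnj c"
      using e2 e2' by (simp_all add: yf_def algebra_simps)
    have b: "b = a - (cnj z * cnj xf - z * cnj yf)" using i2 by (simp add: algebra_simps)
    then have b': "cnj b = cnj a - (z * xf - cnj z * yf)" by simp
    have ss: "cip (S *v f) (S *v f) = w * cnj w * cip f f - c * a - cnj c * cnj a - c * cnj c * cip x x"
      using i3 by (simp add: algebra_simps)
    have tt: "cip (adj S *v f) (adj S *v f) = cip (S *v f) (S *v f) + cnj yf * yf - cnj xf * xf"
      using i1 by (simp add: algebra_simps)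
    have fs: "cip f (S *v f) = w * cip f f - c * cnj xf" "cip (S *v f) f = cnj w * cip f f - cnj c * xf"
      using i5 i5' by (simp_all add: algebra_simps)
    show ?thesis
      unfolding dd tt ss fs b' unfolding b yf xy by (simp add: algebra_simps)
  qed
  moreover have "(xf + cnj z * c - cnj w * c) * (cnj xf + z * cnj c - w * cnj c)
     = of_real ((cmod (xf + cnj z * c - cnj w * c))\<^sup>2)"
    unfolding complex_norm_square by simp
  ultimately have "of_real ((norm d)\<^sup>2 + (cmod (xf + cnj z * c - cnj w * c))\<^sup>2) = (0::complex)"
    by (simp add: cip_self)
  then have "(norm d)\<^sup>2 + (cmod (xf + cnj z * c - cnj w * c))\<^sup>2 = 0"
    using of_real_eq_0_iff by blast
  then have "d = 0" by (smt (verit) norm_eq_zero zero_eq_power2 zero_le_power2)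
  then have "adj S *v f + c *s y = cnj w *s f" by (simp add: d_def)
  then show ?thesis using that f gf e1 by blast
qed

text \<open>The leading part is $d \bar z |z|^2$, so after division by $1 + |z|^2$ the equation becomes
  $z = $ (a bounded continuous function of $z$), which Brouwer's theorem solves.\<close>

lemma cubic_root:
  fixes d k1 k2 k3 k4 k5 :: complex
  assumes d: "d \<noteq> 0"
  shows "\<exists>z. d * (z * cnj z * cnj z) + k1 * (z * cnj z) + k2 * (cnj z * cnj z) + k3 * z + k4 * cnj z + k5 = 0"
proof -
  \<comment> \<open>The equation is d \<open>cnj z\<close> (1 + |z|^2) + r z = 0. The added term d
    \<open>cnj z\<close> explains the coefficient k4 - d; every monomial left in r is bounded by 1 +
    |z|^2.\<close>
  define r where "r z = k1 * (z * cnj z) + k2 * (cnj z * cnj z) + k3 * z + (k4 - d) * cnj z + k5" for z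
  define q where "q z = r z / (d * of_real (1 + (cmod z)\<^sup>2))" for z
  define B where "B = (cmod k1 + cmod k2 + cmod k3 + cmod (k4 - d) + cmod k5) / cmod d"
  have pos: "1 + (cmod z)\<^sup>2 > 0" for z :: complex by (smt (verit) zero_le_power2)
  have bnd: "cmod (q z) \<le> B" for z
  proof -
    have t: "cmod z \<le> 1 + (cmod z)\<^sup>2"
      using zero_le_power2[of "cmod z - 1"] zero_le_power2[of "cmod z"] by (simp add: power2_diff) (smt (verit) norm_ge_zero)
    have "cmod (r z) \<le> cmod k1 * (cmod z)\<^sup>2 + cmod k2 * (cmod z)\<^sup>2 + cmod k3 * cmod z + cmod (k4 - d) * cmod z + cmod k5"
      unfolding r_def
      by (intro order_trans[OF norm_triangle_ineq] add_mono) (simp_all add: norm_mult power2_eq_square)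
    also have "\<dots> \<le> cmod k1 * (1 + (cmod z)\<^sup>2) + cmod k2 * (1 + (cmod z)\<^sup>2) + cmod k3 * (1 + (cmod z)\<^sup>2) + cmod (k4 - d) * (1 + (cmod z)\<^sup>2) + cmod k5 * (1 + (cmod z)\<^sup>2)"
      using t by (intro add_mono mult_left_mono) (auto simp: mult_le_cancel_left1)
    finally have "cmod (r z) \<le> (cmod k1 + cmod k2 + cmod k3 + cmod (k4 - d) + cmod k5) * (1 + (cmod z)\<^sup>2)"
      by (simp add: algebra_simps)
    moreover have "cmod (q z) = cmod (r z) / (cmod d * (1 + (cmod z)\<^sup>2))"
      unfolding q_def norm_divide norm_mult norm_of_real using pos[of z] by simp
    ultimately have "cmod (q z) \<le> (cmod k1 + cmod k2 + cmod k3 + cmod (k4 - d) + cmod k5) * (1 + (cmod z)\<^sup>2) / (cmod d * (1 + (cmod z)\<^sup>2))"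
      using pos[of z] by (simp only:) (intro divide_right_mono, auto)
    also have "\<dots> = B" using pos[of z] by (simp add: B_def)
    finally show ?thesis .
  qed
  have B0: "0 \<le> B" by (simp add: B_def)
  have "continuous_on UNIV q"
    unfolding q_def r_def using d pos
    by (intro continuous_intros) (auto simp del: of_real_add of_real_power simp: order_less_imp_not_eq2)
  then have "continuous_on (cball 0 B) (\<lambda>z. - cnj (q z))"
    by (intro continuous_intros) (auto intro: continuous_on_subset)
  then obtain z where z: "- cnj (q z) = z"
    using brouwer[of "cball 0 B" "\<lambda>z. - cnj (q z)"] B0 bnd by (auto simp: image_subset_iff)
  have "q z = - cnj z" using z by (metis complex_cnj_cnj complex_cnj_minus minus_minus)
  then have "r z = - cnj z * (d * of_real (1 + (cmod z)\<^sup>2))"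
    using d pos[of z] by (simp add: q_def divide_eq_eq del: of_real_add of_real_power)
  also have "of_real (1 + (cmod z)\<^sup>2) = 1 + z * cnj z" by (simp only: of_real_add of_real_1 complex_norm_square)
  finally have "r z + cnj z * (d * (1 + z * cnj z)) = 0" by simp
  then show ?thesis by (intro exI[of _ z]) (simp add: r_def algebra_simps)
qed

text \<open>Being a multiple of \<open>x\<close> means being orthogonal to a basis \<open>a\<close>,
  \<open>b\<close> of the complement of \<open>x\<close>. The requirement on f is thus a homogeneous
  system \<open>M w\<close> whose first row is affine in w and whose other rows are affine in
  \<open>cnj w\<close>. Its determinant has leading term \<open>det E\<close> w (cnj w)^2, so
  \<open>cubic_root\<close> applies once \<open>det E\<close> is nonzero.\<close>

lemma pencil_product_vector:
  fixes S :: "complex^3^3" and u x :: "complex^3"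
  assumes ux: "cip u x \<noteq> 0"
  shows "\<exists>f w s. f \<noteq> 0 \<and> cip u (w *s f - adj S *v f) = 0 \<and> cnj w *s f - S *v f = s *s x"
proof -
  have x0: "x \<noteq> 0" using ux by (auto simp: cip_simps)
  obtain a where a: "a \<noteq> 0" "cip x a = 0" using ex_orth2[of x x] by blast
  obtain b where b: "b \<noteq> 0" "cip x b = 0" "cip a b = 0" using ex_orth2[of x a] by blast
  have ind: "r = 0 \<and> t = 0" if "r *s a + t *s b = 0" for r t
  proof -
    have "cip b (r *s a + t *s b) = t * cip b b" using b by (simp add: cip_simps) (metis cnj_cip complex_cnj_zero)
    then have "t = 0" using that b by (simp add: cip_simps)
    then show ?thesis using that a by simp
  qed
  have x': "cip a x = 0" "cip b x = 0" using a b by (metis cnj_cip complex_cnj_zero)+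
  define M :: "complex \<Rightarrow> complex^3^3" where
    "M w = (\<chi> i. if i = 1 then (\<chi> j. w * cnj (u$j) - cnj ((S *v u)$j))
       else if i = 2 then (\<chi> j. cnj w * cnj (a$j) - cnj ((adj S *v a)$j))
       else (\<chi> j. cnj w * cnj (b$j) - cnj ((adj S *v b)$j)))" for w
  define E :: "complex^3^3" where "E = (\<chi> i. if i = 1 then (\<chi> j. cnj (u$j)) else if i = 2 then (\<chi> j. cnj (a$j)) else (\<chi> j. cnj (b$j)))"
  have M1: "(M w *v f) $ 1 = cip u (w *s f - adj S *v f)" for w f
  proof -
    have "(M w *v f) $ 1 = w * cip u f - cip (S *v u) f"
      by (simp add: M_def matrix_vector_mult_def cip_def sum_distrib_left sum_subtractf algebra_simps)
    then show ?thesis by (simp add: cip_simps cip_adj)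
  qed
  have M2: "(M w *v f) $ 2 = cip a (cnj w *s f - S *v f)" for w f
  proof -
    have "(M w *v f) $ 2 = cnj w * cip a f - cip (adj S *v a) f"
      by (simp add: M_def matrix_vector_mult_def cip_def sum_distrib_left sum_subtractf algebra_simps)
    then show ?thesis by (simp add: cip_simps cip_adj)
  qed
  have M3: "(M w *v f) $ 3 = cip b (cnj w *s f - S *v f)" for w f
  proof -
    have "(M w *v f) $ 3 = cnj w * cip b f - cip (adj S *v b) f"
      by (simp add: M_def matrix_vector_mult_def cip_def sum_distrib_left sum_subtractf algebra_simps)
    then show ?thesis by (simp add: cip_simps cip_adj)
  qed
  have ker: "det A = 0 \<longleftrightarrow> \<not> (\<forall>f. A *v f = 0 \<longrightarrow> f = 0)" for A :: "complex^3^3"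
    using invertible_det_nz[of A] invertible_left_inverse[of A] matrix_left_invertible_ker[of A] by blast
  \<comment> \<open>A vector orthogonal to \<open>a\<close> and \<open>b\<close> is a multiple of
    \<open>x\<close>, and by \<open>ux\<close> only the zero multiple is also orthogonal to
    \<open>u\<close>.\<close>
  have "det E \<noteq> 0"
  proof (rule ccontr)
    assume "\<not> det E \<noteq> 0"
    then obtain f where f: "f \<noteq> 0" "E *v f = 0" using ker by blast
    have "(E *v f) $ 1 = cip u f" "(E *v f) $ 2 = cip a f" "(E *v f) $ 3 = cip b f"
      by (simp_all add: E_def matrix_vector_mult_def cip_def)
    then have f': "cip u f = 0" "cip a f = 0" "cip b f = 0" using f by auto
    then obtain c where "f = c *s x"
      using orth_span[OF ind x0 x'] by blast
    then show False using f'(1) ux f(1) by (auto simp: cip_simps)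
  qed
  have "\<exists>k1 k2 k3 k4 k5. \<forall>w. det (M w) = det E * (w * cnj w * cnj w) + k1 * (w * cnj w) + k2 * (cnj w * cnj w) + k3 * w + k4 * cnj w + k5"
  proof -
    define p q s a0 b0 c0 where "p j = cnj (u$j)" and "q j = cnj (a$j)" and "s j = cnj (b$j)"
      and "a0 j = cnj ((S *v u)$j)" and "b0 j = cnj ((adj S *v a)$j)" and "c0 j = cnj ((adj S *v b)$j)" for j
    define D where "D f g h = det (\<chi> i. if i = 1 then (\<chi> j. f j) else if i = 2 then (\<chi> j. g j) else (\<chi> j. h j) :: complex^3^3)" for f g h
    have "det (M w) = D p q s * (w * cnj w * cnj w) + (- (D p q c0 + D p b0 s)) * (w * cnj w)
      + (- D a0 q s) * (cnj w * cnj w) + D p b0 c0 * w + (D a0 q c0 + D a0 b0 s) * cnj w + (- D a0 b0 c0)" for w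
      unfolding M_def D_def p_def[symmetric] q_def[symmetric] s_def[symmetric] a0_def[symmetric] b0_def[symmetric] c0_def[symmetric]
      by (simp add: det_3) (simp add: algebra_simps)
    moreover have "det E = D p q s" by (simp add: E_def D_def p_def[abs_def] q_def[abs_def] s_def[abs_def])
    ultimately show ?thesis by metis
  qed
  then obtain w where "det (M w) = 0"
    using cubic_root[OF \<open>det E \<noteq> 0\<close>] by metis
  then obtain f where f: "f \<noteq> 0" "M w *v f = 0" using ker by blast
  then have "cip u (w *s f - adj S *v f) = 0" "cip a (cnj w *s f - S *v f) = 0" "cip b (cnj w *s f - S *v f) = 0"
    by (simp_all flip: M1 M2 M3)
  then show ?thesis using orth_span[OF ind x0 x'] f(1) by blast
qed

text \<open>Both sides of \<open>eq\<close> are values of one Hermitian form, positive definite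
  because |\<gamma>| < n, at the vectors (p, q) and (t, r). By \<open>par\<close> these are
  parallel, so equal values mean that the factor has modulus one.\<close>

lemma parallel_cmod_eq:
  fixes p q r t \<gamma> :: complex and n :: real
  assumes n: "cmod \<gamma> < n" and par: "q * t = p * r"
    and eq: "n * ((cmod p)\<^sup>2 + (cmod q)\<^sup>2) - 2 * Re (\<gamma> * (cnj p * q)) = n * ((cmod t)\<^sup>2 + (cmod r)\<^sup>2) - 2 * Re (\<gamma> * (cnj t * r))"
  shows "cmod p = cmod t"
proof -
  define F where "F a b = n * ((cmod a)\<^sup>2 + (cmod b)\<^sup>2) - 2 * Re (\<gamma> * (cnj a * b))" for a b
  have Fpos: "F a b > 0" if "a \<noteq> 0 \<or> b \<noteq> 0" for a b
  proof -
    have "Re (\<gamma> * (cnj a * b)) \<le> cmod \<gamma> * (cmod a * cmod b)"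
      using complex_Re_le_cmod[of "\<gamma> * (cnj a * b)"] by (simp add: norm_mult)
    moreover have "2 * (cmod a * cmod b) \<le> (cmod a)\<^sup>2 + (cmod b)\<^sup>2"
      using sum_squares_bound[of "cmod a" "cmod b"] by (simp add: mult.assoc)
    then have "cmod \<gamma> * (2 * (cmod a * cmod b)) \<le> cmod \<gamma> * ((cmod a)\<^sup>2 + (cmod b)\<^sup>2)"
      by (intro mult_left_mono) auto
    moreover have "(cmod a)\<^sup>2 + (cmod b)\<^sup>2 > 0" using that by (simp add: sum_power2_gt_zero_iff)
    then have "cmod \<gamma> * ((cmod a)\<^sup>2 + (cmod b)\<^sup>2) < n * ((cmod a)\<^sup>2 + (cmod b)\<^sup>2)"
      using n by simp
    ultimately show ?thesis by (simp add: F_def)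
  qed
  have Fsc: "F (k * a) (k * b) = (cmod k)\<^sup>2 * F a b" for k a b
  proof -
    have "\<gamma> * (cnj (k * a) * (k * b)) = of_real ((cmod k)\<^sup>2) * (\<gamma> * (cnj a * b))"
      unfolding complex_norm_square by simp
    moreover have "Re (of_real c * X) = c * Re X" for c X by simp
    ultimately have "Re (\<gamma> * (cnj (k * a) * (k * b))) = (cmod k)\<^sup>2 * Re (\<gamma> * (cnj a * b))"
      by (simp only:)
    then show ?thesis by (simp only: F_def norm_mult power_mult_distrib) (simp only: algebra_simps)
  qed
  have FF: "F p q = F t r" using eq by (simp add: F_def)
  show ?thesis
  proof (cases "t = 0 \<and> r = 0")
    case True
    then have "F p q = 0" using FF by (simp add: F_def)
    then have "p = 0" using Fpos[of p q] by auto
    then show ?thesis using True by simp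
  next
    case False
    have "\<exists>k. p = k * t \<and> q = k * r"
    proof (cases "t = 0")
      case True
      then have "p = 0" using par False by simp
      then show ?thesis using True False by (intro exI[of _ "q / r"]) simp
    next
      case t: False
      then show ?thesis using par by (intro exI[of _ "p / t"]) (simp add: field_simps)
    qed
    then obtain k where k: "p = k * t" "q = k * r" by blast
    have "(cmod k)\<^sup>2 * F t r = F t r" using FF unfolding k Fsc .
    then have "(cmod k)\<^sup>2 = 1" using Fpos[of t r] False by auto
    then have "cmod k = 1" by (simp add: power2_eq_1_iff) (smt (verit) norm_ge_zero)
    then show ?thesis by (simp add: k norm_mult)
  qed
qed

lemma matrix_sub_ldistrib: "A ** (B - C) = A ** B - A ** C" for A :: "complex^'m^'n"
  by (metis (no_types) add_diff_cancel diff_add_cancel matrix_add_ldistrib)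

text \<open>The border of the normal dilation. The traces of $S D$ and $S^2 D$ vanish for the commutator
  $D = S S^* - S^* S$; together with $\|S g\| = \|S^* g\|$ for $g$ in the kernel of $D$ this forces
  $|\langle x, S g\rangle| = |\langle g, S y\rangle|$, after which a phase of $y$ makes
  $S^* x - S y$ orthogonal to $g$.\<close>

lemma rank_one_defect_phase:
  fixes S :: "complex^3^3" and x y :: "complex^3"
  assumes D: "S ** adj S - adj S ** S = outer y y - outer x x"
    and n: "norm x = norm y"
    and ind: "\<And>r t. r *s x + t *s y = 0 \<Longrightarrow> r = 0 \<and> t = 0"
  obtains \<theta> z where "cmod \<theta> = 1" "adj S *v x - S *v (\<theta> *s y) = cnj z *s x - z *s (\<theta> *s y)"
proof -
  define \<gamma> where "\<gamma> = cip x y"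
  define N where "N = (norm x)\<^sup>2"
  have xx: "cip x x = of_real N" "cip y y = of_real N"
    using n by (simp_all add: N_def cip_self)
  have yx: "cip y x = cnj \<gamma>" by (simp add: \<gamma>_def cnj_cip)
  have x0: "x \<noteq> 0" using ind[of 1 0] by auto
  then have N: "N > 0" by (simp add: N_def)
  \<comment> \<open>Strict Cauchy-Schwarz: \<open>e\<close> is the part of \<open>y\<close>
    orthogonal to \<open>x\<close>, nonzero by independence.\<close>
  have \<gamma>N: "cmod \<gamma> < N"
  proof -
    define e where "e = y - (\<gamma> / of_real N) *s x"
    have "e \<noteq> 0"
    proof
      assume "e = 0"
      then have "(- (\<gamma> / of_real N)) *s x + 1 *s y = 0" by (simp add: e_def)
      from ind[OF this] show False by simp
    qed
    then have "(norm e)\<^sup>2 > 0" by simp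
    moreover have "cip e e = of_real N - \<gamma> * cnj \<gamma> / of_real N"
      using N by (simp add: e_def cip_simps xx yx \<gamma>_def[symmetric])
    then have "of_real ((norm e)\<^sup>2) = (of_real (N - (cmod \<gamma>)\<^sup>2 / N) :: complex)"
      unfolding cip_self complex_norm_square[symmetric] by simp
    then have "(norm e)\<^sup>2 = N - (cmod \<gamma>)\<^sup>2 / N" using of_real_eq_iff by blast
    moreover have "N * (norm e)\<^sup>2 > 0" using N \<open>(norm e)\<^sup>2 > 0\<close> by simp
    moreover have "(cmod \<gamma>)\<^sup>2 + N * (norm e)\<^sup>2 = N\<^sup>2"
      using N \<open>(norm e)\<^sup>2 = _\<close> by (simp add: field_simps power2_eq_square)
    ultimately have "(cmod \<gamma>)\<^sup>2 < N\<^sup>2" by linarith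
    then show ?thesis using N by (simp add: power2_less_imp_less)
  qed
  obtain g0 where g0: "g0 \<noteq> 0" "cip x g0 = 0" "cip y g0 = 0" using ex_orth2 by blast
  define g where "g = of_real (1 / norm g0) *s g0"
  have g: "cip x g = 0" "cip y g = 0" using g0 by (simp_all add: g_def cip_simps)
  then have g': "cip g x = 0" "cip g y = 0" by (metis cnj_cip complex_cnj_zero)+
  have gg: "cip g g = 1" using g0 by (simp add: g_def cip_simps) (simp add: cip_self power2_eq_square)
  have gnz: "g \<noteq> 0" using gg by (auto simp: cip_simps)
  have zero: "v = 0" if v: "cip x v = 0" "cip y v = 0" "cip g v = 0" for v
  proof -
    obtain c where "v = c *s g" using orth_span[OF ind gnz g v(1,2)] by blast
    then show ?thesis using v(3) gg by (simp add: cip_simps)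
  qed
  \<comment> \<open>The Gram determinant of \<open>x\<close> and \<open>y\<close>. Multiplied by it,
    the resolution of the identity in the basis \<open>x\<close>, \<open>y\<close>, \<open>g\<close>
    takes the polynomial form \<open>compl\<close>.\<close>
  define \<Delta> where "\<Delta> = of_real N * of_real N - \<gamma> * cnj \<gamma>"
  have \<Delta>r: "\<Delta> = of_real (N\<^sup>2 - (cmod \<gamma>)\<^sup>2)"
    by (simp add: \<Delta>_def power2_eq_square flip: complex_norm_square)
  have "N\<^sup>2 - (cmod \<gamma>)\<^sup>2 > 0" using \<gamma>N N by (simp add: power_strict_mono)
  then have \<Delta>: "\<Delta> \<noteq> 0" unfolding \<Delta>r by (simp del: of_real_diff of_real_power)
  have cnj\<Delta>: "cnj \<Delta> = \<Delta>" by (simp add: \<Delta>r)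
  have compl: "\<Delta> * cip w v = of_real N * cip w x * cip x v - \<gamma> * cip w x * cip y v
      - cnj \<gamma> * cip w y * cip x v + of_real N * cip w y * cip y v + \<Delta> * cip w g * cip g v" for w v
  proof -
    have "\<Delta> *s v - (of_real N * cip x v - \<gamma> * cip y v) *s x - (of_real N * cip y v - cnj \<gamma> * cip x v) *s y
      - (\<Delta> * cip g v) *s g = 0"
      by (rule zero) (simp_all add: cip_simps xx yx \<gamma>_def[symmetric] g g' gg \<Delta>_def algebra_simps)
    then have "cip w (\<Delta> *s v - (of_real N * cip x v - \<gamma> * cip y v) *s x - (of_real N * cip y v - cnj \<gamma> * cip x v) *s y
      - (\<Delta> * cip g v) *s g) = 0" by (simp add: cip_simps)
    then show ?thesis by (simp add: cip_simps algebra_simps)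
  qed
  have c: "cip y (S *v y) = cip x (S *v x)"
  proof -
    have "trace (S ** (S ** adj S - adj S ** S)) = 0"
      using trace_mul_sym[of "S ** adj S" S] by (simp add: matrix_sub_ldistrib matrix_mul_assoc trace_sub)
    then show ?thesis by (simp add: D matrix_sub_ldistrib trace_sub trace_outer)
  qed
  have c2: "cip y (S *v (S *v y)) = cip x (S *v (S *v x))"
  proof -
    have "trace (S ** S ** (S ** adj S - adj S ** S)) = 0"
      using trace_mul_sym[of "S ** S ** adj S" S] by (simp add: matrix_sub_ldistrib matrix_mul_assoc trace_sub)
    then show ?thesis by (simp add: D matrix_sub_ldistrib trace_sub trace_outer matrix_vector_mul_assoc)
  qed
  define p q r t where "p = cip x (S *v g)" and "q = cip y (S *v g)" and "r = cip g (S *v x)" and "t = cip g (S *v y)"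
  \<comment> \<open>The two sides of \<open>c2\<close> are expanded by inserting
    \<open>compl\<close> between the two factors S. By \<open>c\<close> the contributions of
    \<open>x\<close> and \<open>y\<close> agree, which leaves those of \<open>g\<close>.\<close>
  have qt: "q * t = p * r"
  proof -
    have "\<Delta> * (q * t) = \<Delta> * (p * r)"
      using compl[of "adj S *v y" "S *v y"] compl[of "adj S *v x" "S *v x"] c2
      by (simp add: cip_adj2 c p_def q_def r_def t_def algebra_simps)
    then show ?thesis using \<Delta> by simp
  qed
  have gD: "cip (adj S *v g) (adj S *v g) = cip (S *v g) (S *v g)"
  proof -
    have "cip g ((S ** adj S - adj S ** S) *v g) = 0"
      by (simp add: D mv_simps outer_mv cip_simps g)
    then show ?thesis by (simp add: mv_simps cip_simps matrix_vector_mul_assoc[symmetric] cip_adj)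
  qed
  have l: "cip (S *v g) x = cnj p" "cip (S *v g) y = cnj q" "cip x (S *v g) = p" "cip y (S *v g) = q"
    "cip (adj S *v g) x = r" "cip (adj S *v g) y = t" "cip x (adj S *v g) = cnj r" "cip y (adj S *v g) = cnj t"
    by (simp_all add: p_def q_def r_def t_def cnj_cip cip_adj)
  have lg: "cip (S *v g) g = cip g (adj S *v g)" "cip g (S *v g) = cip (adj S *v g) g"
    by (simp_all add: cip_adj)
  \<comment> \<open>This is \<open>gD\<close> expanded by \<open>compl\<close>; the components along
    \<open>g\<close> have equal modulus by \<open>lg\<close> and cancel.\<close>
  have "of_real N * cnj p * p - \<gamma> * cnj p * q - cnj \<gamma> * cnj q * p + of_real N * cnj q * q
     = of_real N * r * cnj r - \<gamma> * r * cnj t - cnj \<gamma> * t * cnj r + of_real N * t * cnj t"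
    using compl[of "S *v g" "S *v g"] compl[of "adj S *v g" "adj S *v g"] unfolding l lg gD by (simp add: algebra_simps)
  then have "Re (of_real N * (cnj p * p) - \<gamma> * (cnj p * q) - cnj (\<gamma> * (cnj p * q)) + of_real N * (cnj q * q))
     = Re (of_real N * (cnj r * r) - \<gamma> * (cnj t * r) - cnj (\<gamma> * (cnj t * r)) + of_real N * (cnj t * t))"
    by (simp only: mult_ac complex_cnj_mult complex_cnj_cnj)
  then have "N * ((cmod p)\<^sup>2 + (cmod q)\<^sup>2) - 2 * Re (\<gamma> * (cnj p * q)) = N * ((cmod t)\<^sup>2 + (cmod r)\<^sup>2) - 2 * Re (\<gamma> * (cnj t * r))"
    unfolding cmod_power2 by (simp add: power2_eq_square algebra_simps)
  then have pt: "cmod p = cmod t" using parallel_cmod_eq[OF \<gamma>N qt] by simp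
  \<comment> \<open>If t = 0, then p = 0 by \<open>pt\<close> and every phase works.\<close>
  define \<theta> where "\<theta> = (if t = 0 then 1 else cnj p / t)"
  have \<theta>: "cmod \<theta> = 1" "\<theta> * t = cnj p" using pt by (auto simp: \<theta>_def norm_divide)
  have \<theta>\<theta>: "cnj \<theta> * \<theta> = 1" "\<theta> * cnj \<theta> = 1" using complex_norm_square[of \<theta>] \<theta>(1) by (simp_all add: mult.commute)
  define y1 where "y1 = \<theta> *s y"
  define v where "v = adj S *v x - S *v y1"
  define \<omega> where "\<omega> = cip x v"
  define \<delta> where "\<delta> = \<theta> * \<gamma>"
  have \<delta>: "cip x y1 = \<delta>" "cip y1 x = cnj \<delta>" "cip y1 y1 = of_real N"
    using \<theta>\<theta> by (simp_all add: y1_def \<delta>_def cip_simps xx yx \<gamma>_def[symmetric] mult.assoc[symmetric])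
  have \<Delta>2: "\<Delta> = of_real N * of_real N - \<delta> * cnj \<delta>"
    using \<theta>\<theta> by (simp add: \<Delta>_def \<delta>_def)
  have gv: "cip g v = 0"
    using \<theta>(2) by (simp add: v_def cip_simps y1_def mv_simps cip_adj t_def p_def cnj_cip)
  have yv: "cip y1 v = - cnj \<omega>"
  proof -
    have "cip y1 (S *v y1) = cip y (S *v y)" using \<theta>\<theta> by (simp add: y1_def mv_simps cip_simps mult.assoc[symmetric])
    then have "cip y1 v = cnj (cip x (S *v y1)) - cip x (S *v x)"
      by (simp add: v_def cip_simps c[unfolded cip_adj] cnj_cip cip_adj)
    moreover have "\<omega> = cnj (cip x (S *v x)) - cip x (S *v y1)"
      by (simp add: \<omega>_def v_def cip_simps cnj_cip) (simp add: cip_adj)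
    ultimately show ?thesis by simp
  qed
  \<comment> \<open>By \<open>yv\<close> the equations obtained by pairing with \<open>x\<close> and
    with \<open>y1\<close> are conjugate to each other. The formula is Cramer's rule for the
    unknowns z and \<open>cnj z\<close>.\<close>
  define z where "z = (of_real N * cnj \<omega> + cnj \<delta> * \<omega>) / \<Delta>"
  have z: "z * \<Delta> = of_real N * cnj \<omega> + cnj \<delta> * \<omega>" "cnj z * \<Delta> = of_real N * \<omega> + \<delta> * cnj \<omega>"
    using \<Delta> by (simp_all add: z_def cnj\<Delta>)
  have "\<Delta> * (\<omega> - cnj z * of_real N + z * \<delta>) = \<Delta> * \<omega> - (cnj z * \<Delta>) * of_real N + (z * \<Delta>) * \<delta>"
    by (simp add: algebra_simps)
  also have "\<dots> = 0" unfolding z unfolding \<Delta>2 by (simp add: algebra_simps)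
  finally have ex: "\<omega> - cnj z * of_real N + z * \<delta> = 0" using \<Delta> by simp
  have ey: "- cnj \<omega> - cnj z * cnj \<delta> + z * of_real N = 0"
  proof -
    have "\<Delta> * (- cnj \<omega> - cnj z * cnj \<delta> + z * of_real N) = - \<Delta> * cnj \<omega> - (cnj z * \<Delta>) * cnj \<delta> + (z * \<Delta>) * of_real N"
      by (simp add: algebra_simps)
    also have "\<dots> = 0" unfolding z unfolding \<Delta>2 by (simp add: algebra_simps)
    finally show ?thesis using \<Delta> by simp
  qed
  have "v - (cnj z *s x - z *s y1) = 0"
  proof (rule zero)
    show "cip x (v - (cnj z *s x - z *s y1)) = 0"
      using ex by (simp add: cip_simps \<omega>_def[symmetric] \<delta> xx algebra_simps)
    have "cip y1 (v - (cnj z *s x - z *s y1)) = 0"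
      using ey by (simp add: cip_simps yv \<delta> xx algebra_simps)
    moreover have "cip y1 e = cnj \<theta> * cip y e" for e by (simp add: y1_def cip_simps)
    moreover have "cnj \<theta> \<noteq> 0" using \<theta>(1) by auto
    ultimately show "cip y (v - (cnj z *s x - z *s y1)) = 0" by (metis mult_eq_0_iff)
    show "cip g (v - (cnj z *s x - z *s y1)) = 0"
      by (simp add: cip_simps gv g' y1_def)
  qed
  then have "adj S *v x - S *v y1 = cnj z *s x - z *s y1" by (simp add: v_def)
  then show ?thesis using that \<theta>(1) unfolding y1_def by blast
qed

lemma psd_herm: "psd A \<Longrightarrow> cip u (A *v v) = cip (A *v u) v"
  by (metis cip_adj psd_def)

lemma mv_axis: "(A *v axis j 1) $ i = A $ i $ j" for A :: "complex^'n^'m"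
  by (simp add: matrix_vector_mult_def axis_def if_distrib cong: if_cong)

lemma cip_axis: "cip (axis i 1) v = v $ i"
  by (simp add: cip_def axis_def if_distrib[of cnj] mult_delta_left cong: if_cong)

lemma entry_cip: "A $ i $ j = cip (axis i 1) (A *v axis j 1)" for A :: "complex^'n^'m"
  by (simp add: cip_axis mv_axis)

lemma psd_trace_0:
  fixes A :: "complex^'n^'n"
  assumes A: "psd A" and t: "Re (trace A) = 0"
  shows "A = 0"
proof -
  have nn: "0 \<le> Re (A $ i $ i)" for i
    using A unfolding entry_cip[of A] psd_def by blast
  have "(\<Sum>i\<in>UNIV. Re (A $ i $ i)) = 0" using t by (simp add: trace_def)
  then have d: "Re (A $ i $ i) = 0" for i
    using nn by (simp add: sum_nonneg_eq_0_iff)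
  have "A $ i $ j = 0" for i j
    using psd_CS[OF A, of "axis i 1" "axis j 1"] d by (simp add: entry_cip[symmetric])
  then show ?thesis by (simp add: vec_eq_iff)
qed

text \<open>In the next two lemmas the conclusion says that $(\alpha, \beta) \otimes f$ lies in the range of the block
  matrix with rows $(1, S)$ and $(S^*, T)$, and $(\bar\alpha, \bar\beta) \otimes f$ in that of its partial
  transpose, written out by means of the Schur complements \<open>Y\<close> and \<open>X\<close>. The vector \<open>g\<close> (possibly 0)
  records a direction in which the original corner block was singular.\<close>

lemma generic_product_vector:
  fixes S X Y :: "complex^3^3"
  assumes Y: "psd Y" "Y *v g = 0" and X: "psd X" "X *v g = 0" and S: "S *v g = 0" "adj S *v g = 0"
    and u: "u \<noteq> 0" "\<And>v. cip u v = 0 \<Longrightarrow> \<exists>q. v = Y *v q" and X0: "X \<noteq> 0"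
  shows "\<exists>\<alpha> \<beta> f q q'. (\<alpha> \<noteq> 0 \<or> \<beta> \<noteq> 0) \<and> f \<noteq> 0 \<and> cip g f = 0 \<and> \<beta> *s f - \<alpha> *s (adj S *v f) = Y *v q
     \<and> cnj \<beta> *s f - cnj \<alpha> *s (S *v f) = X *v q'"
proof -
  obtain b where b: "X *v b \<noteq> 0" using X0 by (metis matrix_eq matrix_vector_mult_0)
  define x where "x = X *v b"
  have x0: "x \<noteq> 0" using b by (simp add: x_def)
  have gx: "cip g x = 0" using X by (simp add: x_def psd_herm cip_simps)
  show ?thesis
  proof (cases "g = 0")
    case True
    show ?thesis
    proof (cases "cip u x = 0")
      case ux: True
      \<comment> \<open>Here \<open>x\<close> lies in both ranges, so (0, 1) and f = x
        suffice.\<close>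
      obtain q where "x = Y *v q" using u(2)[OF ux] by blast
      then show ?thesis using x0 True x_def
        by - (rule exI[of _ 0], rule exI[of _ 1], rule exI[of _ x], rule exI[of _ q], rule exI[of _ b], simp add: cip_simps)
    next
      case False
      obtain f w s where f: "f \<noteq> 0" "cip u (w *s f - adj S *v f) = 0" "cnj w *s f - S *v f = s *s x"
        using pencil_product_vector[OF False] by blast
      obtain q where "w *s f - adj S *v f = Y *v q" using u(2)[OF f(2)] by blast
      then show ?thesis using f True
        by - (rule exI[of _ 1], rule exI[of _ w], rule exI[of _ f], rule exI[of _ q], rule exI[of _ "s *s b"], simp add: cip_simps x_def mv_simps)
    qed
  next
    case False
    \<comment> \<open>The part of \<open>g\<close> orthogonal to \<open>u\<close> lies in the range
      of \<open>Y\<close>, hence is orthogonal to the kernel vector \<open>g\<close> and vanishes.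
      So \<open>u\<close> is parallel to \<open>g\<close>, and the range of \<open>Y\<close>
      contains the whole complement of \<open>g\<close>.\<close>
    define k where "k = cip u g / cip u u"
    define v where "v = g - k *s u"
    have uv: "cip u v = 0" using u(1) by (simp add: v_def cip_simps k_def)
    then obtain q where "v = Y *v q" using u(2) by blast
    then have "cip g v = 0" using Y by (simp add: psd_herm cip_simps)
    moreover have "cip v v = cip g v - cnj k * cip u v"
      unfolding cip_simps(8)[symmetric] cip_simps(4)[symmetric] by (simp add: v_def)
    ultimately have "v = 0" using uv by simp
    then have "g = k *s u" by (simp add: v_def)
    then have gY: "\<exists>q. v = Y *v q" if "cip g v = 0" for v
      using that False u(2)[of v] by (auto simp: cip_simps)
    \<comment> \<open>With \<beta> = 0 only S f parallel to \<open>x\<close> has to be achieved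
      inside the complement of \<open>g\<close>. That complement is a plane, so orthogonality of S f
      to \<open>v0\<close> is enough, a single equation for f.\<close>
    obtain v0 where v0: "v0 \<noteq> 0" "cip g v0 = 0" "cip x v0 = 0" using ex_orth2 by blast
    obtain f where f: "f \<noteq> 0" "cip g f = 0" "cip (adj S *v v0) f = 0" using ex_orth2 by blast
    have ind: "r = 0 \<and> t = 0" if h: "r *s g + t *s v0 = 0" for r t
    proof -
      have "cip g (r *s g + t *s v0) = r * cip g g" by (simp add: cip_simps v0)
      then have "r = 0" using h False by (simp add: cip_simps)
      then show ?thesis using h v0 by simp
    qed
    have "cip v0 x = 0" using v0(3) by (metis cnj_cip complex_cnj_zero)
    moreover have "cip g (S *v f) = 0" "cip v0 (S *v f) = 0"
      using f S by (simp_all add: cip_adj cip_simps)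
    ultimately obtain c where c: "S *v f = c *s x"
      using orth_span[OF ind x0 gx] by blast
    have "cip g (- (adj S *v f)) = 0"
      using S by (simp add: cip_adj cip_simps)
    then obtain q where q: "- (adj S *v f) = Y *v q" using gY by blast
    show ?thesis using f q c
      by - (rule exI[of _ 1], rule exI[of _ 0], rule exI[of _ f], rule exI[of _ q], rule exI[of _ "- c *s b"], simp add: x_def mv_simps)
  qed
qed

lemma outer_phase: "cmod \<theta> = 1 \<Longrightarrow> outer (\<theta> *s y) (\<theta> *s y) = outer y y"
proof -
  assume "cmod \<theta> = 1"
  then have "\<theta> * cnj \<theta> = 1" using complex_norm_square[of \<theta>] by simp
  then have "\<theta> * a * (cnj \<theta> * b) = a * b" for a b
    by (metis (no_types, opaque_lifting) mult.assoc mult.commute mult_1)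
  then show ?thesis by (simp add: outer_def vec_eq_iff)
qed

lemma trace_outer1: "trace (outer x x) = cip x x"
  by (simp add: trace_def outer_def cip_def mult.commute)

lemma product_vector_normalized:
  fixes S T :: "complex^3^3"
  defines "Y \<equiv> T - adj S ** S" and "X \<equiv> T - S ** adj S"
  assumes Y: "psd Y" and X: "psd X" and g: "S *v g = 0" "adj S *v g = 0" "T *v g = 0"
  shows "\<exists>\<alpha> \<beta> f q q'. (\<alpha> \<noteq> 0 \<or> \<beta> \<noteq> 0) \<and> f \<noteq> 0 \<and> cip g f = 0 \<and> \<beta> *s f - \<alpha> *s (adj S *v f) = Y *v q
     \<and> cnj \<beta> *s f - cnj \<alpha> *s (S *v f) = X *v q'"
proof -
  have tr: "trace X = trace Y"
    by (simp add: X_def Y_def trace_sub trace_mul_sym[of S])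
  have D: "S ** adj S - adj S ** S = Y - X" by (simp add: X_def Y_def)
  have Yg: "Y *v g = 0" and Xg: "X *v g = 0"
    by (simp_all add: X_def Y_def mv_simps g matrix_vector_mul_assoc[symmetric])
  obtain f0 where f0: "f0 \<noteq> 0" "cip g f0 = 0" using ex_orth2[of g g] by blast
  \<comment> \<open>Equal defects make \<open>S\<close> normal. The dilation with zero border yields
    a common eigenvector of \<open>S\<close> and \<open>adj S\<close>, for which both residuals are
    zero.\<close>
  have normal: ?thesis if "X = Y"
  proof -
    have D0: "S ** adj S - adj S ** S = outer 0 0 - outer 0 0" by (simp add: D that)
    obtain f c w where "f \<noteq> 0" "cip g f = 0" "S *v f + c *s 0 = w *s f" "adj S *v f + c *s 0 = cnj w *s f"
      by (rule normal_dilation_eigenvector[OF D0, where z = 0 and g = g]) (use g f0 in \<open>simp_all add: cip_simps\<close>)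
    then show ?thesis
      by - (rule exI[of _ 1], rule exI[of _ "cnj w"], rule exI[of _ f], rule exI[of _ 0], rule exI[of _ 0], simp)
  qed
  show ?thesis
  proof (cases "X = 0 \<or> Y = 0")
    case True
    then have "X = Y" using psd_trace_0[OF X] psd_trace_0[OF Y] tr by (metis trace_0 Re_complex_of_real mat_0 of_real_0)
    then show ?thesis by (rule normal)
  next
    case False
    show ?thesis
    proof (cases rule: psd_cases3[OF Y])
      case 1 then show ?thesis using False by simp
    next
      case (3 u)
      show ?thesis
        using generic_product_vector[OF Y Yg X Xg g(1,2) 3] False by blast
    next
      case y: (2 y)
      show ?thesis
      proof (cases rule: psd_cases3[OF X])
        case 1 then show ?thesis using False by simp
      next
        case (3 u)
        \<comment> \<open>Exchanging \<open>S\<close> with \<open>adj S\<close> exchanges the two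
          ranges and conjugates both coefficients.\<close>
        obtain \<alpha> \<beta> f q q' where "\<alpha> \<noteq> 0 \<or> \<beta> \<noteq> 0" "f \<noteq> 0" "cip g f = 0" "\<beta> *s f - \<alpha> *s (S *v f) = X *v q"
          "cnj \<beta> *s f - cnj \<alpha> *s (adj S *v f) = Y *v q'"
          using generic_product_vector[OF X Xg Y Yg g(2), of u] g(1) 3 False by (metis adj_adj)
        then show ?thesis
          by - (rule exI[of _ "cnj \<alpha>"], rule exI[of _ "cnj \<beta>"], rule exI[of _ f], rule exI[of _ q'], rule exI[of _ q], simp)
      next
        case x: (2 x)
        have "cip x x = cip y y" using tr by (simp add: x y trace_outer1)
        then have n: "norm x = norm y"
          unfolding cip_self of_real_eq_iff by simp
        have gx: "cip g x = 0"
          using Xg x(1) by (metis cnj_cip complex_cnj_zero outer_mv vec.scale_eq_0_iff x(2))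
        have gy: "cip g y = 0"
          using Yg y(1) by (metis cnj_cip complex_cnj_zero outer_mv vec.scale_eq_0_iff y(2))
        show ?thesis
        proof (cases "\<forall>r t. r *s x + t *s y = 0 \<longrightarrow> r = 0 \<and> t = 0")
          case True
          have D': "S ** adj S - adj S ** S = outer y y - outer x x" using D x y by simp
          obtain \<theta> z where \<theta>: "cmod \<theta> = 1" "adj S *v x - S *v (\<theta> *s y) = cnj z *s x - z *s (\<theta> *s y)"
            using rank_one_defect_phase[OF D' n] True by metis
          define y1 where "y1 = \<theta> *s y"
          have oy: "outer y1 y1 = outer y y" using \<theta>(1) by (simp add: y1_def outer_phase)
          then have "cip y1 y1 = cip y y" by (metis trace_outer1)
          then have "norm x = norm y1" using n unfolding cip_self of_real_eq_iff by simp
          then have y1: "outer y1 y1 = Y" "norm x = norm y1" "cip g y1 = 0"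
            using y(2) oy gy by (simp_all add: y1_def cip_simps)
          have D1: "S ** adj S - adj S ** S = outer y1 y1 - outer x x" using D x y1 by simp
          obtain f c w where f: "f \<noteq> 0" "cip g f = 0" "S *v f + c *s x = w *s f" "adj S *v f + c *s y1 = cnj w *s f"
            by (rule normal_dilation_eigenvector[OF D1 \<theta>(2)[folded y1_def] y1(2) gx y1(3) g(1,2) f0])
          have "y1 \<noteq> 0" using y1(2) x(1) by auto
          have "cnj w *s f - adj S *v f = c *s y1" using f(4) by (metis add_diff_cancel_left')
          also have "\<dots> = Y *v ((c / cip y1 y1) *s y1)"
            using \<open>y1 \<noteq> 0\<close> by (simp add: y1(1)[symmetric] outer_mv cip_simps)
          finally have 1: "cnj w *s f - adj S *v f = Y *v ((c / cip y1 y1) *s y1)" .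
          have "w *s f - S *v f = c *s x" using f(3) by (metis add_diff_cancel_left')
          also have "\<dots> = X *v ((c / cip x x) *s x)"
            using x by (simp add: outer_mv cip_simps)
          finally have 2: "w *s f - S *v f = X *v ((c / cip x x) *s x)" .
          show ?thesis using f(1,2) 1 2
            by - (rule exI[of _ 1], rule exI[of _ "cnj w"], rule exI[of _ f], rule exI[of _ "(c / cip y1 y1) *s y1"], rule exI[of _ "(c / cip x x) *s x"], simp)
        next
          case False
          \<comment> \<open>Dependent vectors of equal norm differ by a phase, which
            \<open>outer\<close> does not see; hence X = Y.\<close>
          then obtain r t where rt: "r *s x + t *s y = 0" "\<not> (r = 0 \<and> t = 0)" by blast
          have "t \<noteq> 0" using rt x(1) by auto
          define k where "k = - r / t"
          have yk: "y = k *s x"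
          proof -
            have "t *s (y - k *s x) = r *s x + t *s y"
              using \<open>t \<noteq> 0\<close> by (simp add: k_def vec_eq_iff field_simps)
            then have "y - k *s x = 0" using rt(1) \<open>t \<noteq> 0\<close> by (metis vec.scale_eq_0_iff)
            then show ?thesis by simp
          qed
          have "cip y y = (k * cnj k) * cip x x" by (simp add: yk cip_simps)
          then have "(k * cnj k) = 1" using \<open>cip x x = cip y y\<close> x(1) y(1) by simp
          then have "(cmod k)\<^sup>2 = 1" unfolding complex_norm_square[symmetric] by (metis of_real_eq_1_iff)
          then have "cmod k = 1" by (simp add: power2_eq_1_iff) (smt (verit) norm_ge_zero)
          then have "X = Y" using x y yk by (simp add: outer_phase)
          then show ?thesis by (rule normal)
        qed
      qed
    qed
  qed
qed

section \<open>Pairing PPT matrices with block positive ones\<close>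

text \<open>Gram-Schmidt for the inner product given by \<open>R\<close>. The columns of
  \<open>L\<close> are orthonormal for it, so \<open>L ** adj L\<close> is the inverse of
  \<open>R\<close> and \<open>L\<close> serves as a whitening map.\<close>

lemma cholesky3:
  fixes R :: "complex^3^3"
  assumes herm: "adj R = R" and pos: "\<And>v. v \<noteq> 0 \<Longrightarrow> Re (cip v (R *v v)) > 0"
  shows "\<exists>L :: complex^3^3. (\<forall>a b. cip (L *v a) (R *v (L *v b)) = cip a b) \<and> (\<forall>v. L *v (adj L *v (R *v v)) = v)
    \<and> (\<forall>v. R *v (L *v (adj L *v v)) = v) \<and> (\<forall>v. adj L *v (R *v (L *v v)) = v)"
proof -
  have h: "cip u (R *v v) = cip (R *v u) v" for u v using herm by (metis cip_adj)
  have norm: "\<exists>l. cip l (R *v l) = 1 \<and> (\<exists>k. l = k *s v)" if "v \<noteq> 0" for v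
  proof -
    define r where "r = Re (cip v (R *v v))"
    have r: "r > 0" using pos that by (simp add: r_def)
    have "cnj (cip v (R *v v)) = cip v (R *v v)" by (metis cnj_cip h)
    then have vr: "cip v (R *v v) = of_real r" by (simp add: r_def complex_eq_iff)
    define c where "c = 1 / sqrt r"
    have c: "c * (c * r) = 1" using r by (simp add: c_def)
    have "cip (of_real c *s v) (R *v (of_real c *s v)) = of_real (c * (c * r))"
      by (simp add: cip_simps mv_simps vr)
    also have "\<dots> = 1" by (simp add: c)
    finally show ?thesis by auto
  qed
  obtain l1 where l1: "cip l1 (R *v l1) = 1"
    using norm[of "axis 1 1"] by (metis axis_eq_0_iff zero_neq_one)
  obtain v2 where v2: "v2 \<noteq> 0" "cip (R *v l1) v2 = 0" using ex_orth2 by blast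
  obtain l2 where l2: "cip l2 (R *v l2) = 1" "cip (R *v l1) l2 = 0" 
    using norm[OF v2(1)] v2(2) by (metis cip_simps(7) mult_zero_right)
  obtain v3 where v3: "v3 \<noteq> 0" "cip (R *v l1) v3 = 0" "cip (R *v l2) v3 = 0" using ex_orth2 by blast
  obtain l3 where l3: "cip l3 (R *v l3) = 1" "cip (R *v l1) l3 = 0" "cip (R *v l2) l3 = 0"
    using norm[OF v3(1)] v3(2,3) by (metis cip_simps(7) mult_zero_right)
  have s: "cip u (R *v v) = 0" if "cip (R *v v) u = 0" for u v
    using that by (metis cnj_cip complex_cnj_zero)
  define L :: "complex^3^3" where "L = (\<chi> i j. if j = 1 then l1$i else if j = 2 then l2$i else l3$i)"
  have L: "L *v x = x$1 *s l1 + x$2 *s l2 + x$3 *s l3" for x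
    by (simp add: L_def matrix_vector_mult_def vec_eq_iff sum_3 mult.commute)
  have iso: "cip (L *v a) (R *v (L *v b)) = cip a b" for a b
  proof -
    have d: "cip l1 (R *v l1) = 1" "cip l2 (R *v l2) = 1" "cip l3 (R *v l3) = 1"
      "cip l1 (R *v l2) = 0" "cip l1 (R *v l3) = 0" "cip l2 (R *v l3) = 0"
      "cip l2 (R *v l1) = 0" "cip l3 (R *v l1) = 0" "cip l3 (R *v l2) = 0"
      using l1 l2 l3 s by (simp_all add: h)
    show ?thesis by (simp add: L mv_simps cip_simps d) (simp add: cip_def sum_3)
  qed
  have 1: "adj L *v (R *v (L *v v)) = v" for v
    by (rule cip_ext) (simp add: cip_adj[of _ "adj L"] iso)
  then have "(adj L ** R) ** L = Finite_Cartesian_Product.mat 1"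
    by (simp add: matrix_eq matrix_vector_mul_assoc[symmetric])
  then have "L ** (adj L ** R) = Finite_Cartesian_Product.mat 1"
    using matrix_left_right_inverse by blast
  then have 2: "L *v (adj L *v (R *v v)) = v" for v
    by (metis matrix_vector_mul_assoc matrix_vector_mul_lid)
  have 3: "R *v (L *v (adj L *v v)) = v" for v
  proof (rule cip_ext)
    fix u
    have "cip u (R *v (L *v (adj L *v v))) = cip (adj L *v (R *v u)) (adj L *v v)"
      by (simp only: h cip_adj[of _ L])
    also have "\<dots> = cip u v" by (simp only: cip_adj[of _ "adj L"] adj_adj 2)
    finally show "cip u (R *v (L *v (adj L *v v))) = cip u v" .
  qed
  show ?thesis using iso 2 3 1 by blast
qed

text \<open>A triple \<open>R S T\<close> stands for the block matrix with rows $(R, S)$ and $(S^*, T)$; its partial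
  transpose exchanges $S$ and $S^*$.\<close>

definition qf :: "complex^'n^'n \<Rightarrow> complex^'n^'n \<Rightarrow> complex^'n^'n \<Rightarrow> complex^'n \<Rightarrow> complex^'n \<Rightarrow> real" where
  "qf R S T a b = Re (cip a (R *v a)) + 2 * Re (cip a (S *v b)) + Re (cip b (T *v b))"

definition psd2 :: "complex^'n^'n \<Rightarrow> complex^'n^'n \<Rightarrow> complex^'n^'n \<Rightarrow> bool" where
  "psd2 R S T \<longleftrightarrow> adj R = R \<and> adj T = T \<and> (\<forall>a b. 0 \<le> qf R S T a b)"

definition ppt2 :: "complex^'n^'n \<Rightarrow> complex^'n^'n \<Rightarrow> complex^'n^'n \<Rightarrow> bool" where
  "ppt2 R S T \<longleftrightarrow> psd2 R S T \<and> psd2 R (adj S) T"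

text \<open>Cauchy-Schwarz for the block form, from its values on the complex line (a, b) + c (a',
  b'). On the left, (a', b') is paired with the image of (a, b) under the block matrix.\<close>

lemma psd2_CS:
  assumes "psd2 R S T"
  shows "(cmod (cip (R *v a + S *v b) a' + cip (adj S *v a + T *v b) b'))\<^sup>2 \<le> qf R S T a b * qf R S T a' b'"
proof (rule quad_CS)
  fix c :: complex
  have R: "cip u (R *v v) = cip (R *v u) v" and T: "cip u (T *v v) = cip (T *v u) v" for u v
    using assms by (metis cip_adj psd2_def)+
  have re: "Re (cip u (R *v v)) = Re (cip (R *v v) u)" for u v by (rule Re_cip_sym)
  have cc: "Re (cnj c * c * z) = (cmod c)\<^sup>2 * Re z" "Re (c * (cnj c * z)) = (cmod c)\<^sup>2 * Re z" for z
    unfolding cmod_power2 by (simp_all add: power2_eq_square algebra_simps)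
  have x: "Re (cip (c *s u) v) = Re (c * cip v u)" for u v
    by (metis Re_cip_sym cip_simps(7))
  have "0 \<le> qf R S T (a + c *s a') (b + c *s b')" using assms by (simp add: psd2_def)
  also have "\<dots> = qf R S T a b + 2 * Re (c * (cip (R *v a + S *v b) a' + cip (adj S *v a + T *v b) b'))
      + (cmod c)\<^sup>2 * qf R S T a' b'"
  proof -
    have 1: "Re (cip (a + c *s a') (R *v (a + c *s a'))) = Re (cip a (R *v a)) + 2 * Re (c * cip (R *v a) a') + (cmod c)\<^sup>2 * Re (cip a' (R *v a'))"
    proof -
      have "cip (a + c *s a') (R *v (a + c *s a')) = cip a (R *v a) + c * cip (R *v a) a' + cnj (c * cip (R *v a) a') + cnj c * c * cip a' (R *v a')"
        by (simp add: cip_simps mv_simps R[of a a'] cnj_cip algebra_simps)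
      then show ?thesis by (simp only: cc plus_complex.sel cnj.simps)
    qed
    have 2: "Re (cip (b + c *s b') (T *v (b + c *s b'))) = Re (cip b (T *v b)) + 2 * Re (c * cip (T *v b) b') + (cmod c)\<^sup>2 * Re (cip b' (T *v b'))"
    proof -
      have "cip (b + c *s b') (T *v (b + c *s b')) = cip b (T *v b) + c * cip (T *v b) b' + cnj (c * cip (T *v b) b') + cnj c * c * cip b' (T *v b')"
        by (simp add: cip_simps mv_simps T[of b b'] cnj_cip algebra_simps)
      then show ?thesis by (simp only: cc plus_complex.sel cnj.simps)
    qed
    have 3: "Re (cip (a + c *s a') (S *v (b + c *s b'))) = Re (cip a (S *v b)) + Re (c * cip (adj S *v a) b') + Re (c * cip (S *v b) a') + (cmod c)\<^sup>2 * Re (cip a' (S *v b'))"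
    proof -
      have "cip (a + c *s a') (S *v (b + c *s b')) = cip a (S *v b) + c * cip (adj S *v a) b' + cnj (c * cip (S *v b) a') + cnj c * c * cip a' (S *v b')"
        by (simp add: cip_simps mv_simps cip_adj[of a S b'] cnj_cip algebra_simps)
      then show ?thesis by (simp only: cc plus_complex.sel cnj.simps)
    qed
    show ?thesis unfolding qf_def 1 2 3 by (simp add: cip_simps algebra_simps)
  qed
  finally show "0 \<le> qf R S T a b + 2 * Re (c * (cip (R *v a + S *v b) a' + cip (adj S *v a + T *v b) b'))
      + (cmod c)\<^sup>2 * qf R S T a' b'" .
qed

text \<open>For z = M q in the range of a positive M, \<open>psd2_CS\<close> bounds |<z, v>|^2 by
  <q, M q> <v, M v>. Hence a multiple l of the projector onto z may be subtracted as long as l <q, M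
  q> <= 1.\<close>

lemma psd2_minus_product:
  assumes P: "psd2 R S T" and q: "R *v q0 + S *v q1 = \<alpha> *s f" "adj S *v q0 + T *v q1 = \<beta> *s f"
    and l: "0 < l" "l * qf R S T q0 q1 \<le> 1"
  defines "k \<equiv> complex_of_real (sqrt l)"
  shows "psd2 (R - outer (k *s (\<alpha> *s f)) (k *s (\<alpha> *s f))) (S - outer (k *s (\<alpha> *s f)) (k *s (\<beta> *s f))) (T - outer (k *s (\<beta> *s f)) (k *s (\<beta> *s f)))"
  unfolding psd2_def
proof (intro conjI allI)
  show "adj (R - outer (k *s (\<alpha> *s f)) (k *s (\<alpha> *s f))) = R - outer (k *s (\<alpha> *s f)) (k *s (\<alpha> *s f))"
   "adj (T - outer (k *s (\<beta> *s f)) (k *s (\<beta> *s f))) = T - outer (k *s (\<beta> *s f)) (k *s (\<beta> *s f))"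
    using P by (simp_all add: psd2_def adj_simps adj_outer)
  fix a b
  define h where "h = cip (\<alpha> *s f) a + cip (\<beta> *s f) b"
  have k: "k * k = of_real l" "cnj k = k" using l unfolding k_def of_real_mult[symmetric] by simp_all
  have o: "cip u (outer x y *v v) = cip u x * cip y v" for u v x y by (simp add: outer_mv cip_simps)
  define A B where "A = cip (\<alpha> *s f) a" and "B = cip (\<beta> *s f) b"
  have AB: "cip a (\<alpha> *s f) = cnj A" "cip b (\<beta> *s f) = cnj B" by (simp_all only: A_def B_def cnj_cip)
  have ks: "cip u (k *s v) = k * cip u v" "cip (k *s v) u = k * cip v u" for u v by (simp_all add: cip_simps k)
  have "Re (of_real l * (cnj A * A)) + 2 * Re (of_real l * (cnj A * B)) + Re (of_real l * (cnj B * B)) = l * (cmod h)\<^sup>2"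
    unfolding h_def A_def[symmetric] B_def[symmetric] cmod_power2 by (simp add: power2_eq_square algebra_simps)
  then have "qf (R - outer (k *s (\<alpha> *s f)) (k *s (\<alpha> *s f))) (S - outer (k *s (\<alpha> *s f)) (k *s (\<beta> *s f))) (T - outer (k *s (\<beta> *s f)) (k *s (\<beta> *s f))) a b
    = qf R S T a b - l * (cmod h)\<^sup>2"
    unfolding qf_def mv_simps cip_simps(3) o ks AB A_def[symmetric] B_def[symmetric]
    by (simp add: k(1)[symmetric] algebra_simps del: complex_cnj_mult)
  moreover have "(cmod h)\<^sup>2 \<le> qf R S T q0 q1 * qf R S T a b"
    using psd2_CS[OF P, of q0 q1 a b] by (simp add: q h_def)
  then have "l * (cmod h)\<^sup>2 \<le> (l * qf R S T q0 q1) * qf R S T a b" using l by simp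
  moreover have "(l * qf R S T q0 q1) * qf R S T a b \<le> 1 * qf R S T a b"
    using P l by (intro mult_right_mono) (auto simp: psd2_def)
  ultimately show "0 \<le> qf (R - outer (k *s (\<alpha> *s f)) (k *s (\<alpha> *s f))) (S - outer (k *s (\<alpha> *s f)) (k *s (\<beta> *s f))) (T - outer (k *s (\<beta> *s f)) (k *s (\<beta> *s f))) a b"
    by simp
qed

lemma psd2_psd: assumes "psd2 R S T" shows "psd R" "psd T"
proof -
  have "0 \<le> qf R S T v 0" "0 \<le> qf R S T 0 v" for v using assms by (simp_all add: psd2_def)
  then show "psd R" "psd T" using assms by (simp_all add: qf_def psd_def psd2_def cip_simps)
qed

text \<open>The form vanishes at (g, 0), so the block matrix kills this vector; the second component
  of the image is \<open>adj S *v g\<close>.\<close>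

lemma psd2_kernel:
  assumes "psd2 R S T" "R *v g = 0"
  shows "adj S *v g = 0"
proof (rule cip_ext)
  fix u
  have "qf R S T g 0 = 0" using assms by (simp add: qf_def cip_simps)
  then have "cip (R *v g + S *v 0) 0 + cip (adj S *v g + T *v 0) u = 0"
    using psd2_CS[OF assms(1), of g 0 0 u] by simp
  then have "cip (adj S *v g) u = 0" by (simp add: cip_simps)
  then show "cip u (adj S *v g) = cip u 0" by (metis cnj_cip complex_cnj_zero cip_simps(9))
qed

text \<open>The corner \<open>R\<close> is made invertible by filling its kernel and then whitened
  by \<open>L\<close>, which leads to the corner 1 of \<open>product_vector_normalized\<close>.
  Arguing by contradiction supplies \<open>edge\<close>, which settles the degenerate
  corners.\<close>

lemma ppt2_product_vector:
  fixes R S T :: "complex^3^3"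
  assumes P: "ppt2 R S T" and nz: "Re (trace R) + Re (trace T) \<noteq> 0"
  shows "\<exists>\<alpha> \<beta> f q0 q1 q0' q1'. (\<alpha> \<noteq> 0 \<or> \<beta> \<noteq> 0) \<and> f \<noteq> 0 \<and>
    R *v q0 + S *v q1 = \<alpha> *s f \<and> adj S *v q0 + T *v q1 = \<beta> *s f \<and>
    R *v q0' + adj S *v q1' = cnj \<alpha> *s f \<and> S *v q0' + T *v q1' = cnj \<beta> *s f"
proof (rule ccontr)
  assume "\<not> ?thesis"
  then have edge: False if "\<alpha> \<noteq> 0 \<or> \<beta> \<noteq> 0" "f \<noteq> 0" "R *v q0 + S *v q1 = \<alpha> *s f" "adj S *v q0 + T *v q1 = \<beta> *s f"
    "R *v q0' + adj S *v q1' = cnj \<alpha> *s f" "S *v q0' + T *v q1' = cnj \<beta> *s f" for \<alpha> \<beta> f q0 q1 q0' q1'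
    using that by blast
  have P1: "psd2 R S T" and P2: "psd2 R (adj S) T" using P by (simp_all add: ppt2_def)
  have R: "psd R" and T: "psd T" using psd2_psd[OF P1] by simp_all
  \<comment> \<open>If T g were nonzero, (0, 1) tensor T g would lie in both ranges, as the image of
    (0, g).\<close>
  have ker: "S *v g = 0" "adj S *v g = 0" "T *v g = 0" if g: "R *v g = 0" for g
  proof -
    show 1: "S *v g = 0" using psd2_kernel[OF P2 g] by simp
    show 2: "adj S *v g = 0" using psd2_kernel[OF P1 g] .
    show "T *v g = 0"
    proof (rule ccontr)
      assume "T *v g \<noteq> 0"
      then show False using edge[of 0 1 "T *v g" 0 g 0 g] 1 2 by simp
    qed
  qed
  show False
  proof (cases rule: psd_cases3[OF R])
    case 1
    then have "T *v g = 0 *v g" for g using ker[of g] by simp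
    then have "T = 0" by (simp add: matrix_eq)
    then show False using nz 1 by (simp add: trace_def)
  next
    case y: (2 y)
    have orth: "S *v g = 0" "adj S *v g = 0" if "cip y g = 0" for g
      using ker[of g] y that by (simp_all add: outer_mv)
    \<comment> \<open>Both \<open>S\<close> and \<open>adj S\<close> kill the complement of
      \<open>y\<close>, which by adjunction makes \<open>y\<close> an eigenvector of each. The image
      of (y, 0) is then a product vector in both ranges.\<close>
    have eig: "\<exists>s. Q *v y = s *s y" if Q: "Q = S \<or> Q = adj S" for Q
    proof -
      define s where "s = cip y (Q *v y) / cip y y"
      define e where "e = Q *v y - s *s y"
      have e: "cip y e = 0" using y by (simp add: e_def cip_simps s_def)
      then have "cip e y = 0" by (metis cnj_cip complex_cnj_zero)
      moreover have "cip e (Q *v y) = 0" using orth[OF e] Q by (auto simp: cip_adj cip_simps)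
      ultimately have "cip e (Q *v y - s *s y) = 0" by (simp add: cip_simps)
      then have "e = 0" by (simp add: e_def[symmetric])
      then show ?thesis by (auto simp: e_def)
    qed
    obtain s s' where s: "S *v y = s *s y" "adj S *v y = s' *s y" using eig by metis
    have "cip y (adj S *v y) = cnj (cip y (S *v y))" by (simp add: cnj_cip cip_adj)
    then have "s' = cnj s" using y by (simp add: s cip_simps) (metis cip_eq_0 cip_simps(7) cnj_cip complex_cnj_mult mult_cancel_right)
    then show False
      using edge[of "cip y y" s' y y 0 y 0] y s by (simp add: outer_mv cnj_cip)
  next
    case (3 u)
    \<comment> \<open>In this case the kernel of \<open>R\<close> is either 0 or the line through
      \<open>u\<close>; g = 0 records the first alternative.\<close>
    define g where "g = (if R *v u = 0 then u else 0)"
    have Rg: "R *v g = 0" by (simp add: g_def)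
    note kg = ker[OF Rg]
    define R' where "R' = R + outer g g"
    have R'v: "cip v (R' *v v) = cip v (R *v v) + of_real ((cmod (cip g v))\<^sup>2)" for v
      unfolding complex_norm_square by (simp add: R'_def mv_simps outer_mv cip_simps cnj_cip)
    have herm: "adj R' = R'" using R by (simp add: R'_def adj_simps adj_outer psd_def)
    have pos: "Re (cip v (R' *v v)) > 0" if v: "v \<noteq> 0" for v
    proof (rule ccontr)
      assume "\<not> ?thesis"
      moreover have "0 \<le> Re (cip v (R *v v))" using R by (simp add: psd_def)
      moreover have "Re (cip v (R' *v v)) = Re (cip v (R *v v)) + (cmod (cip g v))\<^sup>2"
        unfolding R'v by simp
      ultimately have 0: "Re (cip v (R *v v)) = 0" "(cmod (cip g v))\<^sup>2 = 0"
        by (smt (verit) zero_le_power2)+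
      have Rv: "R *v v = 0"
      proof (rule cip_ext)
        fix w show "cip w (R *v v) = cip w 0" using psd_CS[OF R, of w v] 0 by (simp add: cip_simps)
      qed
      define k where "k = cip u v / cip u u"
      define e where "e = v - k *s u"
      have ue: "cip u e = 0" using 3(1) by (simp add: e_def cip_simps k_def)
      then obtain q where "e = R *v q" using 3(2) by blast
      then have "cip v e = 0" using R Rv by (simp add: psd_herm cip_simps)
      moreover have "cip e e = cip v e - cnj k * cip u e"
        unfolding cip_simps(8)[symmetric] cip_simps(4)[symmetric] by (simp add: e_def)
      ultimately have "e = 0" using ue by simp
      then have vk: "v = k *s u" by (simp add: e_def)
      then have "k \<noteq> 0" using v by auto
      then have "R *v u = 0" using Rv by (simp add: vk mv_smult)
      then have "cip g v = k * cip u u" by (simp add: g_def vk cip_simps)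
      then show False using 0 \<open>k \<noteq> 0\<close> 3(1) by simp
    qed
    obtain L :: "complex^3^3" where L': "(\<forall>a b. cip (L *v a) (R' *v (L *v b)) = cip a b) \<and> (\<forall>v. L *v (adj L *v (R' *v v)) = v)
      \<and> (\<forall>v. R' *v (L *v (adj L *v v)) = v) \<and> (\<forall>v. adj L *v (R' *v (L *v v)) = v)"
      using cholesky3[OF herm] pos by blast
    have L: "\<And>a b. cip (L *v a) (R' *v (L *v b)) = cip a b" "\<And>v. L *v (adj L *v (R' *v v)) = v"
      "\<And>v. R' *v (L *v (adj L *v v)) = v" "\<And>v. adj L *v (R' *v (L *v v)) = v"
      using L' by blast+
    define S1 T1 g1 where "S1 = adj L ** S ** L" and "T1 = adj L ** T ** L" and "g1 = adj L *v g"
    have adjS1: "adj S1 = adj L ** adj S ** L"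
      by (simp add: S1_def adj_mult matrix_mul_assoc)
    have S1v: "S1 *v v = adj L *v (S *v (L *v v))" and S1a: "adj S1 *v v = adj L *v (adj S *v (L *v v))"
      and T1v: "T1 *v v = adj L *v (T *v (L *v v))" for v
      unfolding adjS1 by (simp_all add: S1_def T1_def matrix_vector_mul_assoc matrix_mul_assoc)
    have Lg: "\<exists>c. L *v g1 = c *s g"
    proof (cases "g = 0")
      case True then show ?thesis by (simp add: g1_def)
    next
      case False
      have "R' *v g = cip g g *s g" by (simp add: R'_def mv_simps Rg outer_mv)
      then have "cip g g *s (L *v g1) = g" using L(2)[of g] by (simp add: g1_def mv_smult)
      moreover have "L *v g1 = (1 / cip g g) *s (cip g g *s (L *v g1))" using False by simp
      ultimately have "L *v g1 = (1 / cip g g) *s g" by simp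
      then show ?thesis ..
    qed
    have g1: "S1 *v g1 = 0" "adj S1 *v g1 = 0" "T1 *v g1 = 0"
      using Lg kg by (auto simp: S1v S1a T1v mv_smult)
    have schur: "psd (T1 - adj Q1 ** Q1)" if Q: "psd2 R Q T" and Q1: "\<And>v. Q1 *v v = adj L *v (Q *v (L *v v))" for Q Q1
      unfolding psd_def
    proof (intro conjI allI)
      show "adj (T1 - adj Q1 ** Q1) = T1 - adj Q1 ** Q1"
        using T by (simp add: T1_def adj_simps adj_mult psd_def matrix_mul_assoc)
      fix b
      \<comment> \<open>This is the minimiser in the first argument after whitening. Passing from
        \<open>R\<close> to the larger R' only increases the form, so its Schur complement is
        positive as well.\<close>
      define a where "a = - (Q1 *v b)"
      have "0 \<le> qf R Q T (L *v a) (L *v b)" using Q by (simp add: psd2_def)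
      also have "\<dots> \<le> qf R' Q T (L *v a) (L *v b)" by (simp add: qf_def R'v)
      also have "\<dots> = Re (cip a a) + 2 * Re (cip a (Q1 *v b)) + Re (cip b (T1 *v b))"
        by (simp add: qf_def L Q1 T1v cip_adj[of _ "adj L"])
      also have "\<dots> = Re (cip b ((T1 - adj Q1 ** Q1) *v b))"
        by (simp add: a_def cip_simps mv_simps matrix_vector_mul_assoc[symmetric] cip_adj)
      finally show "0 \<le> Re (cip b ((T1 - adj Q1 ** Q1) *v b))" .
    qed
    have X1: "psd (T1 - adj S1 ** S1)" using schur[OF P1] S1v by blast
    have X2: "psd (T1 - S1 ** adj S1)" using schur[OF P2, of "adj S1"] S1a by simp
    obtain \<alpha> \<beta> f q q' where f: "\<alpha> \<noteq> 0 \<or> \<beta> \<noteq> 0" "f \<noteq> 0" "cip g1 f = 0"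
      "\<beta> *s f - \<alpha> *s (adj S1 *v f) = (T1 - adj S1 ** S1) *v q"
      "cnj \<beta> *s f - cnj \<alpha> *s (S1 *v f) = (T1 - S1 ** adj S1) *v q'"
      using product_vector_normalized[of T1 S1 g1, OF X1 X2 g1(1) g1(2) g1(3)] by blast
    \<comment> \<open>Pullback of a normalised solution. As \<open>g1\<close> is orthogonal to f and
      killed by \<open>adj Q1\<close>, the vector L q0 is orthogonal to \<open>g\<close>, and there
      \<open>R\<close> and R' agree.\<close>
    have tr: "\<exists>q0 q1. R *v q0 + Q *v q1 = a *s (R' *v (L *v f)) \<and> adj Q *v q0 + T *v q1 = b *s (R' *v (L *v f))"
      if Q1: "\<And>v. Q1 *v v = adj L *v (Q *v (L *v v))" "\<And>v. adj Q1 *v v = adj L *v (adj Q *v (L *v v))" "adj Q1 *v g1 = 0"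
        and q: "b *s f - a *s (adj Q1 *v f) = (T1 - adj Q1 ** Q1) *v q" for Q Q1 a b q
    proof -
      define q0 where "q0 = a *s f - Q1 *v q"
      have inj: "v = c *s (R' *v (L *v f))" if "adj L *v v = c *s f" for v c
        using L(3)[of v] that by (simp add: mv_smult)
      have "cip g (L *v q0) = cip g1 q0" by (simp add: g1_def cip_adj)
      also have "\<dots> = 0" by (simp add: q0_def cip_simps f cip_adj Q1(3))
      finally have "R' *v (L *v q0) = R *v (L *v q0)" by (simp add: R'_def mv_simps outer_mv)
      then have "adj L *v (R *v (L *v q0) + Q *v (L *v q)) = a *s f"
        using L(4)[of q0] by (simp add: mv_simps flip: Q1) (simp add: q0_def)
      then have 1: "R *v (L *v q0) + Q *v (L *v q) = a *s (R' *v (L *v f))" by (rule inj)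
      have "adj L *v (adj Q *v (L *v q0) + T *v (L *v q)) = b *s f"
        using q by (simp add: mv_simps flip: Q1 T1v) (simp add: q0_def mv_simps matrix_vector_mul_assoc algebra_simps)
      then have 2: "adj Q *v (L *v q0) + T *v (L *v q) = b *s (R' *v (L *v f))" by (rule inj)
      show ?thesis using 1 2 by blast
    qed
    obtain q0 q1 where "R *v q0 + S *v q1 = \<alpha> *s (R' *v (L *v f))" "adj S *v q0 + T *v q1 = \<beta> *s (R' *v (L *v f))"
      using tr[OF S1v S1a g1(2) f(4)] by blast
    moreover obtain q0' q1' where "R *v q0' + adj S *v q1' = cnj \<alpha> *s (R' *v (L *v f))" "S *v q0' + T *v q1' = cnj \<beta> *s (R' *v (L *v f))"
      using tr[of "adj S1" "adj S" "cnj \<beta>" "cnj \<alpha>" q'] S1v S1a g1(1) f(5) by auto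
    moreover have "R' *v (L *v f) \<noteq> 0" using L(4)[of f] f(2) by auto
    ultimately show False using edge f(1) by blast
  qed
qed

text \<open>The trace of the product of the Hermitian block matrices with blocks A, B, D and R, S,
  T; the two off-diagonal contributions are conjugate, hence the factor 2.\<close>

definition pairing :: "complex^'n^'n \<Rightarrow> complex^'n^'n \<Rightarrow> complex^'n^'n \<Rightarrow> complex^'n^'n \<Rightarrow> complex^'n^'n \<Rightarrow> complex^'n^'n \<Rightarrow> real" where
  "pairing A B D R S T = Re (trace (A ** R)) + 2 * Re (trace (B ** adj S)) + Re (trace (D ** T))"

lemma adj_scaleR: "adj (c *\<^sub>R A) = c *\<^sub>R adj A"
  by (simp add: adj_def vec_eq_iff)

lemma mult_scaleR: "A ** (c *\<^sub>R B) = c *\<^sub>R (A ** B)" for A :: "complex^'n^'m"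
  by (simp add: vec_eq_iff matrix_matrix_mult_def scaleR_sum_right)

lemma trace_scaleR: "trace (c *\<^sub>R A) = c *\<^sub>R trace A" for A :: "complex^'n^'n"
  by (simp add: trace_def scaleR_sum_right)

lemma mv_scaleR: "(c *\<^sub>R A) *v x = c *\<^sub>R (A *v x)" for A :: "complex^'n^'m"
  by (simp add: vec_eq_iff matrix_vector_mult_def scaleR_sum_right)

lemma cip_scaleR: "cip x (c *\<^sub>R y) = c *\<^sub>R cip x y"
  by (simp add: cip_def scaleR_sum_right)

lemma qf_scaleR: "qf (c *\<^sub>R R) (c *\<^sub>R S) (c *\<^sub>R T) a b = c * qf R S T a b"
  by (simp add: qf_def mv_scaleR cip_scaleR algebra_simps)

lemma psd2_scaleR: "psd2 R S T \<Longrightarrow> 0 \<le> c \<Longrightarrow> psd2 (c *\<^sub>R R) (c *\<^sub>R S) (c *\<^sub>R T)"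
  by (simp add: psd2_def adj_scaleR qf_scaleR)

lemma ppt2_scaleR: "ppt2 R S T \<Longrightarrow> 0 \<le> c \<Longrightarrow> ppt2 (c *\<^sub>R R) (c *\<^sub>R S) (c *\<^sub>R T)"
  by (simp add: ppt2_def psd2_scaleR adj_scaleR)

lemma pairing_scaleR: "pairing A B D (c *\<^sub>R R) (c *\<^sub>R S) (c *\<^sub>R T) = c * pairing A B D R S T"
  by (simp add: pairing_def adj_scaleR mult_scaleR trace_scaleR algebra_simps)

lemma psd_trace_nonneg: "psd A \<Longrightarrow> 0 \<le> Re (trace A)"
  unfolding trace_def psd_def entry_cip[of A] by (simp add: sum_nonneg)

lemma psd2_trace_0:
  assumes P: "psd2 R S T" and t: "Re (trace R) + Re (trace T) = 0"
  shows "R = 0" "S = 0" "T = 0"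
proof -
  have "Re (trace R) = 0" "Re (trace T) = 0"
    using psd_trace_nonneg[OF psd2_psd(1)[OF P]] psd_trace_nonneg[OF psd2_psd(2)[OF P]] t by simp_all
  then show R: "R = 0" and "T = 0" using psd_trace_0 psd2_psd[OF P] by blast+
  have "adj S *v g = 0 *v g" for g using psd2_kernel[OF P, of g] R by simp
  then have "adj S = 0" by (simp add: matrix_eq)
  then have "adj (adj S) = adj 0" by simp
  then show "S = 0" by (simp add: adj_simps)
qed

lemma entry_le_trace:
  assumes A: "psd A"
  shows "Re (A $ i $ i) \<le> Re (trace A)" "0 \<le> Re (A $ i $ i)"
proof -
  have nn: "0 \<le> Re (A $ i $ i)" for i using A unfolding entry_cip[of A] psd_def by blast
  show "0 \<le> Re (A $ i $ i)" by (rule nn)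
  have "Re (A $ i $ i) \<le> (\<Sum>i\<in>UNIV. Re (A $ i $ i))" by (rule member_le_sum) (auto simp: nn)
  then show "Re (A $ i $ i) \<le> Re (trace A)" by (simp add: trace_def)
qed

lemma norm_le_entries:
  fixes A :: "complex^'n^'m"
  assumes "\<And>i j. cmod (A $ i $ j) \<le> c"
  shows "norm A \<le> of_nat (CARD('m) * CARD('n)) * c"
proof -
  have "norm A \<le> (\<Sum>i\<in>UNIV. norm (A $ i))" unfolding norm_vec_def[of A] by (rule L2_set_le_sum) simp
  also have "\<dots> \<le> (\<Sum>i\<in>(UNIV::'m set). of_nat CARD('n) * c)"
  proof (rule sum_mono)
    fix i
    have "norm (A $ i) \<le> (\<Sum>j\<in>UNIV. norm (A $ i $ j))" unfolding norm_vec_def[of "A $ i"] by (rule L2_set_le_sum) simp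
    also have "\<dots> \<le> of_nat CARD('n) * c" using assms by (intro sum_bounded_above) auto
    finally show "norm (A $ i) \<le> of_nat CARD('n) * c" .
  qed
  finally show ?thesis by simp
qed

lemma continuous_on_block:
  fixes F :: "'a::topological_space \<Rightarrow> complex^'n^'m"
  assumes "continuous_on X F"
  shows "continuous_on X (\<lambda>x. adj (F x))" "continuous_on X (\<lambda>x. cip a (F x *v b))"
  using assms unfolding adj_def cip_def matrix_vector_mult_def
  by (auto intro!: continuous_intros)

lemma continuous_on_trace:
  fixes F :: "'a::topological_space \<Rightarrow> complex^'n^'n"
  assumes "continuous_on X F"
  shows "continuous_on X (\<lambda>x. trace (F x))"
  using assms unfolding trace_def by (auto intro!: continuous_intros)

text \<open>All conditions are closed, and Cauchy-Schwarz bounds every entry by diagonal entries,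
  which are at most the trace 1.\<close>

lemma compact_ppt2:
  "compact {(R, S, T). ppt2 R S (T :: complex^'n^'n) \<and> Re (trace R) + Re (trace T) = 1}" (is "compact ?K")
proof -
  have e: "?K = {x. adj (fst x) = fst x} \<inter> {x. adj (snd (snd x)) = snd (snd x)}
    \<inter> (\<Inter>a. \<Inter>b. {x. 0 \<le> qf (fst x) (fst (snd x)) (snd (snd x)) a b}) 
    \<inter> (\<Inter>a. \<Inter>b. {x. 0 \<le> qf (fst x) (adj (fst (snd x))) (snd (snd x)) a b})
    \<inter> {x. Re (trace (fst x)) + Re (trace (snd (snd x))) = 1}"
    by (auto simp: ppt2_def psd2_def)
  have "closed ?K"
    unfolding e qf_def
    by (intro closed_Int closed_INT ballI closed_Collect_le closed_Collect_eq continuous_intros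
        continuous_on_block continuous_on_trace)
  moreover have "bounded ?K"
    unfolding bounded_iff
  proof (intro exI ballI)
    fix x assume "x \<in> ?K"
    then obtain R S T where x: "x = (R, S, T)" and p: "ppt2 R S T" and t: "Re (trace R) + Re (trace T) = 1" by auto
    have P: "psd2 R S T" using p by (simp add: ppt2_def)
    note RT = psd2_psd[OF P]
    have le: "Re (trace R) \<le> 1" "Re (trace T) \<le> 1" 
      using t psd_trace_nonneg[OF RT(1)] psd_trace_nonneg[OF RT(2)] by simp_all
    have b: "Re (R $ i $ i) \<le> 1" "Re (T $ i $ i) \<le> 1" "0 \<le> Re (R $ i $ i)" "0 \<le> Re (T $ i $ i)" for i
      using entry_le_trace[OF RT(1), of i] entry_le_trace[OF RT(2), of i] le by simp_all
    have m: "c \<le> 1" if "c\<^sup>2 \<le> p * q" "0 \<le> p" "p \<le> 1" "0 \<le> q" "q \<le> 1" for c p q :: real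
    proof -
      have "p * q \<le> 1" using that by (simp add: mult_le_one)
      then have "c\<^sup>2 \<le> 1\<^sup>2" using that(1) by simp
      then show ?thesis by (rule power2_le_imp_le) simp
    qed
    have "cmod (R $ i $ j) \<le> 1" for i j
      by (rule m[OF psd_CS[OF RT(1), of "axis i 1" "axis j 1", folded entry_cip]]) (rule b)+
    then have 1: "norm R \<le> of_nat (CARD('n) * CARD('n)) * 1" by (rule norm_le_entries)
    have "cmod (T $ i $ j) \<le> 1" for i j
      by (rule m[OF psd_CS[OF RT(2), of "axis i 1" "axis j 1", folded entry_cip]]) (rule b)+
    then have 2: "norm T \<le> of_nat (CARD('n) * CARD('n)) * 1" by (rule norm_le_entries)
    have "cmod (S $ i $ j) \<le> 1" for i j
    proof -
      have "(cmod (cip (S *v axis j 1) (axis i 1)))\<^sup>2 \<le> Re (T $ j $ j) * Re (R $ i $ i)"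
        using psd2_CS[OF P, of 0 "axis j 1" "axis i 1" 0] by (simp add: qf_def cip_simps entry_cip[symmetric])
      moreover have "cmod (cip (S *v axis j 1) (axis i 1)) = cmod (S $ i $ j)"
        by (metis cnj_cip complex_mod_cnj entry_cip)
      ultimately have "(cmod (S $ i $ j))\<^sup>2 \<le> Re (T $ j $ j) * Re (R $ i $ i)" by simp
      then show ?thesis by (rule m) (rule b)+
    qed
    then have 3: "norm S \<le> of_nat (CARD('n) * CARD('n)) * 1" by (rule norm_le_entries)
    have "norm x \<le> norm R + (norm S + norm T)"
      unfolding x by (intro order_trans[OF norm_Pair_le] add_left_mono norm_Pair_le)
    then show "norm x \<le> 3 * of_nat (CARD('n) * CARD('n))" using 1 2 3 by simp
  qed
  ultimately show ?thesis by (simp add: compact_eq_bounded_closed)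
qed

lemma pairing_diff: "pairing A B D (R - R') (S - S') (T - T') = pairing A B D R S T - pairing A B D R' S' T'"
proof -
  have "X ** (Y - Z) = X ** Y - X ** Z" for X Y Z :: "complex^'a^'a" by (rule matrix_sub_ldistrib)
  then show ?thesis by (simp add: pairing_def adj_simps trace_sub)
qed

lemma pairing_product:
  "pairing A B D (outer p p) (outer p q) (outer q q) = Re (cip p (A *v p)) + 2 * Re (cip p (B *v q)) + Re (cip q (D *v q))"
  by (simp add: pairing_def adj_outer trace_outer)

text \<open>Duality form of the Stoermer--Woronowicz theorem for $2 \otimes 3$. A trace-one minimiser
  with negative value would be an edge state: splitting off a product vector from the two ranges
  lowers the normalised value.\<close>

lemma ppt2_pairing_nonneg:
  fixes R S T A B D :: "complex^3^3"
  assumes P: "ppt2 R S T"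
    and W: "\<And>\<alpha> \<beta> f. 0 \<le> qf A B D (\<alpha> *s f) (\<beta> *s f)"
  shows "0 \<le> pairing A B D R S T"
proof (rule ccontr)
  assume neg: "\<not> ?thesis"
  define K where "K = {(R, S, T). ppt2 R S (T :: complex^3^3) \<and> Re (trace R) + Re (trace T) = 1}"
  define tr where "tr R T = Re (trace R) + Re (trace T)" for R T :: "complex^3^3"
  have tr0: "pairing A B D R S T = 0" if "ppt2 R S T" "tr R T = 0" for R S T
    using psd2_trace_0[of R S T] that by (simp add: ppt2_def pairing_def tr_def adj_simps trace_def)
  have trnn: "0 \<le> tr R T" if "ppt2 R S T" for R S T
    using that psd2_psd[of R S T] by (auto simp: ppt2_def tr_def intro!: add_nonneg_nonneg psd_trace_nonneg)
  have norm: "(inverse (tr R T) *\<^sub>R R, inverse (tr R T) *\<^sub>R S, inverse (tr R T) *\<^sub>R T) \<in> K" if "ppt2 R S T" "tr R T > 0" for R S T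
    using that ppt2_scaleR[of R S T "inverse (tr R T)"]
    by (simp add: K_def trace_scaleR distrib_left[symmetric]) (simp add: tr_def)
  have "tr R T > 0" using trnn[OF P] tr0[OF P] neg by (cases "tr R T = 0") auto
  then have ne: "K \<noteq> {}" using norm[OF P] by blast
  have "continuous_on K (\<lambda>x. pairing A B D (fst x) (fst (snd x)) (snd (snd x)))"
    unfolding pairing_def trace_def matrix_matrix_mult_def adj_def by (simp add: continuous_intros)
  moreover have "compact K" unfolding K_def by (rule compact_ppt2)
  ultimately obtain R1 S1 T1 where 1: "(R1, S1, T1) \<in> K" "\<forall>x\<in>K. pairing A B D R1 S1 T1 \<le> pairing A B D (fst x) (fst (snd x)) (snd (snd x))"
    using continuous_attains_inf[OF _ ne] by fastforce
  define m where "m = pairing A B D R1 S1 T1"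
  \<comment> \<open>Homogeneity carries the minimum over trace one to all PPT triples.\<close>
  have min: "m * tr R T \<le> pairing A B D R S T" if "ppt2 R S T" for R S T
  proof (cases "tr R T = 0")
    case True then show ?thesis using tr0[OF that] by simp
  next
    case False
    then have t: "tr R T > 0" using trnn[OF that] by simp
    have "m \<le> inverse (tr R T) * pairing A B D R S T"
      using 1(2) norm[OF that t] pairing_scaleR[of A B D "inverse (tr R T)" R S T] unfolding m_def by force
    then show ?thesis using t by (simp add: field_simps)
  qed
  have "m < 0"
  proof -
    have "m * tr R T < 0" using min[OF P] neg by simp
    then show ?thesis using trnn[OF P] by (simp add: mult_less_0_iff)
  qed
  have p1: "ppt2 R1 S1 T1" and t1: "tr R1 T1 = 1" using 1(1) by (simp_all add: K_def tr_def)
  obtain \<alpha> \<beta> f q0 q1 q0' q1' where e: "\<alpha> \<noteq> 0 \<or> \<beta> \<noteq> 0" "f \<noteq> 0"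
    "R1 *v q0 + S1 *v q1 = \<alpha> *s f" "adj S1 *v q0 + T1 *v q1 = \<beta> *s f"
    "R1 *v q0' + adj S1 *v q1' = cnj \<alpha> *s f" "S1 *v q0' + T1 *v q1' = cnj \<beta> *s f"
    using ppt2_product_vector[OF p1, folded tr_def] unfolding t1 by (metis zero_neq_one)
  define c where "c = qf R1 S1 T1 q0 q1"
  define c' where "c' = qf R1 (adj S1) T1 q0' q1'"
  have cc: "0 \<le> c" "0 \<le> c'" using p1 by (simp_all add: c_def c'_def ppt2_def psd2_def)
  \<comment> \<open>One weight small enough for \<open>psd2_minus_product\<close> on the matrix and
    on its partial transpose.\<close>
  define l where "l = 1 / (1 + c + c')"
  have l: "0 < l" "l * c \<le> 1" "l * c' \<le> 1" using cc by (simp_all add: l_def)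
  define k where "k = complex_of_real (sqrt l)"
  define x where "x = k *s (\<alpha> *s f)"
  define y where "y = k *s (\<beta> *s f)"
  define x' where "x' = k *s (cnj \<alpha> *s f)"
  define y' where "y' = k *s (cnj \<beta> *s f)"
  have "psd2 (R1 - outer x x) (S1 - outer x y) (T1 - outer y y)"
    unfolding x_def y_def k_def using p1 e l by (intro psd2_minus_product[where ?q0.0 = q0 and ?q1.0 = q1]) (auto simp: ppt2_def c_def)
  moreover have "psd2 (R1 - outer x' x') (adj S1 - outer x' y') (T1 - outer y' y')"
    unfolding x'_def y'_def k_def using p1 e l by (intro psd2_minus_product[where ?q0.0 = q0' and ?q1.0 = q1']) (auto simp: ppt2_def c'_def)
  \<comment> \<open>Since k is real, conjugating \<alpha> and \<beta> partially transposes the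
    product projector, so both subtractions remove the same triple.\<close>
  moreover have "outer x' x' = outer x x" "outer y' y' = outer y y" "outer x' y' = adj (outer x y)"
    by (simp_all add: x_def x'_def y_def y'_def outer_def adj_def vec_eq_iff k_def)
  ultimately have p2: "ppt2 (R1 - outer x x) (S1 - outer x y) (T1 - outer y y)"
    by (simp add: ppt2_def adj_simps)
  \<comment> \<open>The subtraction lowers the trace by |x|^2 + |y|^2 and does not raise the
    pairing; for m < 0 this contradicts minimality unless x = y = 0.\<close>
  have "m * tr (R1 - outer x x) (T1 - outer y y) \<le> m - pairing A B D (outer x x) (outer x y) (outer y y)"
    using min[OF p2] by (simp add: pairing_diff m_def)
  moreover have "0 \<le> pairing A B D (outer x x) (outer x y) (outer y y)"
    using W[of "k * \<alpha>" f "k * \<beta>"] by (simp add: pairing_product x_def y_def qf_def)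
  moreover have "tr (R1 - outer x x) (T1 - outer y y) = 1 - ((norm x)\<^sup>2 + (norm y)\<^sup>2)"
    using t1 by (simp add: tr_def trace_sub trace_outer1 cip_self)
  ultimately have "m * (1 - ((norm x)\<^sup>2 + (norm y)\<^sup>2)) \<le> m" by simp
  then have "0 \<le> m * ((norm x)\<^sup>2 + (norm y)\<^sup>2)" by (simp add: algebra_simps)
  then have "(norm x)\<^sup>2 + (norm y)\<^sup>2 \<le> 0" using \<open>m < 0\<close> by (simp add: zero_le_mult_iff)
  then have "x = 0 \<and> y = 0" by (simp add: sum_power2_le_zero_iff)
  moreover have "k \<noteq> 0" using l by (simp add: k_def)
  ultimately show False using e(1,2) by (simp add: x_def y_def)
qed

section \<open>Forms on C^3 tensor C^3 that are positive up to Schmidt rank two\<close>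

type_synonym block_matrix = "3 \<Rightarrow> 3 \<Rightarrow> complex^3^3"

definition block_psd :: "block_matrix \<Rightarrow> bool" where
  "block_psd C \<longleftrightarrow> (\<forall>i j. adj (C i j) = C j i) \<and> (\<forall>v. 0 \<le> Re (\<Sum>i\<in>UNIV. \<Sum>j\<in>UNIV. cip (v i) (C i j *v v j)))"

text \<open>The partial transposition acts on the first tensor factor here.\<close>

definition block_ppt :: "block_matrix \<Rightarrow> bool" where
  "block_ppt C \<longleftrightarrow> block_psd C \<and> block_psd (\<lambda>i j. C j i)"

lemma block_psd_psd2:
  assumes "block_psd C"
  shows "psd2 (C 1 1) (C 1 2) (C 2 2)"
  unfolding psd2_def
proof (intro conjI allI)
  show "adj (C 1 1) = C 1 1" "adj (C 2 2) = C 2 2" using assms by (simp_all add: block_psd_def)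
  fix a b
  define v :: "3 \<Rightarrow> complex^3" where "v i = (if i = 1 then a else if i = 2 then b else 0)" for i
  have h: "adj (C 1 2) = C 2 1" using assms by (simp add: block_psd_def)
  have "Re (cip b (C 2 1 *v a)) = Re (cip a (C 1 2 *v b))"
    unfolding h[symmetric] by (metis Re_cip_sym cip_adj2)
  moreover have "0 \<le> Re (\<Sum>i\<in>UNIV. \<Sum>j\<in>UNIV. cip (v i) (C i j *v v j))" using assms by (simp add: block_psd_def)
  ultimately show "0 \<le> qf (C 1 1) (C 1 2) (C 2 2) a b"
    by (simp add: qf_def v_def sum_3 cip_simps)
qed

lemma block_ppt_ppt2:
  assumes "block_ppt C"
  shows "ppt2 (C 1 1) (C 1 2) (C 2 2)"
proof -
  have "adj (C 1 2) = C 2 1" using assms by (simp add: block_psd_def block_ppt_def)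
  then show ?thesis
    using assms block_psd_psd2[of C] block_psd_psd2[of "\<lambda>i j. C j i"] by (simp add: block_ppt_def ppt2_def)
qed

lemma trace_adj_mult: "trace (A ** B) = cnj (trace (adj A ** adj B))" for A B :: "complex^'n^'n"
  by (metis trace_adj adj_mult trace_mul_sym complex_cnj_cnj)

text \<open>Following Choi: subtracting the completely positive part $U_{i3} U_{33}^{-1} U_{3j}$ leaves a form that
  lives on the indices 1, 2 and is still block positive, so the two-block case applies.\<close>

lemma two_positive_pairing_pd:
  assumes C: "block_ppt C" and U: "\<And>i j. adj (U i j) = U j i"
    and pos: "\<And>s t x y. 0 \<le> Re (\<Sum>i\<in>UNIV. \<Sum>j\<in>UNIV. cip (s i *s x + t i *s y) (U i j *v (s j *s x + t j *s y)))"
    and pd: "\<And>v. v \<noteq> 0 \<Longrightarrow> 0 < Re (cip v (U 3 3 *v v))"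
  shows "0 \<le> Re (\<Sum>i\<in>UNIV. \<Sum>j\<in>UNIV. trace (C i j ** U j i))"
proof -
  obtain L :: "complex^3^3" where L': "(\<forall>a b. cip (L *v a) (U 3 3 *v (L *v b)) = cip a b) \<and> (\<forall>v. L *v (adj L *v (U 3 3 *v v)) = v)
      \<and> (\<forall>v. U 3 3 *v (L *v (adj L *v v)) = v) \<and> (\<forall>v. adj L *v (U 3 3 *v (L *v v)) = v)"
    using cholesky3[of "U 3 3"] U[of 3 3] pd by blast
  have L: "L *v (adj L *v (U 3 3 *v v)) = v" "U 3 3 *v (L *v (adj L *v v)) = v" for v
    using L' by blast+
  \<comment> \<open>\<open>L ** adj L\<close> inverts \<open>U 3 3\<close>, so \<open>Z\<close>
    below is Choi's subtrahend in factored form.\<close>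
  define K where "K i = U i 3 ** L" for i
  define Z where "Z i j = K i ** adj (K j)" for i j
  have adjK: "adj (K i) *v v = adj L *v (U 3 i *v v)" for i v
    by (simp add: K_def adj_mult U matrix_vector_mul_assoc)
  have Zv: "Z i j *v v = U i 3 *v (L *v (adj L *v (U 3 j *v v)))" for i j v
    by (simp add: Z_def K_def adj_mult U matrix_vector_mul_assoc matrix_mul_assoc)
  have Z3: "Z i 3 = U i 3" "Z 3 i = U 3 i" for i
    by (simp_all add: matrix_eq Zv L)
  define V where "V i j = U i j - Z i j" for i j
  have V3: "V i 3 = 0" "V 3 i = 0" for i by (simp_all add: V_def Z3)
  have adjV: "adj (V i j) = V j i" for i j
    by (simp add: V_def Z_def adj_simps adj_mult U)
  have 1: "0 \<le> Re (\<Sum>i\<in>UNIV. \<Sum>j\<in>UNIV. trace (C i j ** Z j i))"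
  proof -
    \<comment> \<open>For each column k the vectors K i e_k form one test family for the positivity
      of \<open>C\<close>.\<close>
    have t: "trace (C i j ** Z j i) = (\<Sum>k\<in>UNIV. cip (K i *v axis k 1) (C i j *v (K j *v axis k 1)))" for i j
    proof -
      have "trace (C i j ** Z j i) = trace (adj (K i) ** (C i j ** K j))"
        by (metis Z_def trace_mul_sym matrix_mul_assoc)
      also have "\<dots> = (\<Sum>k\<in>UNIV. cip (axis k 1) (adj (K i) *v (C i j *v (K j *v axis k 1))))"
        by (simp add: trace_def entry_cip matrix_vector_mul_assoc matrix_mul_assoc)
      finally show ?thesis by (simp add: cip_adj[of _ "adj (K i)"])
    qed
    have "(\<Sum>i\<in>UNIV. \<Sum>j\<in>UNIV. trace (C i j ** Z j i))
      = (\<Sum>k\<in>UNIV. \<Sum>i\<in>UNIV. \<Sum>j\<in>UNIV. cip (K i *v axis k 1) (C i j *v (K j *v axis k 1)))"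
      unfolding t by (subst sum.swap, rule sum.cong[OF refl], subst sum.swap) (rule refl)
    also have "Re \<dots> = (\<Sum>k\<in>UNIV. Re (\<Sum>i\<in>UNIV. \<Sum>j\<in>UNIV. cip (K i *v axis k 1) (C i j *v (K j *v axis k 1))))"
      by simp
    also have "\<dots> \<ge> 0" using C by (intro sum_nonneg) (simp add: block_ppt_def block_psd_def)
    finally show ?thesis .
  qed
  have 2: "0 \<le> Re (\<Sum>i\<in>UNIV. \<Sum>j\<in>UNIV. trace (C i j ** V j i))"
  proof -
    have "0 \<le> pairing (V 1 1) (V 1 2) (V 2 2) (C 1 1) (C 1 2) (C 2 2)"
    proof (rule ppt2_pairing_nonneg[OF block_ppt_ppt2[OF C]])
      fix \<alpha> \<beta> and f :: "complex^3"
      define a b where "a = \<alpha> *s f" and "b = \<beta> *s f"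
      define h where "h = U 3 1 *v a + U 3 2 *v b"
      \<comment> \<open>Completing the square: y is minus the inverse of \<open>U 3 3\<close>
        applied to h. The tested vector with components \<alpha> f, \<beta> f, y uses only f and y,
        so its Schmidt rank is at most two.\<close>
      define y where "y = - (L *v (adj L *v h))"
      define s t where "s i = (if i = 1 then \<alpha> else if i = 2 then \<beta> else 0)" and "t i = (if i = 3 then 1 else 0 :: complex)" for i :: 3
      have q: "0 \<le> Re (\<Sum>i\<in>UNIV. \<Sum>j\<in>UNIV. cip (s i *s f + t i *s y) (U i j *v (s j *s f + t j *s y)))" by (rule pos)
      have sw: "Re (cip u (U i j *v v)) = Re (cip v (U j i *v u))" for u v i j
        by (metis Re_cip_sym cip_adj U)
      have "(\<Sum>i\<in>UNIV. \<Sum>j\<in>UNIV. cip (s i *s f + t i *s y) (U i j *v (s j *s f + t j *s y)))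
        = cip a (U 1 1 *v a) + cip a (U 1 2 *v b) + cip a (U 1 3 *v y) + (cip b (U 2 1 *v a) + cip b (U 2 2 *v b) + cip b (U 2 3 *v y))
          + (cip y h + cip y (U 3 3 *v y))"
      proof -
        have v: "s 1 *s f + t 1 *s y = a" "s 2 *s f + t 2 *s y = b" "s 3 *s f + t 3 *s y = y"
          by (simp_all add: s_def t_def a_def b_def)
        show ?thesis unfolding sum_3 v by (simp add: h_def cip_simps)
      qed
      moreover have "U 3 3 *v y = - h" by (simp add: y_def mv_simps L)
      moreover have "Re (cip a (U 1 3 *v y)) + Re (cip b (U 2 3 *v y)) = Re (cip y h)"
        by (simp add: sw[of a 1 3] sw[of b 2 3] h_def cip_simps)
      ultimately have "0 \<le> Re (cip a (U 1 1 *v a)) + 2 * Re (cip a (U 1 2 *v b)) + Re (cip b (U 2 2 *v b)) + Re (cip y h)"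
        using q sw[of b 2 1 a] by (simp add: cip_simps)
      moreover have "cip y h = - cip (adj L *v h) (adj L *v h)"
        by (simp add: y_def cip_simps cip_adj2)
      moreover have "Re (cip (adj L *v h) (adj L *v h)) = Re (cip a (Z 1 1 *v a)) + 2 * Re (cip a (Z 1 2 *v b)) + Re (cip b (Z 2 2 *v b))"
      proof -
        have z: "cip u (Z i j *v v) = cip (adj L *v (U 3 i *v u)) (adj L *v (U 3 j *v v))" for u v i j
          by (simp add: Zv cip_adj[of _ "U _ 3"] cip_adj[of _ L] U)
        show ?thesis
          by (simp add: z h_def mv_simps cip_simps Re_cip_sym[of "adj L *v (U 3 2 *v b)" "adj L *v (U 3 1 *v a)"])
      qed
      ultimately show "0 \<le> qf (V 1 1) (V 1 2) (V 2 2) (\<alpha> *s f) (\<beta> *s f)"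
        by (simp add: qf_def V_def mv_simps cip_simps a_def[symmetric] b_def[symmetric])
    qed
    moreover have "Re (trace (C 1 2 ** V 2 1)) = Re (trace (V 1 2 ** C 2 1))"
      using C unfolding trace_adj_mult[of "C 1 2"] by (simp add: adjV block_ppt_def block_psd_def trace_mul_sym[of "V 1 2"])
    moreover have "adj (C 1 2) = C 2 1" using C by (simp add: block_ppt_def block_psd_def)
    ultimately show ?thesis
      by (simp add: pairing_def sum_3 V3 trace_mul_sym[of "C _ _"] trace_def[of 0])
  qed
  have "trace (C i j ** U j i) = trace (C i j ** Z j i) + trace (C i j ** V j i)" for i j
  proof -
    have "U j i = Z j i + V j i" by (simp add: V_def)
    then show ?thesis by (simp only: matrix_add_ldistrib trace_add)
  qed
  then show ?thesis using 1 2 by (simp add: sum.distrib)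
qed

text \<open>Adding e times the identity to \<open>U\<close> makes the corner \<open>U 3 3\<close>
  positive definite and changes the pairing by e d, with d the trace of \<open>C\<close>; then e
  tends to 0.\<close>

lemma two_positive_pairing:
  assumes C: "block_ppt C" and U: "\<And>i j. adj (U i j) = U j i"
    and pos: "\<And>s t x y. 0 \<le> Re (\<Sum>i\<in>UNIV. \<Sum>j\<in>UNIV. cip (s i *s x + t i *s y) (U i j *v (s j *s x + t j *s y)))"
  shows "0 \<le> Re (\<Sum>i\<in>UNIV. \<Sum>j\<in>UNIV. trace (C i j ** U j i))"
proof -
  define I :: "complex^3^3" where "I = Finite_Cartesian_Product.mat 1"
  define d where "d = Re (trace (C 1 1) + trace (C 2 2) + trace (C 3 3))"
  have "0 \<le> Re (\<Sum>i\<in>UNIV. \<Sum>j\<in>UNIV. trace (C i j ** U j i)) + e * d" if e: "e > 0" for e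
  proof -
    define U' where "U' i j = (if i = j then U i j + e *\<^sub>R I else U i j)" for i j
    have Iv: "(e *\<^sub>R I) *v v = e *\<^sub>R v" for v by (simp add: I_def mv_scaleR matrix_vector_mul_lid)
    have "0 \<le> Re (\<Sum>i\<in>UNIV. \<Sum>j\<in>UNIV. trace (C i j ** U' j i))"
    proof (rule two_positive_pairing_pd[OF C])
      show "adj (U' i j) = U' j i" for i j
        by (simp add: U'_def U adj_simps adj_scaleR I_def) (auto simp: adj_def Finite_Cartesian_Product.mat_def vec_eq_iff)
      have f: "Re (\<Sum>i\<in>UNIV. \<Sum>j\<in>UNIV. cip (v i) (U' i j *v v j))
        = Re (\<Sum>i\<in>UNIV. \<Sum>j\<in>UNIV. cip (v i) (U i j *v v j)) + e * (\<Sum>i\<in>UNIV. (norm (v i))\<^sup>2)" for v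
        by (simp add: U'_def sum_3 mv_simps Iv cip_simps cip_scaleR cip_self algebra_simps)
      show "0 \<le> Re (\<Sum>i\<in>UNIV. \<Sum>j\<in>UNIV. cip (s i *s x + t i *s y) (U' i j *v (s j *s x + t j *s y)))" for s t x y
        unfolding f using pos[of s x t y] e by (intro add_nonneg_nonneg) (auto intro!: mult_nonneg_nonneg sum_nonneg)
      fix v :: "complex^3" assume v: "v \<noteq> 0"
      have "0 \<le> Re (cip v (U 3 3 *v v))"
        using pos[of "\<lambda>i. if i = 3 then 1 else 0" v "\<lambda>i. 0" v] by (simp add: sum_3 cip_simps)
      moreover have "0 < e * (norm v)\<^sup>2" using e v by simp
      ultimately show "0 < Re (cip v (U' 3 3 *v v))"
        by (simp add: U'_def mv_simps Iv cip_simps cip_scaleR cip_self)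
    qed
    moreover have "Re (\<Sum>i\<in>UNIV. \<Sum>j\<in>UNIV. trace (C i j ** U' j i)) = Re (\<Sum>i\<in>UNIV. \<Sum>j\<in>UNIV. trace (C i j ** U j i)) + e * d"
      by (simp add: U'_def sum_3 matrix_add_ldistrib trace_add mult_scaleR trace_scaleR d_def I_def matrix_mul_rid algebra_simps)
    ultimately show ?thesis by simp
  qed
  note * = this
  have "0 \<le> Re (\<Sum>i\<in>UNIV. \<Sum>j\<in>UNIV. trace (C i j ** U j i)) + \<epsilon>" if "\<epsilon> > 0" for \<epsilon>
  proof -
    have "0 < \<epsilon> / (\<bar>d\<bar> + 1)" using that by simp
    from *[OF this] have "0 \<le> Re (\<Sum>i\<in>UNIV. \<Sum>j\<in>UNIV. trace (C i j ** U j i)) + \<epsilon> / (\<bar>d\<bar> + 1) * d" .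
    moreover have "\<epsilon> / (\<bar>d\<bar> + 1) * d \<le> \<epsilon>"
    proof -
      have "\<epsilon> * d \<le> \<epsilon> * (\<bar>d\<bar> + 1)" using that by (intro mult_left_mono) auto
      then show ?thesis by (simp add: pos_divide_le_eq)
    qed
    ultimately show ?thesis by simp
  qed
  then show ?thesis by (rule field_le_epsilon)
qed

lemma sum_mv: "(\<Sum>i\<in>I. F i) *v x = (\<Sum>i\<in>I. F i *v x)" for F :: "'i \<Rightarrow> complex^'n^'m"
  by (induction I rule: infinite_finite_induct) (simp_all add: mv_simps)

lemma cip_sum: "cip x (\<Sum>i\<in>I. F i) = (\<Sum>i\<in>I. cip x (F i))" 
  by (induction I rule: infinite_finite_induct) (simp_all add: cip_simps)

lemma adj_sum: "adj (\<Sum>i\<in>I. F i) = (\<Sum>i\<in>I. adj (F i))"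
  by (induction I rule: infinite_finite_induct) (simp_all add: adj_simps)

definition scal :: "complex \<Rightarrow> complex^'n^'m \<Rightarrow> complex^'n^'m" where
  "scal c A = (\<chi> i j. c * A $ i $ j)"

lemma scal_simps: "scal c A *v x = c *s (A *v x)" "adj (scal c A) = scal (cnj c) (adj A)"
  "scal c A ** B = scal c (A ** B)" "A ** scal c B = scal c (A ** B)"
  by (simp_all add: scal_def adj_def vec_eq_iff matrix_vector_mult_def matrix_matrix_mult_def sum_distrib_left mult_ac)

lemma trace_scal: "trace (scal c A) = c * trace A"
  by (simp add: scal_def trace_def sum_distrib_left)

lemma sum_mm: "(\<Sum>i\<in>I. F i) ** A = (\<Sum>i\<in>I. F i ** A)" for F :: "'i \<Rightarrow> complex^'n^'m" and A :: "complex^'k^'n"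
  by (induction I rule: infinite_finite_induct) (simp_all add: vec_eq_iff matrix_matrix_mult_def sum.distrib distrib_right)

lemma mm_sum: "A ** (\<Sum>i\<in>I. F i) = (\<Sum>i\<in>I. A ** F i)" for F :: "'i \<Rightarrow> complex^'n^'m" and A :: "complex^'m^'k"
  by (induction I rule: infinite_finite_induct) (simp_all add: matrix_add_ldistrib)

lemma trace_sum: "trace (\<Sum>i\<in>I. F i) = (\<Sum>i\<in>I. trace (F i))" for F :: "'i \<Rightarrow> complex^'n^'n"
  by (induction I rule: infinite_finite_induct) (simp_all add: trace_add trace_def[of 0])

text \<open>If \<open>C\<close> is the Choi matrix of \<phi>, the double sum is the (i, j) block of
  the Choi matrix of the composition. Trace duality moves the outer \<phi> over to \<open>W\<close>,
  giving \<open>U\<close>. On vectors of Schmidt rank two \<open>U\<close> reduces to a pairing in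
  M_2 tensor M_3.\<close>

lemma composition_pairing:
  assumes C: "block_ppt C" and W: "\<And>i j. adj (W i j) = W j i"
    and bp: "\<And>s x. 0 \<le> Re (\<Sum>i\<in>UNIV. \<Sum>j\<in>UNIV. cip (s i *s x) (W i j *v (s j *s x)))"
  shows "0 \<le> Re (\<Sum>i\<in>UNIV. \<Sum>j\<in>UNIV. trace ((\<Sum>a\<in>UNIV. \<Sum>b\<in>UNIV. scal (C i j $ a $ b) (C a b)) ** W j i))"
proof -
  have Ch: "adj (C a b) = C b a" for a b using C by (simp add: block_ppt_def block_psd_def)
  \<comment> \<open>Transposed order of b and a, so that the trace of E_ab times
    \<open>U j i\<close> is that of \<open>C a b ** W j i\<close>.\<close>
  define U :: block_matrix where "U j i = (\<chi> b a. trace (C a b ** W j i))" for i j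
  have "0 \<le> Re (\<Sum>i\<in>UNIV. \<Sum>j\<in>UNIV. trace (C i j ** U j i))"
  proof (rule two_positive_pairing[OF C])
    have "cnj (trace (C a b ** W j i)) = trace (C b a ** W i j)" for a b i j
      by (metis trace_adj_mult Ch W complex_cnj_cnj)
    then show "adj (U i j) = U j i" for i j
      by (simp add: U_def adj_def vec_eq_iff)
    fix s t :: "3 \<Rightarrow> complex" and x y :: "complex^3"
    \<comment> \<open>\<open>P y y'\<close> is the map with Choi blocks \<open>C\<close> applied to
      \<open>outer y y'\<close>. The blocks P x x, P x y, P y y form its ampliation on the projector
      onto (x, y), so they inherit the PPT property, while \<open>Q\<close> compresses
      \<open>W\<close> to the span of s and t.\<close>
    define P where "P y y' = (\<Sum>a\<in>UNIV. \<Sum>b\<in>UNIV. scal (y $ a * cnj (y' $ b)) (C a b))" for y y' :: "complex^3"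
    define Q where "Q s t = (\<Sum>j\<in>UNIV. \<Sum>i\<in>UNIV. scal (cnj (s j) * t i) (W j i))" for s t :: "3 \<Rightarrow> complex"
    have adjP: "adj (P y y') = P y' y" for y y'
      unfolding P_def adj_sum scal_simps Ch by (subst sum.swap) (simp add: mult.commute)
    have adjQ: "adj (Q s t) = Q t s" for s t
      unfolding Q_def adj_sum scal_simps W by (subst sum.swap) (simp add: mult.commute)
    have PQ: "trace (P y y' ** Q s t) = (\<Sum>j\<in>UNIV. \<Sum>i\<in>UNIV. cip (s j *s y') (U j i *v (t i *s y)))" for y y' s t
    proof -
      have "trace (P y y' ** W j i) = cip y' (U j i *v y)" for j i
      proof -
        have "trace (P y y' ** W j i) = (\<Sum>a\<in>UNIV. \<Sum>b\<in>UNIV. y $ a * cnj (y' $ b) * trace (C a b ** W j i))"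
          unfolding P_def sum_mm trace_sum scal_simps trace_scal ..
        also have "\<dots> = (\<Sum>b\<in>UNIV. \<Sum>a\<in>UNIV. y $ a * cnj (y' $ b) * trace (C a b ** W j i))" by (rule sum.swap)
        also have "\<dots> = cip y' (U j i *v y)"
          by (simp add: cip_def matrix_vector_mult_def U_def sum_distrib_left mult_ac)
        finally show ?thesis .
      qed
      then show ?thesis
        unfolding Q_def mm_sum trace_sum scal_simps trace_scal by (simp add: cip_simps mv_smult mult_ac)
    qed
    have "0 \<le> pairing (Q s s) (Q s t) (Q t t) (P x x) (P x y) (P y y)"
    proof (rule ppt2_pairing_nonneg)
      have Pv: "cip u (P y y' *v v) = (\<Sum>a\<in>UNIV. \<Sum>b\<in>UNIV. cip (cnj (y $ a) *s u) (C a b *v (cnj (y' $ b) *s v)))" for u v y y'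
        unfolding P_def sum_mv cip_sum scal_simps by (simp add: cip_simps mv_smult mult_ac)
      have Pv': "cip u (P y y' *v v) = (\<Sum>a\<in>UNIV. \<Sum>b\<in>UNIV. cip (y' $ a *s u) (C b a *v (y $ b *s v)))" for u v y y'
        unfolding P_def sum_mv cip_sum scal_simps by (subst sum.swap) (simp add: cip_simps mv_smult mult_ac)
      have sw: "Re (cip v (P y x *v u)) = Re (cip u (P x y *v v))" for u v x y
        by (metis adjP Re_cip_sym cip_adj2)
      have "psd2 (P x x) (P x y) (P y y)"
        unfolding psd2_def
      proof (intro conjI allI)
        fix u v
        have "0 \<le> Re (\<Sum>a\<in>UNIV. \<Sum>b\<in>UNIV. cip (cnj (x $ a) *s u + cnj (y $ a) *s v) (C a b *v (cnj (x $ b) *s u + cnj (y $ b) *s v)))"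
          using C by (simp add: block_ppt_def block_psd_def)
        also have "(\<Sum>a\<in>UNIV. \<Sum>b\<in>UNIV. cip (cnj (x $ a) *s u + cnj (y $ a) *s v) (C a b *v (cnj (x $ b) *s u + cnj (y $ b) *s v)))
          = cip u (P x x *v u) + cip u (P x y *v v) + cip v (P y x *v u) + cip v (P y y *v v)"
          unfolding Pv mv_simps(1) cip_simps(1,2) sum.distrib by (simp only: add_ac)
        finally show "0 \<le> qf (P x x) (P x y) (P y y) u v"
          using sw[of v y x u] by (simp add: qf_def)
      qed (simp_all add: adjP)
      moreover have "psd2 (P x x) (P y x) (P y y)"
        unfolding psd2_def
      proof (intro conjI allI)
        fix u v
        have "0 \<le> Re (\<Sum>a\<in>UNIV. \<Sum>b\<in>UNIV. cip (x $ a *s u + y $ a *s v) (C b a *v (x $ b *s u + y $ b *s v)))"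
          using C by (simp add: block_ppt_def block_psd_def)
        also have "(\<Sum>a\<in>UNIV. \<Sum>b\<in>UNIV. cip (x $ a *s u + y $ a *s v) (C b a *v (x $ b *s u + y $ b *s v)))
          = cip u (P x x *v u) + cip u (P y x *v v) + cip v (P x y *v u) + cip v (P y y *v v)"
          unfolding Pv' mv_simps(1) cip_simps(1,2) sum.distrib by (simp only: add_ac)
        finally show "0 \<le> qf (P x x) (P y x) (P y y) u v"
          using sw[of v x y u] by (simp add: qf_def)
      qed (simp_all add: adjP)
      ultimately show "ppt2 (P x x) (P x y) (P y y)" by (simp add: ppt2_def adjP)
      have Qv: "cip f (Q s t *v f') = (\<Sum>j\<in>UNIV. \<Sum>i\<in>UNIV. cip (s j *s f) (W j i *v (t i *s f')))" for f f' s t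
        unfolding Q_def sum_mv cip_sum scal_simps by (simp add: cip_simps mv_smult mult_ac)
      fix \<alpha> \<beta> f
      \<comment> \<open>The pair \<alpha> f, \<beta> f corresponds to the product vector c tensor f,
        on which \<open>W\<close> is nonnegative.\<close>
      define c where "c i = \<alpha> * s i + \<beta> * t i" for i
      have "0 \<le> Re (\<Sum>j\<in>UNIV. \<Sum>i\<in>UNIV. cip (c j *s f) (W j i *v (c i *s f)))" by (rule bp)
      also have "(\<Sum>j\<in>UNIV. \<Sum>i\<in>UNIV. cip (c j *s f) (W j i *v (c i *s f)))
        = cip (\<alpha> *s f) (Q s s *v (\<alpha> *s f)) + cip (\<alpha> *s f) (Q s t *v (\<beta> *s f)) + cip (\<beta> *s f) (Q t s *v (\<alpha> *s f)) + cip (\<beta> *s f) (Q t t *v (\<beta> *s f))"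
        by (simp add: Qv c_def cip_simps mv_smult sum_3 algebra_simps)
      moreover have "Re (cip (\<beta> *s f) (Q t s *v (\<alpha> *s f))) = Re (cip (\<alpha> *s f) (Q s t *v (\<beta> *s f)))"
        by (metis adjQ Re_cip_sym cip_adj2)
      ultimately show "0 \<le> qf (Q s s) (Q s t) (Q t t) (\<alpha> *s f) (\<beta> *s f)"
        by (simp add: qf_def)
    qed
    moreover have "Re (trace (P x y ** Q t s)) = Re (trace (Q s t ** P y x))"
      unfolding trace_adj_mult[of "P x y"] by (simp add: adjP adjQ trace_mul_sym[of "Q s t"])
    ultimately have "0 \<le> Re (trace (P x x ** Q s s) + trace (P y x ** Q s t) + trace (P x y ** Q t s) + trace (P y y ** Q t t))"
      by (simp add: pairing_def adjP trace_mul_sym[of "Q _ _"])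
    also have "trace (P x x ** Q s s) + trace (P y x ** Q s t) + trace (P x y ** Q t s) + trace (P y y ** Q t t)
      = (\<Sum>i\<in>UNIV. \<Sum>j\<in>UNIV. cip (s i *s x + t i *s y) (U i j *v (s j *s x + t j *s y)))"
      unfolding PQ mv_simps(1) cip_simps(1,2) sum.distrib by (simp only: add_ac)
    finally show "0 \<le> Re (\<Sum>i\<in>UNIV. \<Sum>j\<in>UNIV. cip (s i *s x + t i *s y) (U i j *v (s j *s x + t j *s y)))" .
  qed
  moreover have "trace (C i j ** U j i) = trace ((\<Sum>a\<in>UNIV. \<Sum>b\<in>UNIV. scal (C i j $ a $ b) (C a b)) ** W j i)" for i j
    unfolding sum_mm trace_sum scal_simps trace_scal
    by (subst trace_def) (simp add: U_def matrix_matrix_mult_def[of "C i j"])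
  ultimately show ?thesis by (simp only:)
qed

section \<open>Separability of the composition\<close>

text \<open>The projector onto the product vector s tensor x, up to scaling. Iterated vectors
  instead of functions provide the inner product and topology needed for convex separation.\<close>

definition prodm :: "complex^3 \<Rightarrow> complex^3 \<Rightarrow> complex^3^3^3^3" where
  "prodm s x = (\<chi> i j. outer (s $ i *s x) (s $ j *s x))"

text \<open>Unit product projectors have trace 1, so their compact convex hull avoids 0 and
  generates a closed convex cone. A point outside is cut off by a hyperplane, whose Hermitian part
  is a block positive W violating \<open>pos\<close>.\<close>

lemma separable_of_pairing:
  fixes P :: block_matrix
  assumes herm: "\<And>i j. adj (P i j) = P j i"
    and pos: "\<And>W. (\<And>i j. adj (W i j) = W j i) \<Longrightarrow>
      (\<And>s x. 0 \<le> Re (\<Sum>i\<in>UNIV. \<Sum>j\<in>UNIV. cip (s i *s x) (W i j *v (s j *s x)))) \<Longrightarrow>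
      0 \<le> Re (\<Sum>i\<in>UNIV. \<Sum>j\<in>UNIV. trace (P i j ** W j i))"
  shows "\<exists>(N::nat) s x. \<forall>i j. P i j = (\<Sum>l<N. outer (s l i *s x l) (s l j *s x l))"
proof -
  define K where "K = (\<lambda>(s, x). prodm s x) ` (sphere 0 1 \<times> sphere 0 1)"
  define H where "H = convex hull K"
  define p where "p = (\<chi> i j. P i j)"
  define tr where "tr q = Re (\<Sum>i\<in>UNIV. trace (q $ i $ i))" for q :: "complex^3^3^3^3"
  have tr_lin: "tr (u *\<^sub>R q + v *\<^sub>R r) = u * tr q + v * tr r" for u v q r
    by (simp add: tr_def trace_def sum.distrib sum_distrib_left)
  have tr_prodm: "tr (prodm s x) = (norm s)\<^sup>2 * (norm x)\<^sup>2" for s x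
  proof -
    have "(\<Sum>i\<in>UNIV. trace (prodm s x $ i $ i)) = cip s s * cip x x"
      by (simp add: prodm_def trace_outer1 cip_simps) (simp add: cip_def[of s] sum_distrib_left mult_ac)
    then show ?thesis by (simp add: tr_def cip_self)
  qed
  have "continuous_on UNIV (\<lambda>z. prodm (fst z) (snd z))"
    unfolding prodm_def outer_def vector_scalar_mult_def by (auto intro!: continuous_intros)
  then have "compact K" unfolding K_def
    by (intro compact_continuous_image compact_Times) (auto simp: case_prod_unfold intro: continuous_on_subset)
  then have "compact H" unfolding H_def by (rule compact_convex_hull)
  have "H \<subseteq> {q. tr q = 1}" unfolding H_def
  proof (rule hull_minimal)
    show "K \<subseteq> {q. tr q = 1}" by (auto simp: K_def tr_prodm)
    show "convex {q. tr q = 1}" by (rule convexI) (simp add: tr_lin)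
  qed
  moreover have "tr 0 \<noteq> 1" by (simp add: tr_def trace_def)
  ultimately have "0 \<notin> H" by auto
  have cc: "closed (conic hull H)" "convex (conic hull H)"
    using closed_conic_hull[of H] \<open>compact H\<close> \<open>0 \<notin> H\<close> convex_conic_hull[of H] by (simp_all add: H_def)
  have "of_real ((norm (axis 1 1 :: complex^3))\<^sup>2) = (1 :: complex)"
    unfolding cip_self[symmetric] cip_axis by simp
  then have "(norm (axis 1 1 :: complex^3))\<^sup>2 = 1" by (metis of_real_eq_1_iff)
  then have norm_axis: "norm (axis 1 1 :: complex^3) = 1"
    by (simp add: power2_eq_1_iff)
  have "prodm (axis 1 1) (axis 1 1) \<in> H"
    unfolding H_def by (rule hull_inc) (auto simp: K_def norm_axis intro!: image_eqI[of _ _ "(axis 1 1, axis 1 1)"])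
  then have H0: "0 \<in> conic hull H" by auto
  have "p \<in> conic hull H"
  proof (rule ccontr)
    assume "p \<notin> conic hull H"
    then obtain a b where ab: "inner a p < b" "\<And>x. x \<in> conic hull H \<Longrightarrow> inner a x > b"
      using separating_hyperplane_closed_point[OF cc(2,1)] by blast
    have b: "b < 0" using ab(2)[OF H0] by simp
    have aH: "0 \<le> inner a h" if h: "h \<in> H" for h
    proof (rule ccontr)
      assume n: "\<not> 0 \<le> inner a h"
      \<comment> \<open>Rescaled in this way h has inner product exactly b with a, while points of
        the cone have more.\<close>
      have "(b / inner a h) *\<^sub>R h \<in> conic hull H"
        using h b n by (auto simp: conic_hull_explicit divide_nonpos_neg intro!: exI[of _ "b / inner a h"])
      from ab(2)[OF this] n show False by simp
    qed
    have in_tr: "inner a q = Re (\<Sum>i\<in>UNIV. \<Sum>j\<in>UNIV. trace (q $ i $ j ** adj (a $ i $ j)))" for q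
      by (simp add: inner_vec_def inner_complex_def trace_def matrix_matrix_mult_def adj_def sum_distrib_left algebra_simps)
    \<comment> \<open>The Hermitian part of the separating functional; it gives the same pairing
      with Hermitian block matrices.\<close>
    define W where "W i j = scal (1/2) (adj (a $ j $ i) + a $ i $ j)" for i j
    have Wh: "adj (W i j) = W j i" for i j
      by (simp add: W_def scal_simps adj_simps add.commute)
    have WI: "Re (\<Sum>i\<in>UNIV. \<Sum>j\<in>UNIV. trace (q i j ** W j i)) = inner a (\<chi> i j. q i j)"
      if q: "\<And>i j. adj (q i j) = q j i" for q
    proof -
      have "Re (trace (q i j ** a $ j $ i)) = Re (trace (q j i ** adj (a $ j $ i)))" for i j
        by (subst trace_adj_mult) (simp add: q)
      then have e: "Re (trace (q i j ** W j i)) = (Re (trace (q i j ** adj (a $ i $ j))) + Re (trace (q j i ** adj (a $ j $ i)))) / 2" for i j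
        by (simp add: W_def scal_simps trace_scal matrix_add_ldistrib trace_add)
      have "Re (\<Sum>i\<in>UNIV. \<Sum>j\<in>UNIV. trace (q i j ** W j i))
        = ((\<Sum>i\<in>UNIV. \<Sum>j\<in>UNIV. Re (trace (q i j ** adj (a $ i $ j)))) + (\<Sum>i\<in>UNIV. \<Sum>j\<in>UNIV. Re (trace (q j i ** adj (a $ j $ i))))) / 2"
        by (simp only: Re_sum e sum.distrib sum_divide_distrib[symmetric])
      also have "(\<Sum>i\<in>UNIV. \<Sum>j\<in>UNIV. Re (trace (q j i ** adj (a $ j $ i)))) = (\<Sum>i\<in>UNIV. \<Sum>j\<in>UNIV. Re (trace (q i j ** adj (a $ i $ j))))"
        by (rule sum.swap)
      finally show ?thesis by (simp add: in_tr)
    qed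
    have a_prodm: "0 \<le> inner a (prodm s x)" for s x
    proof (cases "s = 0 \<or> x = 0")
      case True
      then have "prodm s x = 0" by (auto simp: prodm_def outer_def vec_eq_iff)
      then show ?thesis by simp
    next
      case False
      define s' x' where "s' = of_real (1 / norm s) *s s" and "x' = of_real (1 / norm x) *s x"
      have nrm: "norm (of_real (1 / norm v) *s v) = 1" if "v \<noteq> 0" for v :: "complex^3"
      proof -
        have "of_real (1 / norm v) *s v = (1 / norm v) *\<^sub>R v" by (simp add: vec_eq_iff) (simp add: scaleR_conv_of_real)
        then show ?thesis using that by simp
      qed
      have "norm s' = 1" "norm x' = 1" unfolding s'_def x'_def by (rule nrm; use False in simp)+
      then have "prodm s' x' \<in> H" unfolding H_def
        by (intro hull_inc) (auto simp: K_def intro!: image_eqI[of _ _ "(s', x')"])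
      moreover have "s = of_real (norm s) *s s'" "x = of_real (norm x) *s x'"
        using False by (simp_all add: s'_def x'_def)
      moreover have "prodm (of_real r *s s') (of_real t *s x') = (r\<^sup>2 * t\<^sup>2) *\<^sub>R prodm s' x'" for r t
        by (simp add: prodm_def outer_def vec_eq_iff) (simp add: scaleR_conv_of_real power2_eq_square mult_ac)
      ultimately have "prodm s x = ((norm s)\<^sup>2 * (norm x)\<^sup>2) *\<^sub>R prodm s' x'" by metis
      then show ?thesis using aH[OF \<open>prodm s' x' \<in> H\<close>] by simp
    qed
    have "0 \<le> Re (\<Sum>i\<in>UNIV. \<Sum>j\<in>UNIV. trace (P i j ** W j i))"
    proof (rule pos[OF Wh])
      fix s :: "3 \<Rightarrow> complex" and x :: "complex^3"
      define q where "q i j = outer (s i *s x) (s j *s x)" for i j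
      have "(\<Sum>i\<in>UNIV. \<Sum>j\<in>UNIV. cip (s i *s x) (W i j *v (s j *s x))) = (\<Sum>i\<in>UNIV. \<Sum>j\<in>UNIV. trace (q j i ** W i j))"
        unfolding q_def trace_mul_sym[of "outer _ _"] trace_outer ..
      also have "\<dots> = (\<Sum>i\<in>UNIV. \<Sum>j\<in>UNIV. trace (q i j ** W j i))" by (rule sum.swap)
      also have "Re \<dots> = inner a (\<chi> i j. q i j)" by (rule WI) (simp add: q_def adj_outer)
      also have "(\<chi> i j. q i j) = prodm (\<chi> i. s i) x" by (simp add: prodm_def q_def)
      finally show "0 \<le> Re (\<Sum>i\<in>UNIV. \<Sum>j\<in>UNIV. cip (s i *s x) (W i j *v (s j *s x)))"
        using a_prodm by simp
    qed
    then have "0 \<le> inner a p" using WI[of P] herm by (simp add: p_def)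
    then show False using ab(1) b by simp
  qed
  then obtain c h where ch: "0 \<le> c" "h \<in> H" "p = c *\<^sub>R h" by (auto simp: conic_hull_explicit)
  obtain n u g where g: "\<forall>i\<in>{1::nat..n}. 0 \<le> u i \<and> g i \<in> K" "(\<Sum>i = 1..n. u i *\<^sub>R g i) = h"
    using ch(2) unfolding H_def convex_hull_indexed by auto
  have "g (Suc l) \<in> K" if "l < n" for l using g(1) that by simp
  then have "\<forall>l<n. \<exists>s x. g (Suc l) = prodm s x" unfolding K_def by fast
  then obtain s x where sx: "\<And>l. l < n \<Longrightarrow> g (Suc l) = prodm (s l) (x l)" by metis
  \<comment> \<open>The nonnegative weight enters \<open>outer\<close> twice, hence the square root;
    \<open>Suc\<close> shifts the index set 1..n of the convex combination to l < n.\<close>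
  define S where "S l i = complex_of_real (sqrt (c * u (Suc l))) * s l $ i" for l i
  have "P i j = (\<Sum>l<n. outer (S l i *s x l) (S l j *s x l))" for i j
  proof -
    have "h = (\<Sum>l<n. u (Suc l) *\<^sub>R g (Suc l))"
      unfolding g(2)[symmetric] by (rule sum.reindex_bij_witness[of _ Suc "\<lambda>i. i - 1"]) auto
    then have "p = (\<Sum>l<n. (c * u (Suc l)) *\<^sub>R prodm (s l) (x l))"
      by (simp add: ch(3) scaleR_sum_right sx)
    moreover have "P i j = p $ i $ j" by (simp add: p_def)
    ultimately have "P i j = (\<Sum>l<n. (c * u (Suc l)) *\<^sub>R outer (s l $ i *s x l) (s l $ j *s x l))"
      by (simp add: prodm_def)
    also have "\<dots> = (\<Sum>l<n. outer (S l i *s x l) (S l j *s x l))"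
    proof (rule sum.cong[OF refl])
      fix l assume "l \<in> {..<n}"
      then have "0 \<le> c * u (Suc l)" using ch(1) g(1) by simp
      then have r: "complex_of_real (c * u (Suc l)) = complex_of_real (sqrt (c * u (Suc l))) * complex_of_real (sqrt (c * u (Suc l)))"
        unfolding of_real_mult[symmetric] by simp
      show "(c * u (Suc l)) *\<^sub>R outer (s l $ i *s x l) (s l $ j *s x l) = outer (S l i *s x l) (S l j *s x l)"
        by (intro vec_eq_iff[THEN iffD2] allI)
          (simp only: outer_def S_def vec_lambda_beta vector_scaleR_component vector_smult_component
            complex_cnj_mult complex_cnj_complex_of_real, simp only: scaleR_conv_of_real r mult_ac)
    qed
    finally show ?thesis .
  qed
  then show ?thesis by blast
qed

text \<open>The quadratic form is a sum of squared moduli. With one summand this yields rank-one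
  matrices, which is why later definitions carry a sum over a single index.\<close>

lemma psd_mat_gram:
  "psd_mat n (Matrix.mat n n (\<lambda>(r, s). \<Sum>l<N. z l r * cnj (z l s)))"
  unfolding psd_mat_def
proof (intro conjI allI impI)
  fix v :: "nat \<Rightarrow> complex"
  have "(\<Sum>i<n. \<Sum>j<n. cnj (v i) * Matrix.mat n n (\<lambda>(r, s). \<Sum>l<N. z l r * cnj (z l s)) $$ (i, j) * v j)
    = (\<Sum>i<n. \<Sum>j<n. \<Sum>l<N. cnj (v i) * z l i * (cnj (z l j) * v j))"
    by (simp add: sum_distrib_left sum_distrib_right mult.assoc)
  also have "\<dots> = (\<Sum>i<n. \<Sum>l<N. \<Sum>j<n. cnj (v i) * z l i * (cnj (z l j) * v j))"
    by (intro sum.cong refl sum.swap)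
  also have "\<dots> = (\<Sum>l<N. \<Sum>i<n. \<Sum>j<n. cnj (v i) * z l i * (cnj (z l j) * v j))"
    by (rule sum.swap)
  also have "\<dots> = (\<Sum>l<N. of_real ((cmod (\<Sum>i<n. cnj (v i) * z l i))\<^sup>2))"
    unfolding complex_norm_square cnj_sum sum_product by (simp add: mult_ac)
  also have "\<dots> = of_real (\<Sum>l<N. (cmod (\<Sum>i<n. cnj (v i) * z l i))\<^sup>2)" by simp
  finally have e: "(\<Sum>i<n. \<Sum>j<n. cnj (v i) * Matrix.mat n n (\<lambda>(r, s). \<Sum>l<N. z l r * cnj (z l s)) $$ (i, j) * v j)
    = of_real (\<Sum>l<N. (cmod (\<Sum>i<n. cnj (v i) * z l i))\<^sup>2)" .
  show "(\<Sum>i<n. \<Sum>j<n. cnj (v i) * Matrix.mat n n (\<lambda>(r, s). \<Sum>l<N. z l r * cnj (z l s)) $$ (i, j) * v j) \<in> \<real>"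
    unfolding e by (rule Reals_of_real)
  show "0 \<le> Re (\<Sum>i<n. \<Sum>j<n. cnj (v i) * Matrix.mat n n (\<lambda>(r, s). \<Sum>l<N. z l r * cnj (z l s)) $$ (i, j) * v j)"
    unfolding e Re_complex_of_real by (intro sum_nonneg) simp
qed (simp_all add: mult.commute)

section \<open>From \<open>nat\<close>-indexed Choi matrices to block matrices\<close>

definition ix :: "3 \<Rightarrow> nat" where "ix i = (if i = 1 then 1 else if i = 2 then 2 else 0)"
text \<open>In the type \<open>3\<close> the literals 3 and 0 denote the same element, so the index
  3 corresponds to the natural number 0.\<close>

definition ty :: "nat \<Rightarrow> 3" where "ty n = (if n = 1 then 1 else if n = 2 then 2 else 3)"

lemma ix_less: "ix i < 3" by (simp add: ix_def)

lemma ix_ty: "n < 3 \<Longrightarrow> ix (ty n) = n" by (auto simp: ix_def ty_def)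

lemma ty_ix: "ty (ix i) = i"
  using exhaust_3[of i] by (auto simp: ix_def ty_def)

lemma sum_ix: "(\<Sum>i\<in>UNIV. f (ix i)) = (\<Sum>i<3. f i)" for f :: "nat \<Rightarrow> 'a::comm_monoid_add"
  by (rule sum.reindex_bij_witness[of _ ty ix]) (auto simp: ix_ty ty_ix ix_less)

lemma sum_divmod3: "(\<Sum>r<3*3. f (r div 3) (r mod 3)) = (\<Sum>i<3. \<Sum>a<3. f i (a::nat))" for f :: "nat \<Rightarrow> nat \<Rightarrow> 'a::comm_monoid_add"
  unfolding sum.cartesian_product
  by (rule sum.reindex_bij_witness[of _ "\<lambda>(i, a). 3 * i + a" "\<lambda>r. (r div 3, r mod 3)"]) auto

definition choi_blocks :: "(complex Matrix.mat \<Rightarrow> complex Matrix.mat) \<Rightarrow> block_matrix" where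
  "choi_blocks \<phi> i j = (\<chi> a b. \<phi> (mat_unit 3 (ix i) (ix j)) $$ (ix a, ix b))"

text \<open>The Choi matrix is the ampliation applied to X, the unnormalised projector onto the sum
  of e_i tensor e_i, whose (a, b) block is the matrix unit E_ab.\<close>

lemma psd_mat_choi:
  assumes cp: "completely_positive 3 \<phi>"
  shows "psd_mat (3 * 3) (choi_mat 3 \<phi>)"
proof -
  define X where "X = Matrix.mat (3*3) (3*3) (\<lambda>(r, s). \<Sum>l<(1::nat). (if r div 3 = r mod 3 then 1 else 0) * cnj (if s div 3 = s mod 3 then 1 else (0::complex)))"
  have b: "block_mat 3 X a b = mat_unit 3 a b" if "a < 3" "b < 3" for a b
  proof (rule eq_matI)
    fix i j assume "i < dim_row (mat_unit 3 a b)" "j < dim_col (mat_unit 3 a b)"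
    then have ij: "i < 3" "j < 3" by (simp_all add: mat_unit_def)
    then have "a * 3 + i < 3 * 3" "b * 3 + j < 3 * 3" using that by linarith+
    then show "block_mat 3 X a b $$ (i, j) = mat_unit 3 a b $$ (i, j)"
      using ij by (simp add: block_mat_def X_def mat_unit_def)
  qed (simp_all add: block_mat_def mat_unit_def)
  have "psd_mat (3*3) X" unfolding X_def by (rule psd_mat_gram)
  then have "psd_mat (3*3) (ampliation 3 3 \<phi> X)" using cp unfolding completely_positive_def by blast
  moreover have "ampliation 3 3 \<phi> X = choi_mat 3 \<phi>"
    unfolding ampliation_def choi_mat_def by (rule cong_mat) (auto simp: b)
  ultimately show ?thesis by simp
qed

lemma block_psd_choi:
  assumes "psd_mat (3 * 3) (choi_mat 3 \<phi>)"
  shows "block_psd (choi_blocks \<phi>)"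
  unfolding block_psd_def
proof (intro conjI allI)
  have e: "choi_mat 3 \<phi> $$ (3 * i + a, 3 * j + b) = \<phi> (mat_unit 3 i j) $$ (a, b)" if "i < 3" "j < 3" "a < 3" "b < 3" for i j a b
  proof -
    have "3 * i + a < 3 * 3" "3 * j + b < 3 * 3" using that by linarith+
    then show ?thesis using that by (simp add: choi_mat_def)
  qed
  show "adj (choi_blocks \<phi> i j) = choi_blocks \<phi> j i" for i j
  proof -
    have "\<phi> (mat_unit 3 (ix i) (ix j)) $$ (ix b, ix a) = cnj (\<phi> (mat_unit 3 (ix j) (ix i)) $$ (ix a, ix b))" for a b
    proof -
      have "3 * ix i + ix b < 3 * 3" "3 * ix j + ix a < 3 * 3"
        using ix_less[of i] ix_less[of j] ix_less[of a] ix_less[of b] by linarith+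
      then have "choi_mat 3 \<phi> $$ (3 * ix i + ix b, 3 * ix j + ix a) = cnj (choi_mat 3 \<phi> $$ (3 * ix j + ix a, 3 * ix i + ix b))"
        using assms unfolding psd_mat_def by blast
      then show ?thesis by (simp add: e ix_less)
    qed
    then show ?thesis by (simp add: choi_blocks_def adj_def vec_eq_iff)
  qed
  fix v :: "3 \<Rightarrow> complex^3"
  define V where "V r = v (ty (r div 3)) $ ty (r mod 3)" for r
  have "0 \<le> Re (\<Sum>r<3*3. \<Sum>s<3*3. cnj (V r) * choi_mat 3 \<phi> $$ (r, s) * V s)"
    using assms unfolding psd_mat_def by blast
  also have "(\<Sum>r<3*3. \<Sum>s<3*3. cnj (V r) * choi_mat 3 \<phi> $$ (r, s) * V s)
    = (\<Sum>r<3*3. \<Sum>s<3*3. cnj (v (ty (r div 3)) $ ty (r mod 3)) * \<phi> (mat_unit 3 (r div 3) (s div 3)) $$ (r mod 3, s mod 3) * v (ty (s div 3)) $ ty (s mod 3))"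
    by (simp add: V_def choi_mat_def)
  also have "\<dots> = (\<Sum>i<3. \<Sum>a<3. \<Sum>j<3. \<Sum>b<3. cnj (v (ty i) $ ty a) * \<phi> (mat_unit 3 i j) $$ (a, b) * v (ty j) $ ty b)"
    unfolding sum_divmod3[where f = "\<lambda>j b. cnj (v (ty _) $ ty _) * \<phi> (mat_unit 3 _ j) $$ (_, b) * v (ty j) $ ty b"]
    by (rule sum_divmod3)
  also have "\<dots> = (\<Sum>i\<in>UNIV. \<Sum>a\<in>UNIV. \<Sum>j\<in>UNIV. \<Sum>b\<in>UNIV. cnj (v i $ a) * choi_blocks \<phi> i j $ a $ b * v j $ b)"
    by (simp add: sum_ix[symmetric] ty_ix choi_blocks_def)
  also have "\<dots> = (\<Sum>i\<in>UNIV. \<Sum>j\<in>UNIV. \<Sum>a\<in>UNIV. \<Sum>b\<in>UNIV. cnj (v i $ a) * choi_blocks \<phi> i j $ a $ b * v j $ b)"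
    by (intro sum.cong refl sum.swap)
  also have "\<dots> = (\<Sum>i\<in>UNIV. \<Sum>j\<in>UNIV. cip (v i) (choi_blocks \<phi> i j *v v j))"
    by (simp add: cip_def matrix_vector_mult_def sum_distrib_left mult.assoc)
  finally show "0 \<le> Re (\<Sum>i\<in>UNIV. \<Sum>j\<in>UNIV. cip (v i) (choi_blocks \<phi> i j *v v j))" .
qed

text \<open>Transposing every block is the full transposition followed by an exchange of the block
  indices. The full transposition is absorbed by conjugating the test vector, which is the choice of
  \<open>w\<close>.\<close>

lemma block_ppt_choi:
  assumes "PPT_map 3 \<phi>"
  shows "block_ppt (choi_blocks \<phi>)"
proof -
  define \<psi> where "\<psi> A = transpose_mat (\<phi> A)" for A
  have c1: "block_psd (choi_blocks \<phi>)"
    using assms by (intro block_psd_choi psd_mat_choi) (simp add: PPT_map_def)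
  have c2: "block_psd (choi_blocks \<psi>)"
    using assms unfolding \<psi>_def by (intro block_psd_choi psd_mat_choi) (simp add: PPT_map_def completely_copositive_def)
  have car: "\<phi> (mat_unit 3 i j) \<in> carrier_mat 3 3" for i j
    using assms by (simp add: PPT_map_def linear_map_mat_def mat_unit_def)
  have t: "choi_blocks \<psi> i j $ a $ b = choi_blocks \<phi> i j $ b $ a" for i j a b
    using car[of "ix i" "ix j"] ix_less[of a] ix_less[of b] by (simp add: choi_blocks_def \<psi>_def)
  have "block_psd (\<lambda>i j. choi_blocks \<phi> j i)"
    unfolding block_psd_def
  proof (intro conjI allI)
    show "adj (choi_blocks \<phi> j i) = choi_blocks \<phi> i j" for i j using c1 by (simp add: block_psd_def)
    fix v :: "3 \<Rightarrow> complex^3"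
    define w where "w i = (\<chi> a. cnj (v i $ a))" for i
    have e: "cip (w i) (choi_blocks \<psi> i j *v w j) = cip (v j) (choi_blocks \<phi> i j *v v i)" for i j
    proof -
      have "cip (w i) (choi_blocks \<psi> i j *v w j) = (\<Sum>a\<in>UNIV. \<Sum>b\<in>UNIV. v i $ a * choi_blocks \<phi> i j $ b $ a * cnj (v j $ b))"
        by (simp add: cip_def matrix_vector_mult_def sum_distrib_left w_def t mult.assoc)
      also have "\<dots> = (\<Sum>b\<in>UNIV. \<Sum>a\<in>UNIV. v i $ a * choi_blocks \<phi> i j $ b $ a * cnj (v j $ b))" by (rule sum.swap)
      also have "\<dots> = cip (v j) (choi_blocks \<phi> i j *v v i)"
        by (simp add: cip_def matrix_vector_mult_def sum_distrib_left mult_ac)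
      finally show ?thesis .
    qed
    have "0 \<le> Re (\<Sum>i\<in>UNIV. \<Sum>j\<in>UNIV. cip (w i) (choi_blocks \<psi> i j *v w j))" using c2 by (simp add: block_psd_def)
    also have "(\<Sum>i\<in>UNIV. \<Sum>j\<in>UNIV. cip (w i) (choi_blocks \<psi> i j *v w j)) = (\<Sum>j\<in>UNIV. \<Sum>i\<in>UNIV. cip (v j) (choi_blocks \<phi> i j *v v i))"
      unfolding e by (rule sum.swap)
    finally show "0 \<le> Re (\<Sum>i\<in>UNIV. \<Sum>j\<in>UNIV. cip (v i) (choi_blocks \<phi> j i *v v j))" .
  qed
  then show ?thesis using c1 by (simp add: block_ppt_def)
qed

lemma linear_map_mat_expand:
  assumes lin: "linear_map_mat 3 \<phi>" and A: "A \<in> carrier_mat 3 3" and kl: "k < 3" "l < 3"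
  shows "\<phi> A $$ (k, l) = (\<Sum>a<3. \<Sum>b<3. A $$ (a, b) * \<phi> (mat_unit 3 a b) $$ (k, l))"
proof -
  define u where "u a b = A $$ (a, b) \<cdot>\<^sub>m mat_unit 3 a b" for a b
  have uc: "u a b \<in> carrier_mat 3 3" "mat_unit 3 a b \<in> carrier_mat 3 3" for a b by (simp_all add: u_def mat_unit_def)
  have add: "\<phi> (B + C) = \<phi> B + \<phi> C" "B + C \<in> carrier_mat 3 3" "\<phi> B \<in> carrier_mat 3 3" if "B \<in> carrier_mat 3 3" "C \<in> carrier_mat 3 3" for B C
    using lin that by (simp_all add: linear_map_mat_def)
  have addkl: "\<phi> (B + C) $$ (k, l) = \<phi> B $$ (k, l) + \<phi> C $$ (k, l)" if "B \<in> carrier_mat 3 3" "C \<in> carrier_mat 3 3" for B C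
    using add[OF that] add(3)[OF that(2) that(2)] kl by simp
  have ukl: "\<phi> (u a b) $$ (k, l) = A $$ (a, b) * \<phi> (mat_unit 3 a b) $$ (k, l)" for a b
  proof -
    have "\<phi> (u a b) = A $$ (a, b) \<cdot>\<^sub>m \<phi> (mat_unit 3 a b)" using lin uc by (simp add: linear_map_mat_def u_def)
    moreover have "\<phi> (mat_unit 3 a b) \<in> carrier_mat 3 3" using add(3)[OF uc(2) uc(2)] .
    ultimately show ?thesis using kl by simp
  qed
  \<comment> \<open>The nine terms are spelled out because linearity is given for binary sums; the
    nesting to the right lets \<open>addkl\<close> peel them off.\<close>
  have "A = u 0 0 + (u 0 1 + (u 0 2 + (u 1 0 + (u 1 1 + (u 1 2 + (u 2 0 + (u 2 1 + u 2 2)))))))"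
  proof (rule eq_matI)
    fix i j :: nat
    assume "i < dim_row (u 0 0 + (u 0 1 + (u 0 2 + (u 1 0 + (u 1 1 + (u 1 2 + (u 2 0 + (u 2 1 + u 2 2))))))))"
      "j < dim_col (u 0 0 + (u 0 1 + (u 0 2 + (u 1 0 + (u 1 1 + (u 1 2 + (u 2 0 + (u 2 1 + u 2 2))))))))"
    then have "i < 3" "j < 3" by (simp_all add: u_def mat_unit_def)
    then have "(i = 0 \<or> i = 1 \<or> i = 2) \<and> (j = 0 \<or> j = 1 \<or> j = 2)" by linarith
    then show "A $$ (i, j) = (u 0 0 + (u 0 1 + (u 0 2 + (u 1 0 + (u 1 1 + (u 1 2 + (u 2 0 + (u 2 1 + u 2 2)))))))) $$ (i, j)"
      by (auto simp: u_def mat_unit_def)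
  qed (use A in \<open>simp_all add: u_def mat_unit_def\<close>)
  then have "\<phi> A $$ (k, l) = \<phi> (u 0 0 + (u 0 1 + (u 0 2 + (u 1 0 + (u 1 1 + (u 1 2 + (u 2 0 + (u 2 1 + u 2 2)))))))) $$ (k, l)"
    by simp
  also have "\<dots> = (\<Sum>a<3. \<Sum>b<3. A $$ (a, b) * \<phi> (mat_unit 3 a b) $$ (k, l))"
  proof -
    have "(\<Sum>a<3. f a) = f 0 + (f 1 + f 2)" for f :: "nat \<Rightarrow> complex" by (simp add: eval_nat_numeral)
    then show ?thesis by (simp add: addkl ukl uc)
  qed
  finally show ?thesis .
qed

theorem theorem1:
  fixes \<phi> :: "complex mat \<Rightarrow> complex mat"
  assumes "PPT_map 3 \<phi>"
  shows "separable_map 3 (\<phi> \<circ> \<phi>)"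
proof -
  define C where "C = choi_blocks \<phi>"
  \<comment> \<open>Expanding the inner value \<phi>(E_ij) in matrix units shows that these are the
    Choi blocks of the composition; \<open>entry\<close> below verifies it.\<close>
  define P where "P i j = (\<Sum>a\<in>UNIV. \<Sum>b\<in>UNIV. scal (C i j $ a $ b) (C a b))" for i j
  have C: "block_ppt C" unfolding C_def using assms by (rule block_ppt_choi)
  have Ch: "adj (C i j) = C j i" for i j using C by (simp add: block_ppt_def block_psd_def)
  have Ph: "adj (P i j) = P j i" for i j
  proof -
    have "cnj (C i j $ a $ b) = C j i $ b $ a" for a b
      by (simp add: Ch[of i j, symmetric]) (simp add: adj_def)
    then show ?thesis unfolding P_def adj_sum scal_simps Ch by (subst sum.swap) simp
  qed
  have "\<exists>(N::nat) s x. \<forall>i j. P i j = (\<Sum>l<N. outer (s l i *s x l) (s l j *s x l))"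
    by (rule separable_of_pairing[OF Ph]) (unfold P_def, rule composition_pairing[OF C])
  then obtain N s x where sep: "\<And>i j. P i j = (\<Sum>l<(N::nat). outer (s l i *s x l) (s l j *s x l))"
    by blast
  have lin: "linear_map_mat 3 \<phi>" using assms by (simp add: PPT_map_def)
  have car: "\<phi> (mat_unit 3 i j) \<in> carrier_mat 3 3" for i j
    using lin by (simp add: linear_map_mat_def mat_unit_def)
  have entry: "(\<phi> \<circ> \<phi>) (mat_unit 3 i j) $$ (k, l) = P (ty i) (ty j) $ ty k $ ty l" if "i < 3" "j < 3" "k < 3" "l < 3" for i j k l
  proof -
    have "(\<phi> \<circ> \<phi>) (mat_unit 3 i j) $$ (k, l) = (\<Sum>a<3. \<Sum>b<3. \<phi> (mat_unit 3 i j) $$ (a, b) * \<phi> (mat_unit 3 a b) $$ (k, l))"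
      using linear_map_mat_expand[OF lin car that(3,4)] by simp
    also have "\<dots> = (\<Sum>a\<in>UNIV. \<Sum>b\<in>UNIV. C (ty i) (ty j) $ a $ b * C a b $ ty k $ ty l)"
      using that by (simp add: sum_ix[symmetric] C_def choi_blocks_def ix_ty)
    also have "\<dots> = P (ty i) (ty j) $ ty k $ ty l" by (simp add: P_def scal_def)
    finally show ?thesis .
  qed
  \<comment> \<open>Rank-one factors of the projector onto s tensor x, written as one-term sums to
    match \<open>psd_mat_gram\<close>.\<close>
  define \<alpha> where "\<alpha> l = Matrix.mat 3 3 (\<lambda>(i, j). \<Sum>m<(1::nat). s l (ty i) * cnj (s l (ty j)))" for l
  define \<beta> where "\<beta> l = Matrix.mat 3 3 (\<lambda>(i, j). \<Sum>m<(1::nat). x l $ ty i * cnj (x l $ ty j))" for l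
  have eq: "choi_mat 3 (\<phi> \<circ> \<phi>) = Matrix.mat (3*3) (3*3) (\<lambda>(r, t). \<Sum>l<N. (s l (ty (r div 3)) * x l $ ty (r mod 3)) * cnj (s l (ty (t div 3)) * x l $ ty (t mod 3)))"
    unfolding choi_mat_def
  proof (rule cong_mat[OF refl refl])
    fix r t :: nat assume "r < 3 * 3" "t < 3 * 3"
    then have "r div 3 < 3" "t div 3 < 3" by simp_all
    then show "(\<lambda>(r, t). (\<phi> \<circ> \<phi>) (mat_unit 3 (r div 3) (t div 3)) $$ (r mod 3, t mod 3)) (r, t) =
      (\<lambda>(r, t). \<Sum>l<N. (s l (ty (r div 3)) * x l $ ty (r mod 3)) * cnj (s l (ty (t div 3)) * x l $ ty (t mod 3))) (r, t)"
      by (simp only: entry prod.case mod_less_divisor zero_less_numeral sep) (simp add: outer_def)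
  qed
  have "psd_mat (3*3) (choi_mat 3 (\<phi> \<circ> \<phi>))" unfolding eq by (rule psd_mat_gram)
  moreover have "psd_mat 3 (\<alpha> l) \<and> psd_mat 3 (\<beta> l)" for l
    unfolding \<alpha>_def \<beta>_def by (intro conjI psd_mat_gram)
  moreover have "choi_mat 3 (\<phi> \<circ> \<phi>) = Matrix.mat (3*3) (3*3) (\<lambda>(r, t). \<Sum>l<N. kron_mat 3 3 (\<alpha> l) (\<beta> l) $$ (r, t))"
    unfolding eq
  proof (rule cong_mat[OF refl refl])
    fix r t :: nat assume "r < 3 * 3" "t < 3 * 3"
    then show "(\<lambda>(r, t). \<Sum>l<N. (s l (ty (r div 3)) * x l $ ty (r mod 3)) * cnj (s l (ty (t div 3)) * x l $ ty (t mod 3))) (r, t) =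
      (\<lambda>(r, t). \<Sum>l<N. kron_mat 3 3 (\<alpha> l) (\<beta> l) $$ (r, t)) (r, t)"
      by (simp add: kron_mat_def \<alpha>_def \<beta>_def mult_ac)
  qed
  ultimately show ?thesis
    unfolding separable_map_def separable_mat_def by blast
qed

end
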